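(* Consider the urn model described in the context. Assume that there is an integer constant $C$ with $A_n\vee B_n\vee N_n\le C$ for all $n\ge 1$; that $E[A_n]=E[B_n]=m_n$ for all $n$, with $m_n\to m\in(0,+\infty)$; that $$E[N_n|\mathcal F_{n-1}]\xrightarrow{a.s.}N,\qquad E[N_n^2|\mathcal F_{n-1}]\xrightarrow{a.s.}Q,$$ where $N$ and $Q$ are strictly positive finite random variables; and that $$E[A_n^2]\to q_A,\qquad E[B_n^2]\to q_B,\qquad E[A_nB_n]\to q_{AB},$$ where $q_A,q_B,q_{AB}$ are strictly positive finite constants. Let $Z$ be the almost sure limit of $Z_n$ (which exists under these assumptions). Then $P(Z=z)=0$ for all $z\in[0,1]$.
   Context: Urn model. An urn initially contains $a\ge 1$ balls of color A and $b\ge 1$ balls of color B ($a,b$ integers). On a probability space $(\Omega,\mathcal A,P)$ there are random variables $N_n,X_n,A_n,B_n$, $n\ge 1$, where $N_n$ is the size of the sample drawn without replacement at time $n$, $X_n$ is the number of sampled balls of color A, and after the draw the sampled balls are returned together with $A_nX_n$ new balls of color A and $B_n(N_n-X_n)$ new balls of color B. Put, for $n\ge 0$, $H_n=a+\sum_{j=1}^n A_jX_j$ (balls of color A), $K_n=b+\sum_{j=1}^n B_j(N_j-X_j)$ (balls of color B), $S_n=H_n+K_n$. For each $n\ge1$: (A1) the conditional distribution of $N_n$ given $[N_1,X_1,A_1,B_1,\dots,N_{n-1},X_{n-1},A_{n-1},B_{n-1}]$ is concentrated on $\{1,\dots,S_{n-1}\}$; (A2) the conditional distribution of $X_n$ given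 $[N_1,X_1,A_1,B_1,\dots,N_{n-1},X_{n-1},A_{n-1},B_{n-1},N_n]$ is hypergeometric with parameters $N_n,S_{n-1},H_{n-1}$, i.e. it gives mass $\binom{H_{n-1}}{k}\binom{S_{n-1}-H_{n-1}}{N_n-k}/\binom{S_{n-1}}{N_n}$ to $k$; (A3) the random vector $[A_n,B_n]$ takes values in $(\mathbb N\setminus\{0\})^2$ and is independent of $[N_1,X_1,A_1,B_1,\dots,N_{n-1},X_{n-1},A_{n-1},B_{n-1},N_n,X_n]$ ($A_n$ and $B_n$ may be correlated with each other and their law may depend on $n$). The proportion of balls of color A is $Z_n=H_n/S_n$, $n\ge0$. Filtration: $\mathcal F_0=\{\emptyset,\Omega\}$, $\mathcal F_n=\sigma(N_1,X_1,A_1,B_1,\dots,N_n,X_n,A_n,B_n)$ for $n\ge1$. *)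

theory Defs
  imports "HOL-Probability.Probability"
begin

(* Time runs from 1; the values of the sequences at index 0 are never constrained. *)

definition urn_step ::
  "(nat \<Rightarrow> 'w \<Rightarrow> nat) \<Rightarrow> (nat \<Rightarrow> 'w \<Rightarrow> nat) \<Rightarrow> (nat \<Rightarrow> 'w \<Rightarrow> nat) \<Rightarrow> (nat \<Rightarrow> 'w \<Rightarrow> nat)
    \<Rightarrow> nat \<Rightarrow> 'w \<Rightarrow> nat \<times> nat \<times> nat \<times> nat" where
  "urn_step N X A B j \<omega> = (N j \<omega>, X j \<omega>, A j \<omega>, B j \<omega>)"

(* The random vector [N_1, X_1, A_1, B_1, ..., N_n, X_n, A_n, B_n]. *)
definition urn_history ::
  "(nat \<Rightarrow> 'w \<Rightarrow> nat) \<Rightarrow> (nat \<Rightarrow> 'w \<Rightarrow> nat) \<Rightarrow> (nat \<Rightarrow> 'w \<Rightarrow> nat) \<Rightarrow> (nat \<Rightarrow> 'w \<Rightarrow> nat)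
    \<Rightarrow> nat \<Rightarrow> 'w \<Rightarrow> nat \<Rightarrow> nat \<times> nat \<times> nat \<times> nat" where
  "urn_history N X A B n \<omega> = (\<lambda>j\<in>{1..n}. urn_step N X A B j \<omega>)"

definition history_space :: "nat \<Rightarrow> (nat \<Rightarrow> nat \<times> nat \<times> nat \<times> nat) measure" where
  "history_space n = PiM {1..n} (\<lambda>_. count_space UNIV)"

(* For n = 0 the space of histories has a single point, so this is the trivial sigma-algebra. *)
definition urn_filtration ::
  "'w measure \<Rightarrow> (nat \<Rightarrow> 'w \<Rightarrow> nat) \<Rightarrow> (nat \<Rightarrow> 'w \<Rightarrow> nat) \<Rightarrow> (nat \<Rightarrow> 'w \<Rightarrow> nat) \<Rightarrow> (nat \<Rightarrow> 'w \<Rightarrow> nat)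
    \<Rightarrow> nat \<Rightarrow> 'w measure" where
  "urn_filtration M N X A B n =
     vimage_algebra (space M) (urn_history N X A B n) (history_space n)"

(* The sigma-algebra of [N_1, X_1, A_1, B_1, ..., N_(n-1), X_(n-1), A_(n-1), B_(n-1), N_n]. *)
definition urn_before_draw ::
  "'w measure \<Rightarrow> (nat \<Rightarrow> 'w \<Rightarrow> nat) \<Rightarrow> (nat \<Rightarrow> 'w \<Rightarrow> nat) \<Rightarrow> (nat \<Rightarrow> 'w \<Rightarrow> nat) \<Rightarrow> (nat \<Rightarrow> 'w \<Rightarrow> nat)
    \<Rightarrow> nat \<Rightarrow> 'w measure" where
  "urn_before_draw M N X A B n =
     vimage_algebra (space M) (\<lambda>\<omega>. (urn_history N X A B (n - 1) \<omega>, N n \<omega>))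
       (history_space (n - 1) \<Otimes>\<^sub>M count_space UNIV)"

(* The sigma-algebra of [N_1, X_1, A_1, B_1, ..., N_(n-1), X_(n-1), A_(n-1), B_(n-1), N_n, X_n]. *)
definition urn_after_draw ::
  "'w measure \<Rightarrow> (nat \<Rightarrow> 'w \<Rightarrow> nat) \<Rightarrow> (nat \<Rightarrow> 'w \<Rightarrow> nat) \<Rightarrow> (nat \<Rightarrow> 'w \<Rightarrow> nat) \<Rightarrow> (nat \<Rightarrow> 'w \<Rightarrow> nat)
    \<Rightarrow> nat \<Rightarrow> 'w measure" where
  "urn_after_draw M N X A B n =
     vimage_algebra (space M) (\<lambda>\<omega>. (urn_history N X A B (n - 1) \<omega>, N n \<omega>, X n \<omega>))
       (history_space (n - 1) \<Otimes>\<^sub>M count_space UNIV \<Otimes>\<^sub>M count_space UNIV)"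

definition balls_A ::
  "nat \<Rightarrow> (nat \<Rightarrow> 'w \<Rightarrow> nat) \<Rightarrow> (nat \<Rightarrow> 'w \<Rightarrow> nat) \<Rightarrow> nat \<Rightarrow> 'w \<Rightarrow> nat" where
  "balls_A a X A n \<omega> = a + (\<Sum>j=1..n. A j \<omega> * X j \<omega>)"

(* Truncated subtraction is harmless: in the urn model, X j \<le> N j almost surely for j \<ge> 1. *)
definition balls_B ::
  "nat \<Rightarrow> (nat \<Rightarrow> 'w \<Rightarrow> nat) \<Rightarrow> (nat \<Rightarrow> 'w \<Rightarrow> nat) \<Rightarrow> (nat \<Rightarrow> 'w \<Rightarrow> nat) \<Rightarrow> nat \<Rightarrow> 'w \<Rightarrow> nat" where
  "balls_B b N X B n \<omega> = b + (\<Sum>j=1..n. B j \<omega> * (N j \<omega> - X j \<omega>))"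

definition balls_total ::
  "nat \<Rightarrow> nat \<Rightarrow> (nat \<Rightarrow> 'w \<Rightarrow> nat) \<Rightarrow> (nat \<Rightarrow> 'w \<Rightarrow> nat) \<Rightarrow> (nat \<Rightarrow> 'w \<Rightarrow> nat) \<Rightarrow> (nat \<Rightarrow> 'w \<Rightarrow> nat)
    \<Rightarrow> nat \<Rightarrow> 'w \<Rightarrow> nat" where
  "balls_total a b N X A B n \<omega> = balls_A a X A n \<omega> + balls_B b N X B n \<omega>"

definition proportion_A ::
  "nat \<Rightarrow> nat \<Rightarrow> (nat \<Rightarrow> 'w \<Rightarrow> nat) \<Rightarrow> (nat \<Rightarrow> 'w \<Rightarrow> nat) \<Rightarrow> (nat \<Rightarrow> 'w \<Rightarrow> nat) \<Rightarrow> (nat \<Rightarrow> 'w \<Rightarrow> nat)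
    \<Rightarrow> nat \<Rightarrow> 'w \<Rightarrow> real" where
  "proportion_A a b N X A B n \<omega> =
     real (balls_A a X A n \<omega>) / real (balls_total a b N X A B n \<omega>)"

(* A version of the mass that the conditional distribution of Y given F puts on k. *)
definition cond_mass :: "'w measure \<Rightarrow> 'w measure \<Rightarrow> ('w \<Rightarrow> nat) \<Rightarrow> nat \<Rightarrow> 'w \<Rightarrow> real" where
  "cond_mass M F Y k = real_cond_exp M F (indicator {\<omega> \<in> space M. Y \<omega> = k})"

(* n balls drawn without replacement from s balls, h of which have color A.  The case split is
   needed because n - k is truncated: (s - h) choose (n - k) would be 1, not 0, for k > n. *)
definition hypergeometric_mass :: "nat \<Rightarrow> nat \<Rightarrow> nat \<Rightarrow> nat \<Rightarrow> real" where
  "hypergeometric_mass n s h k =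
     (if k \<le> n then real (h choose k) * real ((s - h) choose (n - k)) / real (s choose n) else 0)"

(* The independence of the two random vectors is stated through the sigma-algebras they generate
   because indep_var requires both vectors to have the same type. *)
locale hypergeometric_urn = prob_space M
  for M :: "'w measure" +
  fixes a b :: nat
    and N X A B :: "nat \<Rightarrow> 'w \<Rightarrow> nat"
  assumes a_ge_1: "a \<ge> 1"
    and b_ge_1: "b \<ge> 1"
    and random_N: "\<And>n. n \<ge> 1 \<Longrightarrow> random_variable (count_space UNIV) (N n)"
    and random_X: "\<And>n. n \<ge> 1 \<Longrightarrow> random_variable (count_space UNIV) (X n)"
    and random_A: "\<And>n. n \<ge> 1 \<Longrightarrow> random_variable (count_space UNIV) (A n)"
    and random_B: "\<And>n. n \<ge> 1 \<Longrightarrow> random_variable (count_space UNIV) (B n)"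
    and sample_size_law: "\<And>n. n \<ge> 1 \<Longrightarrow>
      AE \<omega> in M. (\<Sum>k = 1..balls_total a b N X A B (n - 1) \<omega>.
        cond_mass M (urn_filtration M N X A B (n - 1)) (N n) k \<omega>) = 1"
    and draw_law: "\<And>n k. n \<ge> 1 \<Longrightarrow>
      AE \<omega> in M. cond_mass M (urn_before_draw M N X A B n) (X n) k \<omega> =
        hypergeometric_mass (N n \<omega>) (balls_total a b N X A B (n - 1) \<omega>)
          (balls_A a X A (n - 1) \<omega>) k"
    and reinforcement_pos: "\<And>n \<omega>. n \<ge> 1 \<Longrightarrow> \<omega> \<in> space M \<Longrightarrow> A n \<omega> \<ge> 1 \<and> B n \<omega> \<ge> 1"
    and reinforcement_indep: "\<And>n. n \<ge> 1 \<Longrightarrow>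
      indep_set
        (sets (vimage_algebra (space M) (\<lambda>\<omega>. (A n \<omega>, B n \<omega>)) (count_space UNIV)))
        (sets (urn_after_draw M N X A B n))"
begin

lemma measurable_urn_history: "urn_history N X A B n \<in> measurable M (history_space n)"
proof -
  have "urn_step N X A B j \<in> measurable M (count_space UNIV)" if "j \<in> {1..n}" for j
  proof -
    have [measurable]: "N j \<in> measurable M (count_space UNIV)" "X j \<in> measurable M (count_space UNIV)"
      "A j \<in> measurable M (count_space UNIV)" "B j \<in> measurable M (count_space UNIV)"
      using that random_N random_X random_A random_B by auto
    show ?thesis
      unfolding urn_step_def[abs_def] by measurable
  qed
  then show ?thesis
    unfolding urn_history_def[abs_def] history_space_def by (intro measurable_restrict)
qed

(* real_cond_exp is only meaningful for sub-sigma-algebras. *)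
lemma subalgebra_urn_filtration: "subalgebra M (urn_filtration M N X A B n)"
  unfolding subalgebra_def urn_filtration_def
  using measurable_sets[OF measurable_urn_history] measurable_space[OF measurable_urn_history]
  by (auto simp: sets_vimage_algebra2)

lemma subalgebra_urn_before_draw:
  assumes "n \<ge> 1"
  shows "subalgebra M (urn_before_draw M N X A B n)"
proof -
  have "(\<lambda>\<omega>. (urn_history N X A B (n - 1) \<omega>, N n \<omega>))
      \<in> measurable M (history_space (n - 1) \<Otimes>\<^sub>M count_space UNIV)"
    using measurable_urn_history random_N[OF assms] by (rule measurable_Pair)
  from measurable_sets[OF this] measurable_space[OF this] show ?thesis
    unfolding subalgebra_def urn_before_draw_def by (auto simp: sets_vimage_algebra2 simp del: One_nat_def)
qed

end

end

theory Submission
  imports Defs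
begin

text \<open>In conditional mean the draws leave the proportion \<open>Z\<close> of color A unchanged up to order \<open>1 / n\<^sup>2\<close>, and
  its steps are of order \<open>1 / n\<close>. Hence \<open>Z\<close> converges almost surely, and given the past at time \<open>n\<close> the second
  moment of \<open>Z_lim - Z n\<close> is at most of order \<open>Z n / n\<close>. An atom at 0 is excluded because the mean of
  \<open>(Z_lim - Z n)\<^sup>2 / (Z n)\<^sup>2\<close> is at most of the order of the mean of the inverse number of balls of color A,
  which tends to 0; the point 1 is symmetric. For an interior point \<open>z\<close>, given a past at time \<open>n\<close> with
  \<open>Z n - z\<close> of order \<open>1 / sqrt n\<close>, the second moment of \<open>Z_lim - z\<close> is at least of order \<open>1 / n\<close> and the fourth
  one at most of order \<open>1 / n\<^sup>2\<close>, so \<open>Z_lim \<noteq> z\<close> has a conditional probability bounded away from 0, uniformly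
  in \<open>n\<close>; for the other pasts Chebyshev's inequality gives the same. On the event \<open>Z_lim = z\<close>,
  however, such probabilities would have to tend to 0.\<close>

section \<open>Balanced reinforcement processes\<close>

text \<open>\<open>Z\<close> is not a martingale: the denominator \<open>s (Suc n)\<close> is random
  and correlated with the numerator of the increment. Equal means of \<open>A n\<close> and
  \<open>B n\<close> make the numerator \<open>R n\<close> conditionally centred, so dividing it by
  the known \<open>s n\<close> causes no drift, and passing to \<open>s (Suc n)\<close> costs only
  order \<open>1 / n^2\<close>. The abstract locale keeps just these mean conditions and bounded
  increments; its \<open>\<nu> n\<close> is \<open>m (Suc n) * N (Suc n)\<close> in the urn, which
  the past need not determine, so it is only ever bounded. The basic upper bounds keep a factor
  \<open>Z n\<close>. It comes from bounding the size of \<open>R n\<close> by the increment of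
  \<open>h\<close> plus \<open>c * Z n\<close>, and it turns the quotient by \<open>(Z n)^2\<close>
  into the inverse of \<open>h n\<close> at the boundary. The mean conditions alone admit the
  deterministic process with increments \<open>Z n\<close> and \<open>1 - Z n\<close>, whose
  proportion is constant. A lower bound on the fluctuations must come from the draws; it is isolated
  as \<open>spreads_at\<close>. Weights replace conditional expectations throughout. With weights
  that are continuous functions of \<open>Z n\<close> and concentrate at \<open>z\<close>, uniform
  escape rules out an atom directly, without a zero-one law.\<close>

lemma inverse_square_bounds:
  "1 / (real j + 1) - 1 / (real j + 2) \<le> 1 / (real j + 1)\<^sup>2"
  "1 / (real j + 1)\<^sup>2 \<le> 2 * (1 / (real j + 1) - 1 / (real j + 2))"
  by (simp_all add: frac_le_eq divide_simps power2_eq_square add_pos_nonneg algebra_simps)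

text \<open>\<open>1 / (j + 1)^2\<close> is compared with the telescoping
  \<open>1 / ((j + 1) * (j + 2))\<close>. Their ratio lies between 1 and 2, hence a factor 2 here
  and none in the lower bound.\<close>

lemma telescoping_upper:
  fixes u :: "nat \<Rightarrow> real"
  assumes "\<And>j. j \<ge> n \<Longrightarrow> u (Suc j) \<le> u j + q / (real j + 1)\<^sup>2" and "q \<ge> 0" and "k \<ge> n"
  shows "u k \<le> u n + 2 * q * (1 / (real n + 1) - 1 / (real k + 1))"
  using \<open>k \<ge> n\<close>
proof (induction k rule: dec_induct)
  case (step j)
  have "u (Suc j) \<le> u j + q * (1 / (real j + 1)\<^sup>2)"
    using assms(1)[of j] step by simp
  then show ?case
    using step mult_left_mono[OF inverse_square_bounds(2)[of j] \<open>q \<ge> 0\<close>]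
    by (simp add: algebra_simps)
qed simp

lemma telescoping_lower:
  fixes u :: "nat \<Rightarrow> real"
  assumes "\<And>j. j \<ge> n \<Longrightarrow> u (Suc j) \<ge> u j + q / (real j + 1)\<^sup>2" and "q \<ge> 0" and "k \<ge> n"
  shows "u k \<ge> u n + q * (1 / (real n + 1) - 1 / (real k + 1))"
  using \<open>k \<ge> n\<close>
proof (induction k rule: dec_induct)
  case (step j)
  have "u (Suc j) \<ge> u j + q * (1 / (real j + 1)\<^sup>2)"
    using assms(1)[of j] step by simp
  then show ?case
    using step mult_left_mono[OF inverse_square_bounds(1)[of j] \<open>q \<ge> 0\<close>]
    by (simp add: algebra_simps)
qed simp

section \<open>Comparing a sequence with its values at the cubes\<close>

lemma cube_gap: "real ((i + 1) ^ 3) - real (i ^ 3) \<le> 3 * (real i + 1)\<^sup>2"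
  by (simp add: power2_eq_square power3_eq_cube algebra_simps)

text \<open>Denominators \<open>i ^ 3 + 1\<close> are safe at \<open>i = 0\<close>; this trades them
  for powers of \<open>i + 1\<close> at the cost of the factor 4, attained at
  \<open>i = 1\<close>.\<close>

lemma cube_lower: "(real i + 1) ^ 3 \<le> 4 * (real i ^ 3 + 1)"
proof -
  have "4 * (real i ^ 3 + 1) - (real i + 1) ^ 3 = 3 * (real i + 1) * (real i - 1)\<^sup>2"
    by (simp add: power2_eq_square power3_eq_cube algebra_simps)
  also have "\<dots> \<ge> 0" by simp
  finally show ?thesis by simp
qed

lemma tendsto_along_cubes:
  fixes f :: "nat \<Rightarrow> real"
  assumes lim: "(\<lambda>i. f (i ^ 3)) \<longlonglongrightarrow> L" and e: "e \<longlonglongrightarrow> 0"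
    and gap: "\<And>i n. i ^ 3 \<le> n \<Longrightarrow> n \<le> (i + 1) ^ 3 \<Longrightarrow> \<bar>f n - f (i ^ 3)\<bar> \<le> e i"
  shows "f \<longlonglongrightarrow> L"
proof -
  \<comment> \<open>\<open>r n\<close> is the integer cube root of \<open>n\<close>, the index of
    the block of cubes that contains \<open>n\<close>.\<close>
  define r where "r n = (LEAST i. n < (i + 1) ^ 3)" for n :: nat
  have ex: "n < (n + 1) ^ 3" for n :: nat
    using self_le_power[of "n + 1" 3] by simp
  have r1: "n < (r n + 1) ^ 3" for n
    unfolding r_def using ex by (rule LeastI)
  have r2: "r n ^ 3 \<le> n" for n
  proof (cases "r n")
    case (Suc i)
    then have "\<not> n < (i + 1) ^ 3" using not_less_Least[of i "\<lambda>i. n < (i + 1) ^ 3"] by (simp add: r_def)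
    then show ?thesis using Suc by simp
  qed simp
  have r_lim: "filterlim r at_top sequentially"
    unfolding filterlim_at_top
  proof
    fix K
    show "\<forall>\<^sub>F n in sequentially. K \<le> r n"
      using eventually_ge_at_top[of "K ^ 3"]
    proof eventually_elim
      case (elim n)
      then have "K ^ 3 < (r n + 1) ^ 3" using r1[of n] by linarith
      then show ?case using power_less_imp_less_base[of K 3 "r n + 1"] by simp
    qed
  qed
  have "(\<lambda>n. f n - f (r n ^ 3)) \<longlonglongrightarrow> 0"
  proof (rule Lim_null_comparison)
    show "\<forall>\<^sub>F n in sequentially. norm (f n - f (r n ^ 3)) \<le> e (r n)"
      using gap[OF r2 less_imp_le[OF r1]] by simp
    show "(\<lambda>n. e (r n)) \<longlonglongrightarrow> 0" using e r_lim by (rule filterlim_compose)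
  qed
  from tendsto_add[OF this filterlim_compose[OF lim r_lim]] show ?thesis by simp
qed

text \<open>Statements about conditional expectations given \<open>F n\<close> are expressed by integrating against bounded
  \<open>F n\<close>-measurable weights \<open>W\<close>.\<close>

locale balanced_reinforcement = prob_space M
  for M :: "'w measure" +
  fixes F :: "nat \<Rightarrow> 'w measure"
    and h k \<nu> :: "nat \<Rightarrow> 'w \<Rightarrow> real"
    and c :: real
  assumes subalg: "\<And>n. subalgebra M (F n)"
    and filtration: "\<And>n. subalgebra (F (Suc n)) (F n)"
    and adapted_h: "\<And>n. h n \<in> borel_measurable (F n)"
    and adapted_k: "\<And>n. k n \<in> borel_measurable (F n)"
    and h_ge_1: "\<And>n \<omega>. h n \<omega> \<ge> 1"
    and k_ge_1: "\<And>n \<omega>. k n \<omega> \<ge> 1"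
    and start_le: "\<And>\<omega>. h 0 \<omega> + k 0 \<omega> \<le> c"
    and h_step: "\<And>n. AE \<omega> in M. h n \<omega> \<le> h (Suc n) \<omega> \<and> h (Suc n) \<omega> \<le> h n \<omega> + c"
    and k_step: "\<And>n. AE \<omega> in M. k n \<omega> \<le> k (Suc n) \<omega> \<and> k (Suc n) \<omega> \<le> k n \<omega> + c"
    and total_step: "\<And>n. AE \<omega> in M. h n \<omega> + k n \<omega> + 1 \<le> h (Suc n) \<omega> + k (Suc n) \<omega>"
    and measurable_\<nu>: "\<And>n. \<nu> n \<in> borel_measurable M"
    and \<nu>_bounds: "\<And>n. AE \<omega> in M. 1 \<le> \<nu> n \<omega> \<and> \<nu> n \<omega> \<le> c"
    and mean_h: "\<And>n W D. W \<in> borel_measurable (F n) \<Longrightarrow> AE \<omega> in M. \<bar>W \<omega>\<bar> \<le> D \<Longrightarrow>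
      (\<integral>\<omega>. W \<omega> * (h (Suc n) \<omega> - h n \<omega>) \<partial>M) =
      (\<integral>\<omega>. W \<omega> * (\<nu> n \<omega> * (h n \<omega> / (h n \<omega> + k n \<omega>))) \<partial>M)"
    and mean_k: "\<And>n W D. W \<in> borel_measurable (F n) \<Longrightarrow> AE \<omega> in M. \<bar>W \<omega>\<bar> \<le> D \<Longrightarrow>
      (\<integral>\<omega>. W \<omega> * (k (Suc n) \<omega> - k n \<omega>) \<partial>M) =
      (\<integral>\<omega>. W \<omega> * (\<nu> n \<omega> * (k n \<omega> / (h n \<omega> + k n \<omega>))) \<partial>M)"
begin

section \<open>The proportion, the numerator of its increments, and weights\<close>

definition s :: "nat \<Rightarrow> 'w \<Rightarrow> real" where "s n \<omega> = h n \<omega> + k n \<omega>"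

definition Z :: "nat \<Rightarrow> 'w \<Rightarrow> real" where "Z n \<omega> = h n \<omega> / s n \<omega>"

text \<open>The numerator of the increment: \<open>s (Suc n) * (Z (Suc n) - Z n)\<close>. It is
  centred given \<open>F n\<close>, because its two terms contribute the conditional mean of
  \<open>\<nu> n * Z n * (1 - Z n)\<close> with opposite signs.\<close>

definition R :: "nat \<Rightarrow> 'w \<Rightarrow> real" where
  "R n \<omega> = (h (Suc n) \<omega> - h n \<omega>) * (1 - Z n \<omega>) - (k (Suc n) \<omega> - k n \<omega>) * Z n \<omega>"

text \<open>Boundedness is required only almost surely, because \<open>h n\<close> and
  \<open>k n\<close> are controlled only through their almost sure increments; so they are weights
  themselves. Testing against all weights at \<open>n\<close> amounts to conditioning on
  \<open>F n\<close>.\<close>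

definition weight :: "nat \<Rightarrow> ('w \<Rightarrow> real) \<Rightarrow> bool" where
  "weight n W \<longleftrightarrow> W \<in> borel_measurable (F n) \<and> (\<exists>D. AE \<omega> in M. \<bar>W \<omega>\<bar> \<le> D)"

lemma c_ge_2: "c \<ge> 2"
  \<comment> \<open>Any sample point serves, since the bounds at time 0 hold everywhere.\<close>
  using start_le[of undefined] h_ge_1[of 0 undefined] k_ge_1[of 0 undefined] by linarith

lemma s_ge_2: "s n \<omega> \<ge> 2"
  using h_ge_1[of n \<omega>] k_ge_1[of n \<omega>] by (simp add: s_def)

lemma Z_bounds: "0 < Z n \<omega>" "Z n \<omega> < 1"
  using h_ge_1[of n \<omega>] k_ge_1[of n \<omega>] by (auto simp: Z_def s_def divide_simps)

lemma one_minus_Z: "1 - Z n \<omega> = k n \<omega> / s n \<omega>"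
  using s_ge_2[of n \<omega>] by (simp add: Z_def divide_simps) (simp add: s_def)

text \<open>A single null set serves all \<open>n\<close>, as the pathwise convergence argument
  requires. The linear growth of \<open>s n\<close> from both sides is what fixes the scale
  \<open>1 / n\<close> of the steps.\<close>

lemma AE_steps:
  "AE \<omega> in M. \<forall>n. h n \<omega> \<le> h (Suc n) \<omega> \<and> h (Suc n) \<omega> \<le> h n \<omega> + c
     \<and> k n \<omega> \<le> k (Suc n) \<omega> \<and> k (Suc n) \<omega> \<le> k n \<omega> + c
     \<and> s n \<omega> + 1 \<le> s (Suc n) \<omega> \<and> real n + 1 \<le> s n \<omega> \<and> s n \<omega> \<le> 2 * c * (real n + 1)"
proof -
  have "AE \<omega> in M. \<forall>n. (h n \<omega> \<le> h (Suc n) \<omega> \<and> h (Suc n) \<omega> \<le> h n \<omega> + c)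
      \<and> (k n \<omega> \<le> k (Suc n) \<omega> \<and> k (Suc n) \<omega> \<le> k n \<omega> + c)
      \<and> h n \<omega> + k n \<omega> + 1 \<le> h (Suc n) \<omega> + k (Suc n) \<omega>"
    using h_step k_step total_step by (simp add: AE_all_countable AE_conj_iff)
  then show ?thesis
  proof eventually_elim
    case (elim \<omega>)
    have "real n + 1 \<le> s n \<omega> \<and> s n \<omega> \<le> 2 * c * (real n + 1)" for n
    proof (induction n)
      case 0
      show ?case using s_ge_2[of 0 \<omega>] start_le[of \<omega>] c_ge_2 by (simp add: s_def)
    next
      case (Suc n)
      then show ?case using elim[rule_format, of n] by (auto simp: s_def algebra_simps)
    qed
    with elim show ?case by (simp add: s_def)
  qed
qed

lemma Z_step: "s (Suc n) \<omega> * (Z (Suc n) \<omega> - Z n \<omega>) = R n \<omega>"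
proof -
  have "s (Suc n) \<omega> * Z (Suc n) \<omega> = h (Suc n) \<omega>" "s n \<omega> * Z n \<omega> = h n \<omega>"
    using s_ge_2[of n \<omega>] s_ge_2[of "Suc n" \<omega>] by (auto simp: Z_def)
  then show ?thesis
    unfolding R_def by (simp add: algebra_simps s_def)
qed

lemma Z_step': "Z (Suc n) \<omega> - Z n \<omega> = R n \<omega> / s (Suc n) \<omega>"
  using Z_step[of n \<omega>] s_ge_2[of "Suc n" \<omega>] by (simp add: field_simps)

text \<open>The bound by \<open>c\<close> ignores that \<open>Z\<close> hardly moves in mean when
  color A is scarce. The other one does not: the increment of \<open>h\<close> has conditional mean
  at most \<open>c * Z n\<close>, so the whole bound has mean of order \<open>Z n\<close>.\<close>

lemma AE_R_bounds:
  "AE \<omega> in M. \<forall>n. \<bar>R n \<omega>\<bar> \<le> (h (Suc n) \<omega> - h n \<omega>) + c * Z n \<omega> \<and> \<bar>R n \<omega>\<bar> \<le> c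
    \<and> \<bar>Z (Suc n) \<omega> - Z n \<omega>\<bar> \<le> c / (real n + 1)"
  using AE_steps
proof eventually_elim
  case (elim \<omega>)
  show ?case
  proof
    fix n
    define x y where "x = h (Suc n) \<omega> - h n \<omega>" and "y = k (Suc n) \<omega> - k n \<omega>"
    have xy: "0 \<le> x" "x \<le> c" "0 \<le> y" "y \<le> c"
      using elim[rule_format, of n] by (auto simp: x_def y_def)
    have z: "0 < Z n \<omega>" "Z n \<omega> < 1" by (rule Z_bounds)+
    have 1: "0 \<le> x * (1 - Z n \<omega>)" "x * (1 - Z n \<omega>) \<le> x" "x * (1 - Z n \<omega>) \<le> c * (1 - Z n \<omega>)"
      "0 \<le> y * Z n \<omega>" "y * Z n \<omega> \<le> c * Z n \<omega>"
      using xy z by (auto intro: mult_right_mono mult_left_le)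
    have R: "R n \<omega> = x * (1 - Z n \<omega>) - y * Z n \<omega>" by (simp add: R_def x_def y_def)
    have b: "\<bar>R n \<omega>\<bar> \<le> x + c * Z n \<omega>" "\<bar>R n \<omega>\<bar> \<le> c"
    proof -
      have "0 \<le> c * Z n \<omega>" "c * Z n \<omega> \<le> c" "c * (1 - Z n \<omega>) \<le> c"
        using z c_ge_2 by (auto intro: mult_left_le)
      then show "\<bar>R n \<omega>\<bar> \<le> x + c * Z n \<omega>" "\<bar>R n \<omega>\<bar> \<le> c"
        unfolding R abs_le_iff using 1 xy by linarith+
    qed
    have "\<bar>Z (Suc n) \<omega> - Z n \<omega>\<bar> = \<bar>R n \<omega>\<bar> / s (Suc n) \<omega>"
      using s_ge_2[of "Suc n" \<omega>] by (simp add: Z_step' )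
    also have "\<dots> \<le> c / (real n + 1)"
      using b elim[rule_format, of "n"] c_ge_2 by (intro frac_le) auto
    finally show "\<bar>R n \<omega>\<bar> \<le> (h (Suc n) \<omega> - h n \<omega>) + c * Z n \<omega> \<and> \<bar>R n \<omega>\<bar> \<le> c
      \<and> \<bar>Z (Suc n) \<omega> - Z n \<omega>\<bar> \<le> c / (real n + 1)"
      using b by (simp add: x_def)
  qed
qed

lemma subalgebra_mono: "n \<le> j \<Longrightarrow> subalgebra (F j) (F n)"
proof (induction j rule: dec_induct)
  case base
  show ?case by (simp add: subalgebra_def)
next
  case (step j)
  then show ?case using filtration[of j] by (auto simp: subalgebra_def)
qed

lemma weight_mono: "weight n W \<Longrightarrow> n \<le> j \<Longrightarrow> weight j W"
  unfolding weight_def using measurable_from_subalg[OF subalgebra_mono] by blast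

lemma weight_measurable: "weight n W \<Longrightarrow> W \<in> borel_measurable M"
  unfolding weight_def using measurable_from_subalg[OF subalg] by blast

lemma weight_integrable:
  assumes "weight n W"
  shows "integrable M W"
proof -
  obtain D where "AE \<omega> in M. norm (W \<omega>) \<le> D"
    using assms by (auto simp: weight_def)
  from integrable_const_bound[OF this weight_measurable[OF assms]] show ?thesis .
qed

lemma weight_const: "weight n (\<lambda>_. x)"
  by (auto simp: weight_def)

lemma weight_add:
  assumes "weight n V" "weight n W"
  shows "weight n (\<lambda>\<omega>. V \<omega> + W \<omega>)"
proof -
  obtain D D' where D: "AE \<omega> in M. \<bar>V \<omega>\<bar> \<le> D" "AE \<omega> in M. \<bar>W \<omega>\<bar> \<le> D'"
    using assms by (auto simp: weight_def)
  have "AE \<omega> in M. \<bar>V \<omega> + W \<omega>\<bar> \<le> D + D'"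
    using D by eventually_elim auto
  then show ?thesis using assms by (auto simp: weight_def)
qed

lemma weight_mult:
  assumes "weight n V" "weight n W"
  shows "weight n (\<lambda>\<omega>. V \<omega> * W \<omega>)"
proof -
  obtain D D' where D: "AE \<omega> in M. \<bar>V \<omega>\<bar> \<le> D" "AE \<omega> in M. \<bar>W \<omega>\<bar> \<le> D'"
    using assms by (auto simp: weight_def)
  have "AE \<omega> in M. \<bar>V \<omega> * W \<omega>\<bar> \<le> D * D'"
    using D by eventually_elim (auto simp: abs_mult intro!: mult_mono)
  then show ?thesis using assms by (auto simp: weight_def)
qed

lemma weight_abs: "weight n V \<Longrightarrow> weight n (\<lambda>\<omega>. \<bar>V \<omega>\<bar>)"
  by (auto simp: weight_def)

lemma weight_diff: "weight n V \<Longrightarrow> weight n W \<Longrightarrow> weight n (\<lambda>\<omega>. V \<omega> - W \<omega>)"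
  using weight_add[of n V "\<lambda>\<omega>. (-1) * W \<omega>"] weight_mult[of n "\<lambda>_. -1" W] weight_const[of n "-1"] by simp

lemma weight_power: "weight n V \<Longrightarrow> weight n (\<lambda>\<omega>. V \<omega> ^ i)"
  by (induction i) (simp_all add: weight_const weight_mult)

lemma weight_bounded: "W \<in> borel_measurable (F n) \<Longrightarrow> (\<And>\<omega>. \<bar>W \<omega>\<bar> \<le> D) \<Longrightarrow> weight n W"
  unfolding weight_def by blast

lemma adapted_s [measurable]: "s n \<in> borel_measurable (F n)"
  unfolding s_def[abs_def] using adapted_h[of n] adapted_k[of n] by measurable

lemma adapted_Z [measurable]: "Z n \<in> borel_measurable (F n)"
  unfolding Z_def[abs_def] using adapted_h[of n] by measurable

lemma weight_Z: "weight n (Z n)"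
proof (intro weight_bounded[where D = 1])
  show "\<bar>Z n \<omega>\<bar> \<le> 1" for \<omega>
    using Z_bounds[of n \<omega>] by simp
qed measurable

lemma weight_inverse_s: "weight n (\<lambda>\<omega>. 1 / s n \<omega>)"
proof (intro weight_bounded[where D = 1])
  show "\<bar>1 / s n \<omega>\<bar> \<le> 1" for \<omega>
    using s_ge_2[of n \<omega>] by (simp add: abs_le_iff divide_simps)
qed measurable

lemma weight_h: "weight n (h n)"
proof -
  have "AE \<omega> in M. \<bar>h n \<omega>\<bar> \<le> 2 * c * (real n + 1)"
    using AE_steps
  proof eventually_elim
    case (elim \<omega>)
    show ?case using elim[rule_format, of n] h_ge_1[of n \<omega>] k_ge_1[of n \<omega>] by (simp add: s_def)
  qed
  then show ?thesis using adapted_h by (auto simp: weight_def)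
qed

lemma weight_k: "weight n (k n)"
proof -
  have "AE \<omega> in M. \<bar>k n \<omega>\<bar> \<le> 2 * c * (real n + 1)"
    using AE_steps
  proof eventually_elim
    case (elim \<omega>)
    show ?case using elim[rule_format, of n] h_ge_1[of n \<omega>] k_ge_1[of n \<omega>] by (simp add: s_def)
  qed
  then show ?thesis using adapted_k by (auto simp: weight_def)
qed

lemmas weight_intros = weight_const weight_mult weight_diff weight_add weight_power weight_abs
  weight_mono[OF weight_Z] weight_mono[OF weight_h] weight_mono[OF weight_k]
  weight_mono[OF weight_inverse_s]

lemma weight_R: "n < j \<Longrightarrow> weight j (R n)"
  unfolding R_def[abs_def] by (intro weight_intros) simp_all

section \<open>Estimates for a single step\<close>

lemma integral_weight_mono:
  assumes "weight i V" "weight j W" "AE \<omega> in M. V \<omega> \<le> W \<omega>"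
  shows "(\<integral>\<omega>. V \<omega> \<partial>M) \<le> (\<integral>\<omega>. W \<omega> \<partial>M)"
  by (rule integral_mono_AE[OF assms(1)[THEN weight_integrable] assms(2)[THEN weight_integrable] assms(3)])

text \<open>\<open>\<nu> n\<close> is measurable for \<open>M\<close> but not necessarily for
  \<open>F n\<close>, so it cannot be absorbed into a weight; its bounds 1 and \<open>c\<close> are
  used instead.\<close>

lemma integral_\<nu>_bounds:
  assumes W: "weight n W" and nonneg: "\<And>\<omega>. W \<omega> \<ge> 0"
  shows "(\<integral>\<omega>. W \<omega> \<partial>M) \<le> (\<integral>\<omega>. W \<omega> * \<nu> n \<omega> \<partial>M)" "(\<integral>\<omega>. W \<omega> * \<nu> n \<omega> \<partial>M) \<le> c * (\<integral>\<omega>. W \<omega> \<partial>M)"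
proof -
  obtain D where D: "AE \<omega> in M. \<bar>W \<omega>\<bar> \<le> D" using W by (auto simp: weight_def)
  have "AE \<omega> in M. norm (W \<omega> * \<nu> n \<omega>) \<le> D * c"
    using D \<nu>_bounds[of n] by eventually_elim (auto simp: abs_mult intro!: mult_mono)
  then have i: "integrable M (\<lambda>\<omega>. W \<omega> * \<nu> n \<omega>)"
    using weight_measurable[OF W] measurable_\<nu>[of n] by (intro integrable_const_bound) auto
  have "AE \<omega> in M. W \<omega> \<le> W \<omega> * \<nu> n \<omega> \<and> W \<omega> * \<nu> n \<omega> \<le> c * W \<omega>"
    using \<nu>_bounds[of n]
  proof eventually_elim
    case (elim \<omega>)
    then show ?case
      using mult_left_mono[of 1 "\<nu> n \<omega>" "W \<omega>"] mult_left_mono[of "\<nu> n \<omega>" c "W \<omega>"] nonneg[of \<omega>]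
      by (simp add: mult.commute)
  qed
  note b = this[unfolded AE_conj_iff]
  show "(\<integral>\<omega>. W \<omega> \<partial>M) \<le> (\<integral>\<omega>. W \<omega> * \<nu> n \<omega> \<partial>M)"
    by (rule integral_mono_AE[OF weight_integrable[OF W] i conjunct1[OF b]])
  have "(\<integral>\<omega>. W \<omega> * \<nu> n \<omega> \<partial>M) \<le> (\<integral>\<omega>. c * W \<omega> \<partial>M)"
    by (rule integral_mono_AE[OF i _ conjunct2[OF b]]) (simp add: weight_integrable[OF W])
  then show "(\<integral>\<omega>. W \<omega> * \<nu> n \<omega> \<partial>M) \<le> c * (\<integral>\<omega>. W \<omega> \<partial>M)" by simp
qed

lemma integral_h_step:
  assumes W: "weight n W"
  shows "(\<integral>\<omega>. W \<omega> * (h (Suc n) \<omega> - h n \<omega>) \<partial>M) = (\<integral>\<omega>. W \<omega> * Z n \<omega> * \<nu> n \<omega> \<partial>M)"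
proof -
  obtain D where D: "AE \<omega> in M. \<bar>W \<omega>\<bar> \<le> D" "W \<in> borel_measurable (F n)" using W by (auto simp: weight_def)
  show ?thesis
    using mean_h[OF D(2,1)] by (simp add: Z_def s_def mult_ac)
qed

text \<open>This is where the balance enters: both mean increments carry the same factor
  \<open>\<nu> n\<close>, so the two terms cancel whatever \<open>\<nu> n\<close> is.\<close>

lemma integral_R:
  assumes W: "weight n W"
  shows "(\<integral>\<omega>. W \<omega> * R n \<omega> \<partial>M) = 0"
proof -
  have W1: "weight n (\<lambda>\<omega>. W \<omega> * (1 - Z n \<omega>))" and W2: "weight n (\<lambda>\<omega>. W \<omega> * Z n \<omega>)"
    by (intro weight_intros W; simp)+
  obtain D where D: "AE \<omega> in M. \<bar>W \<omega> * Z n \<omega>\<bar> \<le> D" "(\<lambda>\<omega>. W \<omega> * Z n \<omega>) \<in> borel_measurable (F n)"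
    using W2 by (auto simp: weight_def)
  have "(\<integral>\<omega>. W \<omega> * R n \<omega> \<partial>M) =
    (\<integral>\<omega>. (W \<omega> * (1 - Z n \<omega>)) * (h (Suc n) \<omega> - h n \<omega>) - (W \<omega> * Z n \<omega>) * (k (Suc n) \<omega> - k n \<omega>) \<partial>M)"
    by (intro Bochner_Integration.integral_cong) (auto simp: R_def algebra_simps)
  also have "\<dots> = (\<integral>\<omega>. (W \<omega> * (1 - Z n \<omega>)) * (h (Suc n) \<omega> - h n \<omega>) \<partial>M) -
      (\<integral>\<omega>. (W \<omega> * Z n \<omega>) * (k (Suc n) \<omega> - k n \<omega>) \<partial>M)"
    by (rule Bochner_Integration.integral_diff)
       (rule weight_integrable[of "Suc n"], (intro weight_intros weight_mono[OF W]; simp))+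
  also have "\<dots> = 0"
    using integral_h_step[OF W1] mean_k[OF D(2,1)] one_minus_Z[of n]
    by (simp add: s_def mult_ac)
  finally show ?thesis .
qed

text \<open>The first-order term \<open>R n / s n\<close> of the increment \<open>R n / s (Suc n)\<close> integrates to zero, so only the
  correction of order \<open>1 / n\<^sup>2\<close> remains.\<close>

lemma drift:
  assumes W: "weight n W"
  shows "\<bar>\<integral>\<omega>. W \<omega> * (Z (Suc n) \<omega> - Z n \<omega>) \<partial>M\<bar> \<le>
    4 * c\<^sup>2 / (real n + 1)\<^sup>2 * (\<integral>\<omega>. \<bar>W \<omega>\<bar> * Z n \<omega> \<partial>M)"
proof -
  \<comment> \<open>The subtracted term has integral zero; what is left of the increment carries the
    difference \<open>1 / s (Suc n) - 1 / s n\<close>.\<close>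
  let ?E = "\<lambda>\<omega>. W \<omega> * (Z (Suc n) \<omega> - Z n \<omega>) - W \<omega> * (1 / s n \<omega>) * R n \<omega>"
  let ?B = "\<lambda>\<omega>. 2 * c / (real n + 1)\<^sup>2 * (\<bar>W \<omega>\<bar> * (h (Suc n) \<omega> - h n \<omega>) + c * (\<bar>W \<omega>\<bar> * Z n \<omega>))"
  have W': "weight n (\<lambda>\<omega>. W \<omega> * (1 / s n \<omega>))" by (intro weight_intros W) simp
  have W'': "weight n (\<lambda>\<omega>. \<bar>W \<omega>\<bar> * Z n \<omega>)" by (intro weight_intros W) simp
  have E: "weight (Suc n) ?E" by (intro weight_intros weight_R weight_mono[OF W]) simp_all
  have B: "weight (Suc n) ?B" by (intro weight_intros weight_R weight_mono[OF W]) simp_all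
  have pw: "AE \<omega> in M. \<bar>?E \<omega>\<bar> \<le> ?B \<omega>"
    using AE_steps AE_R_bounds
  proof eventually_elim
    case (elim \<omega>)
    note st = elim(1)[rule_format, of n] and r = elim(2)[rule_format, of n]
    define t t' d where "t = s n \<omega>" and "t' = s (Suc n) \<omega>" and "d = t' - t"
    have t: "t \<ge> real n + 1" "t' \<ge> real n + 1" "0 \<le> d" "d \<le> 2 * c"
      using st by (auto simp: t_def t'_def d_def s_def)
    have pos: "t > 0" "t' > 0" using t by auto
    have "?E \<omega> = W \<omega> * R n \<omega> * (1 / t' - 1 / t)"
      by (simp add: Z_step' t_def t'_def algebra_simps)
    also have "1 / t' - 1 / t = - d / (t' * t)"
      using pos by (simp add: d_def field_simps)
    finally have e: "\<bar>?E \<omega>\<bar> = \<bar>W \<omega>\<bar> * \<bar>R n \<omega>\<bar> * (d / (t' * t))"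
      using pos t by (simp add: abs_mult)
    \<comment> \<open>The total grows by at most \<open>2 * c\<close> in one step while both totals
      are at least \<open>n + 1\<close>; this yields the second power of
      \<open>1 / (n + 1)\<close>.\<close>
    have "d / (t' * t) \<le> 2 * c / ((real n + 1) * (real n + 1))"
      using t c_ge_2 by (intro frac_le mult_mono) auto
    then have "\<bar>?E \<omega>\<bar> \<le> \<bar>W \<omega>\<bar> * (h (Suc n) \<omega> - h n \<omega> + c * Z n \<omega>) * (2 * c / ((real n + 1) * (real n + 1)))"
      unfolding e using r t pos by (intro mult_mono mult_left_mono) auto
    also have "\<dots> = ?B \<omega>" by (simp add: power2_eq_square algebra_simps)
    finally show ?case .
  qed
  have i1: "integrable M (\<lambda>\<omega>. W \<omega> * (Z (Suc n) \<omega> - Z n \<omega>))"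
    by (intro weight_integrable[of "Suc n"] weight_intros weight_R weight_mono[OF W]) simp_all
  have i2: "integrable M (\<lambda>\<omega>. W \<omega> * (1 / s n \<omega>) * R n \<omega>)"
    by (intro weight_integrable[of "Suc n"] weight_intros weight_R weight_mono[OF W]) simp_all
  have i3: "integrable M (\<lambda>\<omega>. \<bar>W \<omega>\<bar> * (h (Suc n) \<omega> - h n \<omega>))"
    by (intro weight_integrable[of "Suc n"] weight_intros weight_R weight_mono[OF W]) simp_all
  have i4: "integrable M (\<lambda>\<omega>. \<bar>W \<omega>\<bar> * Z n \<omega>)"
    by (intro weight_integrable[of n] weight_intros W) simp_all
  have "\<bar>\<integral>\<omega>. W \<omega> * (Z (Suc n) \<omega> - Z n \<omega>) \<partial>M\<bar> = \<bar>\<integral>\<omega>. ?E \<omega> \<partial>M\<bar>"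
    using integral_R[OF W'] Bochner_Integration.integral_diff[OF i1 i2] by simp
  also have "\<dots> \<le> (\<integral>\<omega>. \<bar>?E \<omega>\<bar> \<partial>M)"
    by (rule integral_abs_bound)
  also have "\<dots> \<le> (\<integral>\<omega>. ?B \<omega> \<partial>M)"
    by (rule integral_weight_mono[OF weight_abs[OF E] B pw])
  also have "\<dots> = 2 * c / (real n + 1)\<^sup>2 * ((\<integral>\<omega>. \<bar>W \<omega>\<bar> * (h (Suc n) \<omega> - h n \<omega>) \<partial>M) + c * (\<integral>\<omega>. \<bar>W \<omega>\<bar> * Z n \<omega> \<partial>M))"
    using i3 i4 by simp
  \<comment> \<open>The mean increment of \<open>h\<close> is at most \<open>c\<close> times the
    mean of \<open>Z n\<close>, so the two summands take the same form and add up to the constant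
    \<open>4 * c^2\<close>.\<close>
  also have "\<dots> \<le> 2 * c / (real n + 1)\<^sup>2 * (c * (\<integral>\<omega>. \<bar>W \<omega>\<bar> * Z n \<omega> \<partial>M) + c * (\<integral>\<omega>. \<bar>W \<omega>\<bar> * Z n \<omega> \<partial>M))"
    using c_ge_2 integral_h_step[OF weight_abs[OF W]] integral_\<nu>_bounds(2)[OF W''] Z_bounds(1)
    by (intro mult_left_mono add_mono) (auto simp: less_imp_le)
  finally show ?thesis by (simp add: power2_eq_square algebra_simps)
qed

text \<open>One factor of the square of \<open>R n\<close> is bounded by a constant and only the
  other by the increment of \<open>h\<close> plus \<open>c * Z n\<close>, so the result is linear in
  \<open>Z n\<close>. The constant is rounded up to agree with that of \<open>drift\<close>.\<close>

lemma quadratic_variation: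
  assumes W: "weight n W" and nonneg: "\<And>\<omega>. W \<omega> \<ge> 0"
  shows "(\<integral>\<omega>. W \<omega> * (Z (Suc n) \<omega> - Z n \<omega>)\<^sup>2 \<partial>M) \<le> 4 * c\<^sup>2 / (real n + 1)\<^sup>2 * (\<integral>\<omega>. W \<omega> * Z n \<omega> \<partial>M)"
proof -
  let ?B = "\<lambda>\<omega>. 2 * c / (real n + 1)\<^sup>2 * (W \<omega> * (h (Suc n) \<omega> - h n \<omega>) + c * (W \<omega> * Z n \<omega>))"
  have W': "weight n (\<lambda>\<omega>. W \<omega> * Z n \<omega>)" by (intro weight_intros W) simp
  have B: "weight (Suc n) ?B" by (intro weight_intros weight_R weight_mono[OF W]) simp_all
  have i3: "integrable M (\<lambda>\<omega>. W \<omega> * (h (Suc n) \<omega> - h n \<omega>))"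
    by (intro weight_integrable[of "Suc n"] weight_intros weight_R weight_mono[OF W]) simp_all
  have i4: "integrable M (\<lambda>\<omega>. W \<omega> * Z n \<omega>)"
    by (intro weight_integrable[of n] weight_intros W) simp_all
  have V: "weight (Suc n) (\<lambda>\<omega>. W \<omega> * (Z (Suc n) \<omega> - Z n \<omega>)\<^sup>2)"
    by (intro weight_intros weight_mono[OF W]) simp_all
  have "AE \<omega> in M. W \<omega> * (Z (Suc n) \<omega> - Z n \<omega>)\<^sup>2 \<le> ?B \<omega>"
    using AE_steps AE_R_bounds
  proof eventually_elim
    case (elim \<omega>)
    note st = elim(1)[rule_format, of n] and r = elim(2)[rule_format, of n]
    define t' where "t' = s (Suc n) \<omega>"
    have t: "t' \<ge> real n + 1" using st by (auto simp: t'_def)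
    have "(Z (Suc n) \<omega> - Z n \<omega>)\<^sup>2 = (\<bar>R n \<omega>\<bar> * \<bar>R n \<omega>\<bar>) / (t' * t')"
      by (simp add: Z_step' t'_def power2_eq_square)
    also have "\<dots> \<le> ((2 * c) * (h (Suc n) \<omega> - h n \<omega> + c * Z n \<omega>)) / ((real n + 1) * (real n + 1))"
      using t r c_ge_2 st Z_bounds(1)[of n \<omega>] by (intro frac_le mult_mono) (auto intro!: mult_nonneg_nonneg)
    finally have "W \<omega> * (Z (Suc n) \<omega> - Z n \<omega>)\<^sup>2 \<le>
       W \<omega> * (((2 * c) * (h (Suc n) \<omega> - h n \<omega> + c * Z n \<omega>)) / ((real n + 1) * (real n + 1)))"
      using nonneg by (intro mult_left_mono) auto
    also have "\<dots> = ?B \<omega>" by (simp add: power2_eq_square field_simps)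
    finally show ?case .
  qed
  then have "(\<integral>\<omega>. W \<omega> * (Z (Suc n) \<omega> - Z n \<omega>)\<^sup>2 \<partial>M) \<le> (\<integral>\<omega>. ?B \<omega> \<partial>M)"

    by (rule integral_weight_mono[OF V B])
  also have "\<dots> = 2 * c / (real n + 1)\<^sup>2 * ((\<integral>\<omega>. W \<omega> * (h (Suc n) \<omega> - h n \<omega>) \<partial>M) + c * (\<integral>\<omega>. W \<omega> * Z n \<omega> \<partial>M))"
    using i3 i4 by simp
  also have "\<dots> \<le> 2 * c / (real n + 1)\<^sup>2 * (c * (\<integral>\<omega>. W \<omega> * Z n \<omega> \<partial>M) + c * (\<integral>\<omega>. W \<omega> * Z n \<omega> \<partial>M))"
    using c_ge_2 integral_h_step[OF W] integral_\<nu>_bounds(2)[OF W'] nonneg Z_bounds(1)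
    by (intro mult_left_mono add_mono) (auto simp: less_imp_le)
  finally show ?thesis by (simp add: power2_eq_square algebra_simps)
qed

section \<open>First and second moments over many steps\<close>

lemma integral_weight_add:
  assumes "weight i V" "weight j W"
  shows "(\<integral>\<omega>. V \<omega> + W \<omega> \<partial>M) = (\<integral>\<omega>. V \<omega> \<partial>M) + (\<integral>\<omega>. W \<omega> \<partial>M)"
  by (rule Bochner_Integration.integral_add[OF assms(1)[THEN weight_integrable] assms(2)[THEN weight_integrable]])

text \<open>The drift multiplies the mean of \<open>Z i\<close> by at most
  \<open>1 + 4 * c^2 / (i + 1)^2\<close> per step. These factors are bounded by exponentials whose
  exponents sum to at most \<open>8 * c^2\<close>. The multiplicative form keeps the bound
  proportional to \<open>Z n\<close>, which an additive error would destroy.\<close>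

lemma integral_Z_le:
  assumes W: "weight n W" and nonneg: "\<And>\<omega>. W \<omega> \<ge> 0" and "n \<le> j"
  shows "(\<integral>\<omega>. W \<omega> * Z j \<omega> \<partial>M) \<le> exp (8 * c\<^sup>2) * (\<integral>\<omega>. W \<omega> * Z n \<omega> \<partial>M)"
proof -
  define u where "u i = (\<integral>\<omega>. W \<omega> * Z i \<omega> \<partial>M)" for i
  have u0: "u i \<ge> 0" for i
    unfolding u_def using nonneg Z_bounds(1) by (intro integral_nonneg_AE AE_I2 mult_nonneg_nonneg) (auto simp: less_imp_le)
  have u_step: "u (Suc i) \<le> u i * exp (8 * c\<^sup>2 * (1 / (real i + 1) - 1 / (real i + 2)))" if "i \<ge> n" for i
  proof -
    have Wi: "weight i W" using W that by (rule weight_mono)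
    have V1: "weight i (\<lambda>\<omega>. W \<omega> * Z i \<omega>)" by (intro weight_intros Wi) simp
    have V2: "weight (Suc i) (\<lambda>\<omega>. W \<omega> * (Z (Suc i) \<omega> - Z i \<omega>))"
      by (intro weight_intros weight_mono[OF Wi]) simp_all
    have "u (Suc i) = (\<integral>\<omega>. W \<omega> * Z i \<omega> + W \<omega> * (Z (Suc i) \<omega> - Z i \<omega>) \<partial>M)"
      unfolding u_def by (intro Bochner_Integration.integral_cong) (auto simp: algebra_simps)
    also have "\<dots> = u i + (\<integral>\<omega>. W \<omega> * (Z (Suc i) \<omega> - Z i \<omega>) \<partial>M)"
      unfolding u_def by (rule integral_weight_add[OF V1 V2])
    also have "\<dots> \<le> u i + 4 * c\<^sup>2 / (real i + 1)\<^sup>2 * u i"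
      using drift[OF Wi] nonneg by (simp add: u_def)
    also have "\<dots> = u i * (1 + 4 * c\<^sup>2 * (1 / (real i + 1)\<^sup>2))"
      by (simp add: algebra_simps)
    also have "\<dots> \<le> u i * exp (4 * c\<^sup>2 * (1 / (real i + 1)\<^sup>2))"
      by (intro mult_left_mono u0 exp_ge_add_one_self)
    also have "\<dots> \<le> u i * exp (8 * c\<^sup>2 * (1 / (real i + 1) - 1 / (real i + 2)))"
      using mult_left_mono[OF inverse_square_bounds(2)[of i], of "4 * c\<^sup>2"]
      by (intro mult_left_mono u0) (simp_all add: right_diff_distrib)
    finally show ?thesis .
  qed
  have "u j \<le> u n * exp (8 * c\<^sup>2 * (1 / (real n + 1) - 1 / (real j + 1)))"
    using \<open>n \<le> j\<close>
  proof (induction j rule: dec_induct)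
    case (step i)
    have "u (Suc i) \<le> (u n * exp (8 * c\<^sup>2 * (1 / (real n + 1) - 1 / (real i + 1)))) *
        exp (8 * c\<^sup>2 * (1 / (real i + 1) - 1 / (real i + 2)))"
      using \<open>n \<le> i\<close> step.IH by (intro order_trans[OF u_step] mult_right_mono) auto
    also have "\<dots> = u n * exp (8 * c\<^sup>2 * (1 / (real n + 1) - 1 / (real i + 1)) +
        8 * c\<^sup>2 * (1 / (real i + 1) - 1 / (real i + 2)))"
      by (simp only: exp_add mult.assoc)
    also have "8 * c\<^sup>2 * (1 / (real n + 1) - 1 / (real i + 1)) + 8 * c\<^sup>2 * (1 / (real i + 1) - 1 / (real i + 2))
      = 8 * c\<^sup>2 * (1 / (real n + 1) - 1 / (real (Suc i) + 1))"
      by (simp add: algebra_simps)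
    finally show ?case .
  qed simp
  also have "\<dots> \<le> u n * exp (8 * c\<^sup>2 * 1)"
  proof -
    have "1 / (real n + 1) - 1 / (real j + 1) \<le> 1 / (real n + 1)" by simp
    also have "\<dots> \<le> 1" by simp
    finally show ?thesis
      by (intro mult_left_mono u0) (simp add: mult_left_le)
  qed
  finally show ?thesis by (simp add: u_def mult.commute)
qed

text \<open>Per step the second moment gains \<open>2 * 4 + 4 = 12\<close> times
  \<open>c^2 / (i + 1)^2\<close>, from the cross term and from the quadratic variation. The
  exponential comes from \<open>integral_Z_le\<close>, and telescoping doubles the constant.\<close>

definition \<kappa> :: real where "\<kappa> = 24 * c\<^sup>2 * exp (8 * c\<^sup>2)"

lemma \<kappa>_pos: "\<kappa> > 0"
  using c_ge_2 by (simp add: \<kappa>_def)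

text \<open>Expanding the square leaves a cross term, controlled by \<open>drift\<close>, and the
  quadratic variation; as \<open>Z\<close> and \<open>\<zeta>\<close> lie in the unit interval, both
  are of order \<open>Z i / i^2\<close>. The centre may be random: \<open>Z n\<close> measures the
  later fluctuation, a constant \<open>z\<close> the distance to a possible atom.\<close>

lemma second_moment:
  assumes W: "weight n W" and nonneg: "\<And>\<omega>. W \<omega> \<ge> 0" and "n \<le> j"
    and \<zeta>: "weight n \<zeta>" "\<And>\<omega>. 0 \<le> \<zeta> \<omega>" "\<And>\<omega>. \<zeta> \<omega> \<le> 1"
  shows "(\<integral>\<omega>. W \<omega> * (Z j \<omega> - \<zeta> \<omega>)\<^sup>2 \<partial>M) \<le> (\<integral>\<omega>. W \<omega> * (Z n \<omega> - \<zeta> \<omega>)\<^sup>2 \<partial>M)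
    + \<kappa> * (\<integral>\<omega>. W \<omega> * Z n \<omega> \<partial>M) * (1 / (real n + 1) - 1 / (real j + 1))"
proof -
  define q where "q = 12 * c\<^sup>2 * exp (8 * c\<^sup>2) * (\<integral>\<omega>. W \<omega> * Z n \<omega> \<partial>M)"
  define u where "u i = (\<integral>\<omega>. W \<omega> * (Z i \<omega> - \<zeta> \<omega>)\<^sup>2 \<partial>M)" for i
  have q0: "q \<ge> 0"
    unfolding q_def using nonneg Z_bounds(1)
    by (intro mult_nonneg_nonneg integral_nonneg_AE AE_I2) (auto simp: less_imp_le)
  have step: "u (Suc i) \<le> u i + q / (real i + 1)\<^sup>2" if "i \<ge> n" for i
  proof -
    let ?D = "\<lambda>\<omega>. Z (Suc i) \<omega> - Z i \<omega>" and ?Y = "\<lambda>\<omega>. Z i \<omega> - \<zeta> \<omega>"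
    note Wi = weight_mono[OF W that] and \<zeta>i = weight_mono[OF \<zeta>(1) that]
    have V0: "weight i (\<lambda>\<omega>. W \<omega> * ?Y \<omega>)" by (intro weight_intros Wi \<zeta>i) simp
    have V1: "weight (Suc i) (\<lambda>\<omega>. W \<omega> * (?Y \<omega>)\<^sup>2)"
      by (intro weight_intros weight_mono[OF Wi] weight_mono[OF \<zeta>i]) simp_all
    have V2: "weight (Suc i) (\<lambda>\<omega>. (W \<omega> * ?Y \<omega>) * ?D \<omega>)"
      by (intro weight_intros weight_mono[OF Wi] weight_mono[OF \<zeta>i]) simp_all
    have V2': "weight (Suc i) (\<lambda>\<omega>. 2 * ((W \<omega> * ?Y \<omega>) * ?D \<omega>))"
      by (intro weight_intros weight_mono[OF Wi] weight_mono[OF \<zeta>i]) simp_all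
    have V3: "weight (Suc i) (\<lambda>\<omega>. W \<omega> * (?D \<omega>)\<^sup>2)"
      by (intro weight_intros weight_mono[OF Wi] weight_mono[OF \<zeta>i]) simp_all
    have V4: "weight i (\<lambda>\<omega>. \<bar>W \<omega> * ?Y \<omega>\<bar> * Z i \<omega>)" by (intro weight_intros Wi \<zeta>i) simp_all
    have V5: "weight i (\<lambda>\<omega>. W \<omega> * Z i \<omega>)" by (intro weight_intros Wi \<zeta>i) simp_all
    have "u (Suc i) = (\<integral>\<omega>. (W \<omega> * (?Y \<omega>)\<^sup>2 + 2 * ((W \<omega> * ?Y \<omega>) * ?D \<omega>)) + W \<omega> * (?D \<omega>)\<^sup>2 \<partial>M)"
      unfolding u_def by (intro Bochner_Integration.integral_cong) (auto simp: algebra_simps power2_eq_square)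
    also have "\<dots> = u i + 2 * (\<integral>\<omega>. (W \<omega> * ?Y \<omega>) * ?D \<omega> \<partial>M) + (\<integral>\<omega>. W \<omega> * (?D \<omega>)\<^sup>2 \<partial>M)"
      unfolding u_def using integral_weight_add[OF weight_add[OF V1 V2'] V3] integral_weight_add[OF V1 V2']
      by simp
    also have "\<dots> \<le> u i + 2 * (4 * c\<^sup>2 / (real i + 1)\<^sup>2 * (\<integral>\<omega>. W \<omega> * Z i \<omega> \<partial>M))
        + 4 * c\<^sup>2 / (real i + 1)\<^sup>2 * (\<integral>\<omega>. W \<omega> * Z i \<omega> \<partial>M)"
    proof (intro add_mono order_refl mult_left_mono quadratic_variation[OF Wi nonneg])
      have "(\<integral>\<omega>. \<bar>W \<omega> * ?Y \<omega>\<bar> * Z i \<omega> \<partial>M) \<le> (\<integral>\<omega>. W \<omega> * Z i \<omega> \<partial>M)"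
      proof (rule integral_weight_mono[OF V4 V5 AE_I2])
        fix \<omega>
        have "\<bar>?Y \<omega>\<bar> \<le> 1" using Z_bounds[of i \<omega>] \<zeta>(2,3)[of \<omega>] by (simp add: abs_le_iff)
        then have "\<bar>W \<omega> * ?Y \<omega>\<bar> \<le> W \<omega>" using nonneg[of \<omega>] by (simp add: abs_mult mult_left_le)
        then show "\<bar>W \<omega> * ?Y \<omega>\<bar> * Z i \<omega> \<le> W \<omega> * Z i \<omega>"
          using Z_bounds(1)[of i \<omega>] by (intro mult_right_mono) auto
      qed
      then have "4 * c\<^sup>2 / (real i + 1)\<^sup>2 * (\<integral>\<omega>. \<bar>W \<omega> * ?Y \<omega>\<bar> * Z i \<omega> \<partial>M)
          \<le> 4 * c\<^sup>2 / (real i + 1)\<^sup>2 * (\<integral>\<omega>. W \<omega> * Z i \<omega> \<partial>M)"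
        by (intro mult_left_mono) auto
      with drift[OF V0] show "(\<integral>\<omega>. (W \<omega> * ?Y \<omega>) * ?D \<omega> \<partial>M) \<le> 4 * c\<^sup>2 / (real i + 1)\<^sup>2 * (\<integral>\<omega>. W \<omega> * Z i \<omega> \<partial>M)"
        by linarith
    qed simp
    also have "\<dots> = u i + 12 * c\<^sup>2 / (real i + 1)\<^sup>2 * (\<integral>\<omega>. W \<omega> * Z i \<omega> \<partial>M)" by simp
    also have "\<dots> \<le> u i + 12 * c\<^sup>2 / (real i + 1)\<^sup>2 * (exp (8 * c\<^sup>2) * (\<integral>\<omega>. W \<omega> * Z n \<omega> \<partial>M))"
      by (intro add_left_mono mult_left_mono integral_Z_le[OF W nonneg that]) simp
    finally show ?thesis by (simp add: q_def)
  qed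
  show ?thesis
    using telescoping_upper[of n u q j, OF step q0 \<open>n \<le> j\<close>] by (simp add: q_def \<kappa>_def u_def mult_ac)
qed

section \<open>Almost sure convergence\<close>

text \<open>Along the cubes the increments of \<open>Z\<close> are absolutely summable, by the second-moment bound; between
  consecutive cubes the steps, each of order \<open>1 / n\<close>, add up to something that vanishes.\<close>

lemma AE_cube_increments_summable: "AE \<omega> in M. summable (\<lambda>i. \<bar>Z ((i + 1) ^ 3) \<omega> - Z (i ^ 3) \<omega>\<bar>)"
proof -
  define D where "D i \<omega> = Z ((i + 1) ^ 3) \<omega> - Z (i ^ 3) \<omega>" for i \<omega>
  have wD: "weight ((i + 1) ^ 3) (D i)" for i
    unfolding D_def[abs_def] by (intro weight_intros) (simp_all add: power_mono)
  have [measurable]: "D i \<in> borel_measurable M" for i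
    using weight_measurable[OF wD] .
  \<comment> \<open>Centring at \<open>Z (i ^ 3)\<close> removes the initial term. Reciprocals of
    consecutive cubes differ by order \<open>1 / i ^ 4\<close>, and the square root of this is
    summable.\<close>
  have D2: "(\<integral>\<omega>. (D i \<omega>)\<^sup>2 \<partial>M) \<le> 12 * \<kappa> / (real i + 1) ^ 4" for i
  proof -
    have "(\<integral>\<omega>. 1 * (Z ((i + 1) ^ 3) \<omega> - Z (i ^ 3) \<omega>)\<^sup>2 \<partial>M) \<le> (\<integral>\<omega>. 1 * (Z (i ^ 3) \<omega> - Z (i ^ 3) \<omega>)\<^sup>2 \<partial>M) +
       \<kappa> * (\<integral>\<omega>. 1 * Z (i ^ 3) \<omega> \<partial>M) * (1 / (real (i ^ 3) + 1) - 1 / (real ((i + 1) ^ 3) + 1))"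
      using Z_bounds by (intro second_moment weight_const weight_Z power_mono) (auto simp: less_imp_le)
    also have "(\<integral>\<omega>. 1 * Z (i ^ 3) \<omega> \<partial>M) \<le> (\<integral>\<omega>. 1 \<partial>M)"
      using Z_bounds(2) by (intro integral_weight_mono[OF _ weight_const AE_I2, where i = "i ^ 3"] weight_mult weight_const weight_Z) (simp add: less_imp_le)
    then have "(\<integral>\<omega>. 1 * (Z (i ^ 3) \<omega> - Z (i ^ 3) \<omega>)\<^sup>2 \<partial>M) +
       \<kappa> * (\<integral>\<omega>. 1 * Z (i ^ 3) \<omega> \<partial>M) * (1 / (real (i ^ 3) + 1) - 1 / (real ((i + 1) ^ 3) + 1))
      \<le> \<kappa> * (1 / (real (i ^ 3) + 1) - 1 / (real ((i + 1) ^ 3) + 1))"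
    proof -
      have "1 / (real ((i + 1) ^ 3) + 1) \<le> 1 / (real (i ^ 3) + 1)"
        using power_mono[of "real i" "real i + 1" 3] by (intro divide_left_mono) (auto intro!: mult_pos_pos add_nonneg_pos)
      moreover have "\<kappa> * (\<integral>\<omega>. 1 * Z (i ^ 3) \<omega> \<partial>M) \<le> \<kappa> * 1"
        using \<open>(\<integral>\<omega>. 1 * Z (i ^ 3) \<omega> \<partial>M) \<le> (\<integral>\<omega>. 1 \<partial>M)\<close> \<kappa>_pos by (intro mult_left_mono) (auto simp: prob_space)
      ultimately show ?thesis
        using mult_right_mono[of "\<kappa> * (\<integral>\<omega>. 1 * Z (i ^ 3) \<omega> \<partial>M)" "\<kappa> * 1" "1 / (real (i ^ 3) + 1) - 1 / (real ((i + 1) ^ 3) + 1)"]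
        by simp
    qed
    also have "1 / (real (i ^ 3) + 1) - 1 / (real ((i + 1) ^ 3) + 1) =
        (real ((i + 1) ^ 3) - real (i ^ 3)) / ((real (i ^ 3) + 1) * (real ((i + 1) ^ 3) + 1))"
      by (simp add: diff_frac_eq add_pos_nonneg add_nonneg_eq_0_iff)
    \<comment> \<open>The numerator is bounded by \<open>cube_gap\<close>; the \<open>1 / 4\<close>
      in the denominator comes from \<open>cube_lower\<close> and produces the 12.\<close>
    also have "\<dots> \<le> 3 * (real i + 1)\<^sup>2 / (((real i + 1) ^ 3 / 4) * (real i + 1) ^ 3)"
      using cube_gap[of i] cube_lower[of i] by (intro frac_le mult_mono) (auto simp: add.commute)
    also have "\<dots> = 12 / (real i + 1) ^ 4"
    proof -
      have "x \<noteq> 0 \<Longrightarrow> 3 * x\<^sup>2 / ((x ^ 3 / 4) * x ^ 3) = 12 / x ^ 4" for x :: real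
        by (simp add: power2_eq_square power3_eq_cube power4_eq_xxxx)
      from this[of "real i + 1"] show ?thesis by linarith
    qed
    finally show ?thesis using \<kappa>_pos by (simp add: D_def mult.commute)
  qed
  have D1: "(\<integral>\<omega>. \<bar>D i \<omega>\<bar> \<partial>M) \<le> (12 * \<kappa> + 1) * (1 / (real i + 1)\<^sup>2)" for i
  proof -
    \<comment> \<open>A second moment of order \<open>1 / ?t^2\<close> gives a first absolute moment
      of order \<open>1 / ?t\<close> through \<open>\<bar>x\<bar> \<le> ?t * x^2 + 1 / ?t\<close>,
      which stands in for Cauchy-Schwarz.\<close>
    let ?t = "(real i + 1)\<^sup>2"
    have V: "weight ((i + 1) ^ 3) (\<lambda>\<omega>. ?t * (D i \<omega>)\<^sup>2)" by (intro weight_intros wD)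
    have "(\<integral>\<omega>. \<bar>D i \<omega>\<bar> \<partial>M) \<le> (\<integral>\<omega>. ?t * (D i \<omega>)\<^sup>2 + 1 / ?t \<partial>M)"
    proof (rule integral_weight_mono[OF weight_abs[OF wD] weight_add[OF V weight_const] AE_I2])
      fix \<omega>
      have "0 \<le> (?t * \<bar>D i \<omega>\<bar> - 1)\<^sup>2 / ?t" by simp
      also have "\<dots> = ?t * (D i \<omega>)\<^sup>2 - 2 * \<bar>D i \<omega>\<bar> + 1 / ?t"
      proof -
        have "t > 0 \<Longrightarrow> (t * \<bar>y\<bar> - 1)\<^sup>2 / t = t * y\<^sup>2 - 2 * \<bar>y\<bar> + 1 / t" for t y :: real
          by (simp add: power2_eq_square field_simps)
        then show ?thesis by (simp add: add_nonneg_pos)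
      qed
      finally show "\<bar>D i \<omega>\<bar> \<le> ?t * (D i \<omega>)\<^sup>2 + 1 / ?t" by linarith
    qed
    also have "\<dots> = ?t * (\<integral>\<omega>. (D i \<omega>)\<^sup>2 \<partial>M) + 1 / ?t"
      using integral_weight_add[OF V weight_const[of 0 "1 / ?t"]] by (simp add: prob_space)
    also have "\<dots> \<le> ?t * (12 * \<kappa> / (real i + 1) ^ 4) + 1 / ?t"
      by (intro add_right_mono mult_left_mono D2) simp
    also have "\<dots> = (12 * \<kappa> + 1) * (1 / ?t)"
      by (simp add: power4_eq_xxxx power2_eq_square add_divide_distrib)
    finally show ?thesis .
  qed
  have sm: "summable (\<lambda>i. \<integral>\<omega>. \<bar>D i \<omega>\<bar> \<partial>M)"
  proof (rule summable_comparison_test')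
    have "summable (\<lambda>i. 1 / (real (Suc i))\<^sup>2)"
      using inverse_power_summable[of 2, where 'a = real] summable_Suc_iff[of "\<lambda>i. inverse (real i ^ 2)"]
      by (simp add: inverse_eq_divide del: of_nat_Suc)
    then show "summable (\<lambda>i. (12 * \<kappa> + 1) * (1 / (real i + 1)\<^sup>2))"
      by (intro summable_mult) (simp add: add.commute)
    show "norm (\<integral>\<omega>. \<bar>D i \<omega>\<bar> \<partial>M) \<le> (12 * \<kappa> + 1) * (1 / (real i + 1)\<^sup>2)" if "i \<ge> 0" for i
      using D1[of i] by simp
  qed
  have "(\<integral>\<^sup>+\<omega>. (\<Sum>i. ennreal \<bar>D i \<omega>\<bar>) \<partial>M) = (\<Sum>i. \<integral>\<^sup>+\<omega>. ennreal \<bar>D i \<omega>\<bar> \<partial>M)"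
    by (rule nn_integral_suminf) measurable
  also have "\<dots> = (\<Sum>i. ennreal (\<integral>\<omega>. \<bar>D i \<omega>\<bar> \<partial>M))"
    by (intro suminf_cong nn_integral_eq_integral weight_integrable[OF weight_abs[OF wD]]) simp
  also have "\<dots> = ennreal (\<Sum>i. \<integral>\<omega>. \<bar>D i \<omega>\<bar> \<partial>M)"
    by (rule suminf_ennreal2[OF _ sm]) simp
  also have "\<dots> \<noteq> \<infinity>" by (rule ennreal_neq_top[folded infinity_ennreal_def])
  \<comment> \<open>By Tonelli the series has finite mean, so it is finite almost surely.\<close>
  finally have "AE \<omega> in M. (\<Sum>i. ennreal \<bar>D i \<omega>\<bar>) \<noteq> \<infinity>"
    by (intro nn_integral_PInf_AE) measurable
  then show ?thesis
  proof eventually_elim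
    case (elim \<omega>)
    then show ?case unfolding D_def by (intro summable_suminf_not_top) auto
  qed
qed

text \<open>A total function: where the sequence diverges the value carries no meaning, yet
  measurability holds on the whole space. Bounds on \<open>Z_lim\<close> are therefore only almost
  sure.\<close>

definition Z_lim :: "'w \<Rightarrow> real" where "Z_lim \<omega> = lim (\<lambda>n. Z n \<omega>)"

lemma measurable_Z [measurable]: "Z n \<in> borel_measurable M"
  by (rule weight_measurable[OF weight_Z])

lemma measurable_Z_lim [measurable]: "Z_lim \<in> borel_measurable M"
  unfolding Z_lim_def[abs_def] by (rule borel_measurable_lim_metric) measurable

theorem AE_tendsto_Z_lim: "AE \<omega> in M. (\<lambda>n. Z n \<omega>) \<longlonglongrightarrow> Z_lim \<omega>"
  using AE_cube_increments_summable AE_R_bounds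
proof eventually_elim
  case (elim \<omega>)
  have "summable (\<lambda>i. Z (Suc i ^ 3) \<omega> - Z (i ^ 3) \<omega>)"
    using summable_rabs_cancel[OF elim(1)] by simp
  then have "(\<lambda>m. \<Sum>i<m. Z (Suc i ^ 3) \<omega> - Z (i ^ 3) \<omega>) \<longlonglongrightarrow> (\<Sum>i. Z (Suc i ^ 3) \<omega> - Z (i ^ 3) \<omega>)"
    by (rule summable_LIMSEQ)
  moreover have "(\<Sum>i<m. Z (Suc i ^ 3) \<omega> - Z (i ^ 3) \<omega>) = Z (m ^ 3) \<omega> - Z 0 \<omega>" for m
    using sum_lessThan_telescope[of "\<lambda>i. Z (i ^ 3) \<omega>" m] by simp
  ultimately have "(\<lambda>m. Z (m ^ 3) \<omega> - Z 0 \<omega>) \<longlonglongrightarrow> (\<Sum>i. Z (Suc i ^ 3) \<omega> - Z (i ^ 3) \<omega>)"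
    by simp
  from tendsto_add[OF this tendsto_const[of "Z 0 \<omega>"]] obtain L where L: "(\<lambda>m. Z (m ^ 3) \<omega>) \<longlonglongrightarrow> L"
    by auto
  have "(\<lambda>n. Z n \<omega>) \<longlonglongrightarrow> L"
  \<comment> \<open>A block of cubes has at most \<open>3 * (i + 1)^2\<close> steps, each of size at
    most \<open>c / (i ^ 3 + 1)\<close> and hence at most \<open>4 * c / (i + 1) ^ 3\<close>; the
    product is the error chosen here.\<close>
  proof (rule tendsto_along_cubes[OF L, where e = "\<lambda>i. 12 * c * (1 / (real i + 1))"])
    show "(\<lambda>i. 12 * c * (1 / (real i + 1))) \<longlonglongrightarrow> 0"
      using LIMSEQ_inverse_real_of_nat by (intro tendsto_mult_right_zero) (simp add: inverse_eq_divide add.commute)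
  next
    fix i n :: nat
    assume n: "i ^ 3 \<le> n" "n \<le> (i + 1) ^ 3"
    have "\<bar>Z n \<omega> - Z (i ^ 3) \<omega>\<bar> \<le> (\<Sum>j=i^3..<n. \<bar>Z (Suc j) \<omega> - Z j \<omega>\<bar>)"
      using sum_Suc_diff'[OF n(1), of "\<lambda>j. Z j \<omega>"] sum_abs[of "\<lambda>j. Z (Suc j) \<omega> - Z j \<omega>" "{i^3..<n}"] by simp
    also have "\<dots> \<le> (\<Sum>j=i^3..<n. c / (real (i ^ 3) + 1))"
    proof (rule sum_mono)
      fix j assume "j \<in> {i^3..<n}"
      then have "c / (real j + 1) \<le> c / (real (i ^ 3) + 1)"
        using c_ge_2 by (intro divide_left_mono) (auto simp flip: of_nat_power intro!: mult_pos_pos add_nonneg_pos)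
      then show "\<bar>Z (Suc j) \<omega> - Z j \<omega>\<bar> \<le> c / (real (i ^ 3) + 1)"
        using elim(2)[rule_format, of j] by linarith
    qed
    also have "\<dots> = (real n - real (i ^ 3)) * c / (real (i ^ 3) + 1)"
      using n(1) by (simp add: of_nat_diff)
    also have "\<dots> \<le> (3 * (real i + 1)\<^sup>2) * c / ((real i + 1) ^ 3 / 4)"
    proof (intro frac_le mult_right_mono)
      have "real n \<le> real ((i + 1) ^ 3)" using n(2) by (simp only: of_nat_le_iff)
      then show "real n - real (i ^ 3) \<le> 3 * (real i + 1)\<^sup>2" using cube_gap[of i] by linarith
    qed (use c_ge_2 cube_lower[of i] in auto)
    also have "\<dots> = 12 * c * (1 / (real i + 1))"
    proof -
      have "x \<noteq> 0 \<Longrightarrow> 3 * x\<^sup>2 * c / (x ^ 3 / 4) = 12 * c * (1 / x)" for x :: real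
        by (simp add: power2_eq_square power3_eq_cube)
      then show ?thesis by simp
    qed
    finally show "\<bar>Z n \<omega> - Z (i ^ 3) \<omega>\<bar> \<le> 12 * c * (1 / (real i + 1))" .
  qed
  then show ?case unfolding Z_lim_def by (simp add: limI)
qed

lemma AE_Z_lim_bounds: "AE \<omega> in M. 0 \<le> Z_lim \<omega> \<and> Z_lim \<omega> \<le> 1"
  using AE_tendsto_Z_lim
proof eventually_elim
  case (elim \<omega>)
  have "0 \<le> Z n \<omega>" "Z n \<omega> \<le> 1" for n using Z_bounds[of n \<omega>] by auto
  then show ?case
    by (intro conjI LIMSEQ_le_const[OF elim] LIMSEQ_le_const2[OF elim] exI allI impI)
qed

section \<open>Passing moments to the limit\<close>

lemma moment_tendsto:
  assumes W: "weight n W" and \<zeta>: "weight n \<zeta>" "\<And>\<omega>. 0 \<le> \<zeta> \<omega>" "\<And>\<omega>. \<zeta> \<omega> \<le> 1"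
  shows "(\<lambda>j. \<integral>\<omega>. W \<omega> * (Z j \<omega> - \<zeta> \<omega>) ^ p \<partial>M) \<longlonglongrightarrow> (\<integral>\<omega>. W \<omega> * (Z_lim \<omega> - \<zeta> \<omega>) ^ p \<partial>M)"
proof (rule integral_dominated_convergence)
  note [measurable] = weight_measurable[OF W] weight_measurable[OF \<zeta>(1)]
  show "(\<lambda>\<omega>. W \<omega> * (Z_lim \<omega> - \<zeta> \<omega>) ^ p) \<in> borel_measurable M" by measurable
  show "(\<lambda>\<omega>. W \<omega> * (Z j \<omega> - \<zeta> \<omega>) ^ p) \<in> borel_measurable M" for j by measurable
  show "integrable M (\<lambda>\<omega>. \<bar>W \<omega>\<bar>)" by (rule weight_integrable[OF weight_abs[OF W]])
  show "AE \<omega> in M. (\<lambda>j. W \<omega> * (Z j \<omega> - \<zeta> \<omega>) ^ p) \<longlonglongrightarrow> W \<omega> * (Z_lim \<omega> - \<zeta> \<omega>) ^ p"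
    using AE_tendsto_Z_lim by eventually_elim (intro tendsto_intros)
  show "AE \<omega> in M. norm (W \<omega> * (Z j \<omega> - \<zeta> \<omega>) ^ p) \<le> \<bar>W \<omega>\<bar>" for j
  proof (rule AE_I2)
    fix \<omega>
    have "\<bar>Z j \<omega> - \<zeta> \<omega>\<bar> ^ p \<le> 1"
      using Z_bounds[of j \<omega>] \<zeta>(2,3)[of \<omega>] by (intro power_le_one) (auto simp: abs_le_iff)
    then show "norm (W \<omega> * (Z j \<omega> - \<zeta> \<omega>) ^ p) \<le> \<bar>W \<omega>\<bar>"
      by (simp add: abs_mult power_abs mult_left_le)
  qed
qed

text \<open>With \<open>Z n\<close> as centre the initial term of \<open>second_moment\<close>
  vanishes. The factor \<open>Z n\<close> survives the limit; the boundary argument depends on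
  it.\<close>

lemma second_moment_limit:
  assumes W: "weight n W" and nonneg: "\<And>\<omega>. W \<omega> \<ge> 0"
  shows "(\<integral>\<omega>. W \<omega> * (Z_lim \<omega> - Z n \<omega>)\<^sup>2 \<partial>M) \<le> \<kappa> * (\<integral>\<omega>. W \<omega> * Z n \<omega> \<partial>M) / (real n + 1)"
proof (rule LIMSEQ_le_const2)
  show "(\<lambda>j. \<integral>\<omega>. W \<omega> * (Z j \<omega> - Z n \<omega>)\<^sup>2 \<partial>M) \<longlonglongrightarrow> (\<integral>\<omega>. W \<omega> * (Z_lim \<omega> - Z n \<omega>)\<^sup>2 \<partial>M)"
    by (intro moment_tendsto[OF W weight_Z] less_imp_le Z_bounds)
  have pos: "(\<integral>\<omega>. W \<omega> * Z n \<omega> \<partial>M) \<ge> 0"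
    using nonneg Z_bounds(1) by (intro integral_nonneg_AE AE_I2 mult_nonneg_nonneg) (auto simp: less_imp_le)
  have "(\<integral>\<omega>. W \<omega> * (Z j \<omega> - Z n \<omega>)\<^sup>2 \<partial>M) \<le> \<kappa> * (\<integral>\<omega>. W \<omega> * Z n \<omega> \<partial>M) / (real n + 1)" if "j \<ge> n" for j
  proof -
    have "(\<integral>\<omega>. W \<omega> * (Z j \<omega> - Z n \<omega>)\<^sup>2 \<partial>M) \<le> \<kappa> * (\<integral>\<omega>. W \<omega> * Z n \<omega> \<partial>M) * (1 / (real n + 1) - 1 / (real j + 1))"
      using second_moment[OF W nonneg that weight_Z less_imp_le[OF Z_bounds(1)] less_imp_le[OF Z_bounds(2)]] by simp
    also have "\<dots> \<le> \<kappa> * (\<integral>\<omega>. W \<omega> * Z n \<omega> \<partial>M) * (1 / (real n + 1))"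
      using \<kappa>_pos pos by (intro mult_left_mono) auto
    finally show ?thesis by simp
  qed
  then show "\<exists>N. \<forall>j\<ge>N. (\<integral>\<omega>. W \<omega> * (Z j \<omega> - Z n \<omega>)\<^sup>2 \<partial>M) \<le> \<kappa> * (\<integral>\<omega>. W \<omega> * Z n \<omega> \<partial>M) / (real n + 1)"
    by blast
qed

section \<open>The boundary\<close>

lemma weight_inverse_h: "weight n (\<lambda>\<omega>. 1 / h n \<omega>)"
proof (intro weight_bounded[where D = 1])
  show "\<bar>1 / h n \<omega>\<bar> \<le> 1" for \<omega>
    using h_ge_1[of n \<omega>] by (simp add: abs_le_iff divide_simps)
  show "(\<lambda>\<omega>. 1 / h n \<omega>) \<in> borel_measurable (F n)" using adapted_h[of n] by measurable
qed

text \<open>Since \<open>h n\<close> is at least 1, a step multiplies it by at most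
  \<open>1 + c\<close>, so \<open>1 / h\<close> drops by at least the increment of \<open>h\<close>
  divided by \<open>(1 + c) * (h n)^2\<close>. The mean increment is at least that of
  \<open>Z n = h n / s n\<close> because \<open>\<nu> n\<close> is at least 1, and
  \<open>s n\<close> is at most \<open>2 * c * (n + 1)\<close>.\<close>

lemma integral_inverse_h_step:
  "(\<integral>\<omega>. 1 / h (Suc n) \<omega> \<partial>M) \<le> (1 - 1 / (2 * c * (1 + c)) / (real n + 1)) * (\<integral>\<omega>. 1 / h n \<omega> \<partial>M)"
proof -
  let ?W = "\<lambda>\<omega>. (1 / h n \<omega>)\<^sup>2" and ?d = "\<lambda>\<omega>. h (Suc n) \<omega> - h n \<omega>"
  have W: "weight n ?W" by (intro weight_intros weight_inverse_h)
  have WZ: "weight n (\<lambda>\<omega>. ?W \<omega> * Z n \<omega>)" by (intro weight_intros weight_inverse_h) simp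
  have Wd: "weight (Suc n) (\<lambda>\<omega>. (1 / (1 + c)) * (?W \<omega> * ?d \<omega>))"
    by (intro weight_intros weight_mono[OF weight_inverse_h]) simp_all
  have Wh: "weight (Suc n) (\<lambda>\<omega>. 1 / h n \<omega>)" by (intro weight_mono[OF weight_inverse_h]) simp
  have Wc: "weight n (\<lambda>\<omega>. (1 / (2 * c * (real n + 1))) * (1 / h n \<omega>))"
    by (intro weight_intros weight_inverse_h)
  have "(\<integral>\<omega>. 1 / h (Suc n) \<omega> \<partial>M) \<le> (\<integral>\<omega>. 1 / h n \<omega> - (1 / (1 + c)) * (?W \<omega> * ?d \<omega>) \<partial>M)"
  proof (rule integral_weight_mono[OF weight_inverse_h weight_diff[OF Wh Wd]])
    show "AE \<omega> in M. 1 / h (Suc n) \<omega> \<le> 1 / h n \<omega> - (1 / (1 + c)) * (?W \<omega> * ?d \<omega>)"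
      using AE_steps
    proof eventually_elim
      case (elim \<omega>)
      define x y where "x = h n \<omega>" and "y = h (Suc n) \<omega>"
      have xy: "x \<ge> 1" "x \<le> y" "y \<le> x + c"
        using elim[rule_format, of n] h_ge_1[of n \<omega>] by (auto simp: x_def y_def)
      have "c \<le> c * x" using xy c_ge_2 mult_left_mono[of 1 x c] by simp
      then have "y \<le> (1 + c) * x" using xy by (simp add: algebra_simps)
      then have "(y - x) / (x * ((1 + c) * x)) \<le> (y - x) / (x * y)"
        using xy c_ge_2 by (intro divide_left_mono mult_left_mono mult_pos_pos) auto
      also have "\<dots> = 1 / x - 1 / y" using xy by (simp add: field_simps)
      finally have "1 / y \<le> 1 / x - (y - x) / (x * ((1 + c) * x))" by linarith
      also have "(y - x) / (x * ((1 + c) * x)) = (1 / (1 + c)) * ((1 / x)\<^sup>2 * (y - x))"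
        by (simp add: power2_eq_square)
      finally show ?case by (simp only: x_def y_def)
    qed
  qed
  also have "\<dots> = (\<integral>\<omega>. 1 / h n \<omega> \<partial>M) - (1 / (1 + c)) * (\<integral>\<omega>. ?W \<omega> * ?d \<omega> \<partial>M)"
    using Bochner_Integration.integral_diff[OF weight_integrable[OF Wh] weight_integrable[OF Wd]]
    by (simp only: integral_mult_right_zero)
  also have "\<dots> \<le> (\<integral>\<omega>. 1 / h n \<omega> \<partial>M) - (1 / (1 + c)) * ((1 / (2 * c * (real n + 1))) * (\<integral>\<omega>. 1 / h n \<omega> \<partial>M))"
  proof (intro diff_left_mono mult_left_mono)
    have "(1 / (2 * c * (real n + 1))) * (\<integral>\<omega>. 1 / h n \<omega> \<partial>M) = (\<integral>\<omega>. (1 / (2 * c * (real n + 1))) * (1 / h n \<omega>) \<partial>M)"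
      by (rule integral_mult_right_zero[symmetric])
    also have "\<dots> \<le> (\<integral>\<omega>. ?W \<omega> * Z n \<omega> \<partial>M)"
    proof (rule integral_weight_mono[OF Wc WZ])
      show "AE \<omega> in M. (1 / (2 * c * (real n + 1))) * (1 / h n \<omega>) \<le> ?W \<omega> * Z n \<omega>"
        using AE_steps
      proof eventually_elim
        case (elim \<omega>)
        have "?W \<omega> * Z n \<omega> = (1 / s n \<omega>) * (1 / h n \<omega>)"
          using h_ge_1[of n \<omega>] by (simp add: Z_def power2_eq_square)
        moreover have "1 / (2 * c * (real n + 1)) \<le> 1 / s n \<omega>"
          using elim[rule_format, of n] s_ge_2[of n \<omega>] by (intro divide_left_mono) auto
        ultimately show ?case
          using h_ge_1[of n \<omega>] by (simp only:) (intro mult_right_mono, auto)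
      qed
    qed
    also have "\<dots> \<le> (\<integral>\<omega>. ?W \<omega> * ?d \<omega> \<partial>M)"
      unfolding integral_h_step[OF W] using Z_bounds(1)[THEN less_imp_le]
      by (intro integral_\<nu>_bounds(1)[OF WZ]) simp
    finally show "(1 / (2 * c * (real n + 1))) * (\<integral>\<omega>. 1 / h n \<omega> \<partial>M) \<le> (\<integral>\<omega>. ?W \<omega> * ?d \<omega> \<partial>M)" .
  qed (use c_ge_2 in auto)
  also have "\<dots> = (1 - 1 / (2 * c * (1 + c)) / (real n + 1)) * (\<integral>\<omega>. 1 / h n \<omega> \<partial>M)"
    using c_ge_2 by (simp add: algebra_simps)
  finally show ?thesis .
qed

text \<open>The factors \<open>1 - \<alpha> / (n + 1)\<close> have product zero because the harmonic
  series diverges; comparison with the logarithm gives the explicit rate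
  \<open>(n + 1) powr (- \<alpha>)\<close>.\<close>

lemma integral_inverse_h_tendsto: "(\<lambda>n. \<integral>\<omega>. 1 / h n \<omega> \<partial>M) \<longlonglongrightarrow> 0"
proof -
  define u where "u n = (\<integral>\<omega>. 1 / h n \<omega> \<partial>M)" for n
  define \<alpha> where "\<alpha> = 1 / (2 * c * (1 + c))"
  have \<alpha>: "\<alpha> > 0" using c_ge_2 by (simp add: \<alpha>_def)
  have u0: "u n \<ge> 0" for n
    unfolding u_def using order_trans[OF zero_le_one h_ge_1] by (intro integral_nonneg_AE AE_I2) auto
  \<comment> \<open>The factor is written as a quotient of consecutive values of the target rate, so
    that the induction telescopes.\<close>
  have step: "u (Suc n) \<le> u n * (exp (- \<alpha> * ln (real n + 2)) / exp (- \<alpha> * ln (real n + 1)))" for n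
  proof -
    have "u (Suc n) \<le> u n * (1 + (- \<alpha> / (real n + 1)))"
      using integral_inverse_h_step[of n] by (simp add: u_def \<alpha>_def mult.commute)
    also have "\<dots> \<le> u n * exp (- \<alpha> / (real n + 1))"
      by (intro mult_left_mono u0 exp_ge_add_one_self)
    also have "\<dots> \<le> u n * exp (- \<alpha> * (ln (real n + 2) - ln (real n + 1)))"
    proof -
      have "ln (real n + 2) - ln (real n + 1) \<le> 1 / (real n + 1)"
        using ln_diff_le[of "real n + 2" "real n + 1"] by simp
      from mult_left_mono[OF this less_imp_le[OF \<alpha>]] show ?thesis
        by (intro mult_left_mono u0) (simp add: algebra_simps)
    qed
    finally show ?thesis by (simp add: exp_diff[symmetric] algebra_simps)
  qed
  have bound: "u n \<le> u 0 * exp (- \<alpha> * ln (real n + 1))" for n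
  proof (induction n)
    case (Suc n)
    have "u (Suc n) \<le> (u 0 * exp (- \<alpha> * ln (real n + 1))) * (exp (- \<alpha> * ln (real n + 2)) / exp (- \<alpha> * ln (real n + 1)))"
      by (rule order_trans[OF step mult_right_mono[OF Suc]]) simp
    then show ?case by (simp add: add.commute)
  qed simp
  have eq: "exp (- \<alpha> * ln (real n + 1)) = real (Suc n) powr (- \<alpha>)" for n
    by (simp add: powr_def add.commute)
  have lim: "(\<lambda>n. u 0 * exp (- \<alpha> * ln (real n + 1))) \<longlonglongrightarrow> 0"
    unfolding eq
  proof (intro tendsto_mult_right_zero tendsto_neg_powr)
    show "filterlim (\<lambda>n. real (Suc n)) at_top sequentially"
      by (rule filterlim_compose[OF filterlim_real_sequentially filterlim_Suc])
  qed (use \<alpha> in simp)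
  show ?thesis
    using tendsto_sandwich[of "\<lambda>_. 0" u sequentially "\<lambda>n. u 0 * exp (- \<alpha> * ln (real n + 1))" 0] u0 bound lim
    by (simp add: u_def[abs_def])
qed

text \<open>On \<open>Z_lim = 0\<close> the relative fluctuation \<open>(Z_lim - Z n) / Z n\<close> is \<open>-1\<close>, whereas its second moment
  given the past is of order \<open>1 / h n\<close>.\<close>

theorem Z_lim_no_atom_0: "measure M {\<omega> \<in> space M. Z_lim \<omega> = 0} = 0"
proof -
  have bound: "measure M {\<omega> \<in> space M. Z_lim \<omega> = 0} \<le> 2 * c * \<kappa> * (\<integral>\<omega>. 1 / h n \<omega> \<partial>M)" for n
  proof -
    \<comment> \<open>\<open>?W\<close> is the inverse square of \<open>Z n\<close>. For each fixed
      \<open>n\<close> it is almost surely bounded, hence a weight, though with a bound depending on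
      \<open>n\<close>.\<close>
    let ?W = "\<lambda>\<omega>. (s n \<omega> * (1 / h n \<omega>))\<^sup>2"
    have W: "weight n ?W"
      unfolding s_def by (intro weight_intros weight_inverse_h) simp_all
    have Wsh: "weight n (\<lambda>\<omega>. s n \<omega> * (1 / h n \<omega>))"
      unfolding s_def by (intro weight_intros weight_inverse_h) simp_all
    have Wc: "weight n (\<lambda>\<omega>. (2 * c * (real n + 1)) * (1 / h n \<omega>))"
      by (intro weight_intros weight_inverse_h)
    have WZ: "?W \<omega> * Z n \<omega> = s n \<omega> * (1 / h n \<omega>)" for \<omega>
      using h_ge_1[of n \<omega>] s_ge_2[of n \<omega>] by (simp add: Z_def power2_eq_square)
    have inv: "s n \<omega> * (1 / h n \<omega>) * Z n \<omega> = 1" for \<omega>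
      using h_ge_1[of n \<omega>] s_ge_2[of n \<omega>] by (simp add: Z_def)
    have "measure M {\<omega> \<in> space M. Z_lim \<omega> = 0} = (\<integral>\<omega>. indicator {\<omega> \<in> space M. Z_lim \<omega> = 0} \<omega> \<partial>M)"
      by simp
    also have "\<dots> \<le> (\<integral>\<omega>. ?W \<omega> * (Z_lim \<omega> - Z n \<omega>)\<^sup>2 \<partial>M)"
    proof (rule integral_mono_AE)
      show "integrable M (\<lambda>\<omega>. indicator {\<omega> \<in> space M. Z_lim \<omega> = 0} \<omega> :: real)"
        by (intro integrable_real_indicator) (auto simp: emeasure_eq_measure)
      obtain D where D: "AE \<omega> in M. \<bar>?W \<omega>\<bar> \<le> D" using W unfolding weight_def by blast
      show "integrable M (\<lambda>\<omega>. ?W \<omega> * (Z_lim \<omega> - Z n \<omega>)\<^sup>2)"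
      proof (rule integrable_const_bound)
        show "AE \<omega> in M. norm (?W \<omega> * (Z_lim \<omega> - Z n \<omega>)\<^sup>2) \<le> D"
          using D AE_Z_lim_bounds
        proof eventually_elim
          case (elim \<omega>)
          have "\<bar>Z_lim \<omega> - Z n \<omega>\<bar>\<^sup>2 \<le> 1"
            using elim Z_bounds[of n \<omega>] by (intro power_le_one) (auto simp: abs_le_iff)
          then have "\<bar>?W \<omega>\<bar> * \<bar>Z_lim \<omega> - Z n \<omega>\<bar>\<^sup>2 \<le> \<bar>?W \<omega>\<bar>"
            by (intro mult_left_le) auto
          then show ?case using elim by (simp add: abs_mult)
        qed
        show "(\<lambda>\<omega>. ?W \<omega> * (Z_lim \<omega> - Z n \<omega>)\<^sup>2) \<in> borel_measurable M"
          using weight_measurable[OF W] by measurable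
      qed
      show "AE \<omega> in M. indicator {\<omega> \<in> space M. Z_lim \<omega> = 0} \<omega> \<le> ?W \<omega> * (Z_lim \<omega> - Z n \<omega>)\<^sup>2"
      proof (rule AE_I2)
        fix \<omega>
        show "indicator {\<omega> \<in> space M. Z_lim \<omega> = 0} \<omega> \<le> ?W \<omega> * (Z_lim \<omega> - Z n \<omega>)\<^sup>2"
        proof (cases "Z_lim \<omega> = 0")
          case True
          then have "?W \<omega> * (Z_lim \<omega> - Z n \<omega>)\<^sup>2 = (s n \<omega> * (1 / h n \<omega>) * Z n \<omega>)\<^sup>2"
            by (simp only: power_mult_distrib diff_0 power2_minus)
          then show ?thesis unfolding inv by (simp add: indicator_def)
        qed (simp add: indicator_def)
      qed
    qed
    also have "\<dots> \<le> \<kappa> * (\<integral>\<omega>. ?W \<omega> * Z n \<omega> \<partial>M) / (real n + 1)"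
      by (rule second_moment_limit[OF W]) simp
    \<comment> \<open>\<open>?W * Z n\<close> is \<open>s n / h n\<close>, and the linear growth of
      \<open>s n\<close> cancels the denominator \<open>n + 1\<close>.\<close>
    also have "\<dots> \<le> \<kappa> * (\<integral>\<omega>. (2 * c * (real n + 1)) * (1 / h n \<omega>) \<partial>M) / (real n + 1)"
    proof (intro divide_right_mono mult_left_mono)
      show "(\<integral>\<omega>. ?W \<omega> * Z n \<omega> \<partial>M) \<le> (\<integral>\<omega>. (2 * c * (real n + 1)) * (1 / h n \<omega>) \<partial>M)"
        unfolding WZ
      proof (rule integral_weight_mono[OF Wsh Wc])
        show "AE \<omega> in M. s n \<omega> * (1 / h n \<omega>) \<le> (2 * c * (real n + 1)) * (1 / h n \<omega>)"
          using AE_steps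
        proof eventually_elim
          case (elim \<omega>)
          show ?case using elim[rule_format, of n] h_ge_1[of n \<omega>] by (intro mult_right_mono) auto
        qed
      qed
    qed (use \<kappa>_pos in auto)
    also have "\<dots> = 2 * c * \<kappa> * (\<integral>\<omega>. 1 / h n \<omega> \<partial>M)"
      by (simp only: integral_mult_right_zero) (simp add: field_simps)
    finally show ?thesis .
  qed
  have "(\<lambda>n. 2 * c * \<kappa> * (\<integral>\<omega>. 1 / h n \<omega> \<partial>M)) \<longlonglongrightarrow> 0"
    by (intro tendsto_mult_right_zero integral_inverse_h_tendsto)
  then have "measure M {\<omega> \<in> space M. Z_lim \<omega> = 0} \<le> 0"
    by (rule LIMSEQ_le_const) (use bound in blast)
  then show ?thesis by (simp add: measure_le_0_iff)
qed

lemma swapped: "balanced_reinforcement M F k h \<nu> c"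
proof unfold_locales
  show "AE \<omega> in M. k n \<omega> + h n \<omega> + 1 \<le> k (Suc n) \<omega> + h (Suc n) \<omega>" for n
    using total_step[of n] by eventually_elim linarith
  show "k 0 \<omega> + h 0 \<omega> \<le> c" for \<omega>
    using start_le[of \<omega>] by linarith
  fix n and W :: "'w \<Rightarrow> real" and D :: real
  assume W: "W \<in> borel_measurable (F n)" "AE \<omega> in M. \<bar>W \<omega>\<bar> \<le> D"
  show "(\<integral>\<omega>. W \<omega> * (k (Suc n) \<omega> - k n \<omega>) \<partial>M) = (\<integral>\<omega>. W \<omega> * (\<nu> n \<omega> * (k n \<omega> / (k n \<omega> + h n \<omega>))) \<partial>M)"
    unfolding mean_k[OF W] by (simp only: add.commute)
  show "(\<integral>\<omega>. W \<omega> * (h (Suc n) \<omega> - h n \<omega>) \<partial>M) = (\<integral>\<omega>. W \<omega> * (\<nu> n \<omega> * (h n \<omega> / (k n \<omega> + h n \<omega>))) \<partial>M)"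
    unfolding mean_h[OF W] by (simp only: add.commute)
qed (fact subalg filtration adapted_h adapted_k h_ge_1 k_ge_1 h_step k_step measurable_\<nu> \<nu>_bounds)+

theorem Z_lim_no_atom_1: "measure M {\<omega> \<in> space M. Z_lim \<omega> = 1} = 0"
proof -
  interpret sw: balanced_reinforcement M F k h \<nu> c by (rule swapped)
  have Z: "sw.Z n \<omega> = 1 - Z n \<omega>" for n \<omega>
    unfolding one_minus_Z by (simp add: sw.Z_def sw.s_def s_def add.commute)
  \<comment> \<open>\<open>sw.Z_lim\<close> is defined as a limit of its own; it is identified with
    \<open>1 - Z_lim\<close> only where both sequences converge.\<close>
  have "AE \<omega> in M. Z_lim \<omega> = 1 \<longleftrightarrow> sw.Z_lim \<omega> = 0"
    using AE_tendsto_Z_lim sw.AE_tendsto_Z_lim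
  proof eventually_elim
    case (elim \<omega>)
    have "sw.Z_lim \<omega> = 1 - Z_lim \<omega>"
      using elim(2) unfolding Z by (rule LIMSEQ_unique) (intro tendsto_intros elim(1))
    then show ?case by auto
  qed
  then have "measure M {\<omega> \<in> space M. Z_lim \<omega> = 1} = measure M {\<omega> \<in> space M. sw.Z_lim \<omega> = 0}"
    by (intro finite_measure_eq_AE) (auto elim!: eventually_mono)
  then show ?thesis by (simp add: sw.Z_lim_no_atom_0)
qed

section \<open>Interior points\<close>

lemma weight_indicator: "S \<in> sets borel \<Longrightarrow> weight n (\<lambda>\<omega>. indicator S (Z n \<omega>))"
proof (intro weight_bounded[where D = 1])
  assume [measurable]: "S \<in> sets borel"
  show "(\<lambda>\<omega>. indicator S (Z n \<omega>) :: real) \<in> borel_measurable (F n)" by measurable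
qed (auto simp: indicator_def)

lemma integrable_weight_bounded:
  assumes W: "weight n W" and f: "f \<in> borel_measurable M" "AE \<omega> in M. \<bar>f \<omega>\<bar> \<le> 1"
  shows "integrable M (\<lambda>\<omega>. W \<omega> * f \<omega> :: real)"
proof -
  obtain D where D: "AE \<omega> in M. \<bar>W \<omega>\<bar> \<le> D" using W by (auto simp: weight_def)
  have "AE \<omega> in M. norm (W \<omega> * f \<omega>) \<le> D"
    using D f(2)
  proof eventually_elim
    case (elim \<omega>)
    then have "\<bar>W \<omega>\<bar> * \<bar>f \<omega>\<bar> \<le> D * 1" by (intro mult_mono) auto
    then show ?case by (simp add: abs_mult)
  qed
  then show ?thesis
    using weight_measurable[OF W] f(1) by (intro integrable_const_bound) auto
qed

lemma integral_nonneg_weight: "(\<And>\<omega>. W \<omega> \<ge> 0) \<Longrightarrow> (\<integral>\<omega>. W \<omega> \<partial>M) \<ge> (0::real)"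
  by (intro integral_nonneg_AE AE_I2)

text \<open>The weighted form of a nondegeneracy condition: from some time on, the conditional
  second moment of \<open>R n\<close> is at least \<open>g\<close> whenever \<open>Z n\<close> is
  within \<open>\<eta>\<close> of \<open>z\<close>. The mean conditions of the locale do not imply
  it.\<close>

definition spreads_at :: "real \<Rightarrow> bool" where
  "spreads_at z \<longleftrightarrow> (\<exists>\<eta>>0. \<exists>g>0. \<exists>n0. \<forall>n\<ge>n0. \<forall>W. weight n W \<longrightarrow> (\<forall>\<omega>. W \<omega> \<ge> 0) \<longrightarrow>
    g * (\<integral>\<omega>. W \<omega> * indicator (cball z \<eta>) (Z n \<omega>) \<partial>M) \<le> (\<integral>\<omega>. W \<omega> * (R n \<omega>)\<^sup>2 \<partial>M))"

section \<open>Second and fourth moments near an interior point\<close>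

lemma quadratic_variation_lower:
  assumes W: "weight n W" and nonneg: "\<And>\<omega>. W \<omega> \<ge> 0"
  shows "(\<integral>\<omega>. W \<omega> * (R n \<omega>)\<^sup>2 \<partial>M) / (16 * c\<^sup>2) / (real n + 1)\<^sup>2
    \<le> (\<integral>\<omega>. W \<omega> * (Z (Suc n) \<omega> - Z n \<omega>)\<^sup>2 \<partial>M)"
proof -
  let ?t = "1 / (16 * c\<^sup>2) / (real n + 1)\<^sup>2"
  have V: "weight (Suc n) (\<lambda>\<omega>. ?t * (W \<omega> * (R n \<omega>)\<^sup>2))"
    by (intro weight_intros weight_R weight_mono[OF W]) simp_all
  have V': "weight (Suc n) (\<lambda>\<omega>. W \<omega> * (Z (Suc n) \<omega> - Z n \<omega>)\<^sup>2)"
    by (intro weight_intros weight_mono[OF W]) simp_all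
  have "(\<integral>\<omega>. ?t * (W \<omega> * (R n \<omega>)\<^sup>2) \<partial>M) \<le> (\<integral>\<omega>. W \<omega> * (Z (Suc n) \<omega> - Z n \<omega>)\<^sup>2 \<partial>M)"
  proof (rule integral_weight_mono[OF V V'])
    show "AE \<omega> in M. ?t * (W \<omega> * (R n \<omega>)\<^sup>2) \<le> W \<omega> * (Z (Suc n) \<omega> - Z n \<omega>)\<^sup>2"
      using AE_steps
    proof eventually_elim
      case (elim \<omega>)
      have "s (Suc n) \<omega> \<le> 2 * c * (real (Suc n) + 1)" using elim by blast
      \<comment> \<open>Here \<open>n + 2\<close> is at most \<open>2 * (n + 1)\<close>; squaring
        \<open>4 * c\<close> gives the constant 16.\<close>
      also have "\<dots> \<le> 4 * c * (real n + 1)" using c_ge_2 by (simp add: algebra_simps)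
      finally have "(s (Suc n) \<omega>)\<^sup>2 \<le> (4 * c * (real n + 1))\<^sup>2"
        using s_ge_2[of "Suc n" \<omega>] by (intro power_mono) auto
      then have "(s (Suc n) \<omega>)\<^sup>2 \<le> 16 * c\<^sup>2 * (real n + 1)\<^sup>2"
        by (simp add: power_mult_distrib)
      then have "(R n \<omega>)\<^sup>2 / (16 * c\<^sup>2 * (real n + 1)\<^sup>2) \<le> (R n \<omega>)\<^sup>2 / (s (Suc n) \<omega>)\<^sup>2"
        using s_ge_2[of "Suc n" \<omega>] c_ge_2 by (intro divide_left_mono) (auto intro!: mult_pos_pos)
      from mult_left_mono[OF this nonneg[of \<omega>]] show ?case
        by (simp add: Z_step' power_divide mult_ac)
    qed
  qed
  then show ?thesis by (simp only: integral_mult_right_zero) simp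
qed

lemma integral_weight_Z_le:
  assumes W: "weight n W" and nonneg: "\<And>\<omega>. W \<omega> \<ge> 0"
  shows "(\<integral>\<omega>. W \<omega> * Z n \<omega> \<partial>M) \<le> (\<integral>\<omega>. W \<omega> \<partial>M)"
proof -
  have V: "weight n (\<lambda>\<omega>. W \<omega> * Z n \<omega>)" by (intro weight_intros W) simp
  show ?thesis
  proof (rule integral_weight_mono[OF V W AE_I2])
    show "W \<omega> * Z n \<omega> \<le> W \<omega>" for \<omega>
      using nonneg[of \<omega>] Z_bounds[of n \<omega>] by (intro mult_left_le) auto
  qed
qed

text \<open>The hypothesis \<open>near\<close> confines \<open>W\<close> to a window of width
  \<open>1 / sqrt n\<close> around \<open>z\<close>, the scale of the fluctuation still to come.
  Multiplying it by \<open>W\<close> avoids a case split on where \<open>W\<close> vanishes.\<close>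

lemma second_moment_near:
  assumes W: "weight n W" and nonneg: "\<And>\<omega>. W \<omega> \<ge> 0" and z: "0 \<le> z" "z \<le> 1"
    and near: "\<And>\<omega>. W \<omega> * (Z n \<omega> - z)\<^sup>2 \<le> W \<omega> * (l / (real n + 1))" and "n \<le> i"
  shows "(\<integral>\<omega>. W \<omega> * (Z i \<omega> - z)\<^sup>2 \<partial>M) \<le> (l + \<kappa>) / (real n + 1) * (\<integral>\<omega>. W \<omega> \<partial>M)"
proof -
  let ?w = "\<integral>\<omega>. W \<omega> \<partial>M"
  have V: "weight n (\<lambda>\<omega>. W \<omega> * (Z n \<omega> - z)\<^sup>2)" by (intro weight_intros W) simp
  have V': "weight n (\<lambda>\<omega>. W \<omega> * (l / (real n + 1)))" by (intro weight_intros W)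
  have w: "?w \<ge> 0" by (rule integral_nonneg_weight[OF nonneg])
  have "(\<integral>\<omega>. W \<omega> * (Z i \<omega> - z)\<^sup>2 \<partial>M) \<le> (\<integral>\<omega>. W \<omega> * (Z n \<omega> - z)\<^sup>2 \<partial>M)
      + \<kappa> * (\<integral>\<omega>. W \<omega> * Z n \<omega> \<partial>M) * (1 / (real n + 1) - 1 / (real i + 1))"
    using z by (intro second_moment[OF W nonneg \<open>n \<le> i\<close> weight_const])
  also have "\<dots> \<le> ?w * (l / (real n + 1)) + \<kappa> * ?w * (1 / (real n + 1))"
  proof (intro add_mono mult_mono mult_left_mono integral_weight_Z_le[OF W nonneg])
    show "(\<integral>\<omega>. W \<omega> * (Z n \<omega> - z)\<^sup>2 \<partial>M) \<le> ?w * (l / (real n + 1))"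
      using integral_weight_mono[OF V V' AE_I2[OF near]] by (simp only: integral_mult_left_zero)
    show "0 \<le> 1 / (real n + 1) - 1 / (real i + 1)"
      using \<open>n \<le> i\<close> by (simp add: frac_le)
    show "0 \<le> (\<integral>\<omega>. W \<omega> * Z n \<omega> \<partial>M)"
      using nonneg Z_bounds(1)[THEN less_imp_le] by (intro mult_nonneg_nonneg integral_nonneg_weight) auto
  qed (use \<kappa>_pos w in auto)
  also have "\<dots> = (l + \<kappa>) / (real n + 1) * ?w"
    by (simp add: add_divide_distrib algebra_simps)
  finally show ?thesis .
qed

text \<open>Each step \<open>i\<close> adds at least order \<open>1 / i^2\<close> to the second
  moment around \<open>z\<close>, and these gains sum to order \<open>1 / n\<close>. Two things
  could spoil a gain, and smallness of the second moment for large \<open>n\<close> excludes both: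
  \<open>Z i\<close> may leave the region where \<open>spreads_at\<close> applies, and the drift may
  pull towards \<open>z\<close>.\<close>

lemma second_moment_lower:
  assumes "spreads_at z" and z: "0 \<le> z" "z \<le> 1" and l: "l \<ge> 0"
  shows "\<exists>\<gamma>>0. \<exists>n0. \<forall>n\<ge>n0. \<forall>W. weight n W \<longrightarrow> (\<forall>\<omega>. W \<omega> \<ge> 0) \<longrightarrow>
    (\<forall>\<omega>. W \<omega> * (Z n \<omega> - z)\<^sup>2 \<le> W \<omega> * (l / (real n + 1))) \<longrightarrow>
    \<gamma> / (real n + 1) * (\<integral>\<omega>. W \<omega> \<partial>M) \<le> (\<integral>\<omega>. W \<omega> * (Z_lim \<omega> - z)\<^sup>2 \<partial>M)"
proof -
  obtain \<eta> g n0 where \<eta>: "\<eta> > 0" and g: "g > 0" and spread: "\<And>n W. n \<ge> n0 \<Longrightarrow> weight n W \<Longrightarrow> (\<And>\<omega>. W \<omega> \<ge> 0) \<Longrightarrow>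
    g * (\<integral>\<omega>. W \<omega> * indicator (cball z \<eta>) (Z n \<omega>) \<partial>M) \<le> (\<integral>\<omega>. W \<omega> * (R n \<omega>)\<^sup>2 \<partial>M)"
    using \<open>spreads_at z\<close> unfolding spreads_at_def by blast
  \<comment> \<open>Half of the weight stays near \<open>z\<close>, so the quadratic variation gains
    \<open>g / (32 * c^2)\<close> times \<open>1 / (i + 1)^2\<close>. The choice of
    \<open>\<delta>\<close> makes the drift loss \<open>8 * c^2 * \<delta>\<close> half of this,
    leaving \<open>\<gamma>\<close>.\<close>
  define \<gamma> where "\<gamma> = g / (64 * c\<^sup>2)"
  define \<delta> where "\<delta> = g / (512 * c ^ 4)"
  define V where "V = l + \<kappa>"
  have \<gamma>: "\<gamma> > 0" and \<delta>: "\<delta> > 0" and V: "V > 0"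
    using g c_ge_2 l \<kappa>_pos by (auto simp: \<gamma>_def \<delta>_def V_def)
  \<comment> \<open>From \<open>n1\<close> on, the second moment per unit weight, at most
    \<open>V / (n + 1)\<close>, is below \<open>\<eta>^2 / 2\<close>, as the Chebyshev step needs,
    and below \<open>\<delta>^2\<close>, as the drift estimate needs.\<close>
  obtain n1 :: nat where n1: "real n1 \<ge> max (2 * V / \<eta>\<^sup>2) (V / \<delta>\<^sup>2)"
    using real_arch_simple by blast
  show ?thesis
  proof (rule exI[of _ \<gamma>], intro conjI \<gamma> exI[of _ "max n0 n1"] allI impI)
    fix n W
    assume n: "n \<ge> max n0 n1" and W: "weight n W" and nonneg: "\<forall>\<omega>. 0 \<le> W \<omega>"
      and near: "\<forall>\<omega>. W \<omega> * (Z n \<omega> - z)\<^sup>2 \<le> W \<omega> * (l / (real n + 1))"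
    let ?w = "\<integral>\<omega>. W \<omega> \<partial>M"
    have w: "?w \<ge> 0" using nonneg by (intro integral_nonneg_weight) auto
    have "real n + 1 \<ge> max (2 * V / \<eta>\<^sup>2) (V / \<delta>\<^sup>2)" using n1 n by linarith
    then have nl: "V / (real n + 1) \<le> \<eta>\<^sup>2 / 2" "V / (real n + 1) \<le> \<delta>\<^sup>2"
      using \<eta> \<delta> V by (auto simp: field_simps)
    define u where "u i = (\<integral>\<omega>. W \<omega> * (Z i \<omega> - z)\<^sup>2 \<partial>M)" for i
    have step: "u (Suc i) \<ge> u i + \<gamma> * ?w / (real i + 1)\<^sup>2" if i: "i \<ge> n" for i
    proof -
      let ?D = "\<lambda>\<omega>. Z (Suc i) \<omega> - Z i \<omega>" and ?Y = "\<lambda>\<omega>. Z i \<omega> - z"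
      note Wi = weight_mono[OF W i]
      have V0: "weight i (\<lambda>\<omega>. W \<omega> * ?Y \<omega>)" by (intro weight_intros Wi) simp
      have V1: "weight (Suc i) (\<lambda>\<omega>. W \<omega> * (?Y \<omega>)\<^sup>2)"
        by (intro weight_intros weight_mono[OF Wi]) simp_all
      have V2': "weight (Suc i) (\<lambda>\<omega>. 2 * ((W \<omega> * ?Y \<omega>) * ?D \<omega>))"
        by (intro weight_intros weight_mono[OF Wi]) simp_all
      have V3: "weight (Suc i) (\<lambda>\<omega>. W \<omega> * (?D \<omega>)\<^sup>2)"
        by (intro weight_intros weight_mono[OF Wi]) simp_all
      have V4: "weight i (\<lambda>\<omega>. \<bar>W \<omega> * ?Y \<omega>\<bar> * Z i \<omega>)" by (intro weight_intros Wi) simp_all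
      have V6: "weight i (\<lambda>\<omega>. (1 / (2 * \<delta>)) * (W \<omega> * (?Y \<omega>)\<^sup>2))" by (intro weight_intros Wi) simp_all
      have V7: "weight i (\<lambda>\<omega>. (\<delta> / 2) * W \<omega>)" by (intro weight_intros Wi)
      have V8: "weight i (\<lambda>\<omega>. W \<omega> - (1 / \<eta>\<^sup>2) * (W \<omega> * (?Y \<omega>)\<^sup>2))" by (intro weight_intros Wi) simp_all
      have V9: "weight i (\<lambda>\<omega>. W \<omega> * indicator (cball z \<eta>) (Z i \<omega>))"
        by (intro weight_intros Wi weight_indicator) simp
      have ui: "u i \<le> V / (real n + 1) * ?w"
        unfolding u_def V_def using nonneg near z i by (intro second_moment_near[OF W]) auto
      have "u (Suc i) = (\<integral>\<omega>. (W \<omega> * (?Y \<omega>)\<^sup>2 + 2 * ((W \<omega> * ?Y \<omega>) * ?D \<omega>)) + W \<omega> * (?D \<omega>)\<^sup>2 \<partial>M)"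
        unfolding u_def by (intro Bochner_Integration.integral_cong) (auto simp: algebra_simps power2_eq_square)
      also have "\<dots> = u i + 2 * (\<integral>\<omega>. (W \<omega> * ?Y \<omega>) * ?D \<omega> \<partial>M) + (\<integral>\<omega>. W \<omega> * (?D \<omega>)\<^sup>2 \<partial>M)"
        unfolding u_def using integral_weight_add[OF weight_add[OF V1 V2'] V3] integral_weight_add[OF V1 V2']
        by simp
      finally have expand: "u (Suc i) = u i + 2 * (\<integral>\<omega>. (W \<omega> * ?Y \<omega>) * ?D \<omega> \<partial>M) + (\<integral>\<omega>. W \<omega> * (?D \<omega>)\<^sup>2 \<partial>M)" .
      have "(\<integral>\<omega>. \<bar>W \<omega> * ?Y \<omega>\<bar> * Z i \<omega> \<partial>M) \<le> (\<integral>\<omega>. (1 / (2 * \<delta>)) * (W \<omega> * (?Y \<omega>)\<^sup>2) + (\<delta> / 2) * W \<omega> \<partial>M)"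
      proof (rule integral_weight_mono[OF V4 weight_add[OF V6 V7] AE_I2])
        fix \<omega>
        have "\<bar>W \<omega> * ?Y \<omega>\<bar> * Z i \<omega> \<le> W \<omega> * \<bar>?Y \<omega>\<bar>"
          using nonneg Z_bounds[of i \<omega>] by (simp add: abs_mult mult_left_le)
        \<comment> \<open>Young's inequality with parameter \<open>\<delta>\<close>: a mean square
          of at most \<open>\<delta>^2\<close> then bounds the mean distance by
          \<open>\<delta>\<close>.\<close>
        also have "\<dots> \<le> W \<omega> * ((?Y \<omega>)\<^sup>2 / (2 * \<delta>) + \<delta> / 2)"
        proof (intro mult_left_mono)
          have "0 \<le> (\<bar>?Y \<omega>\<bar> - \<delta>)\<^sup>2 / (2 * \<delta>)" using \<delta> by simp
          also have "\<dots> = (?Y \<omega>)\<^sup>2 / (2 * \<delta>) + \<delta> / 2 - \<bar>?Y \<omega>\<bar>"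
            using \<delta> by (simp add: power2_diff field_simps) (simp add: power2_eq_square algebra_simps)
          finally show "\<bar>?Y \<omega>\<bar> \<le> (?Y \<omega>)\<^sup>2 / (2 * \<delta>) + \<delta> / 2" by simp
        qed (use nonneg in auto)
        finally show "\<bar>W \<omega> * ?Y \<omega>\<bar> * Z i \<omega> \<le> (1 / (2 * \<delta>)) * (W \<omega> * (?Y \<omega>)\<^sup>2) + (\<delta> / 2) * W \<omega>"
          by (simp add: algebra_simps)
      qed
      also have "\<dots> = (1 / (2 * \<delta>)) * u i + (\<delta> / 2) * ?w"
        using integral_weight_add[OF V6 V7] by (simp only: integral_mult_right_zero u_def)
      also have "\<dots> \<le> (1 / (2 * \<delta>)) * (\<delta>\<^sup>2 * ?w) + (\<delta> / 2) * ?w"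
      proof (intro add_right_mono mult_left_mono)
        show "u i \<le> \<delta>\<^sup>2 * ?w" using ui mult_right_mono[OF nl(2) w] by linarith
      qed (use \<delta> in auto)
      also have "\<dots> = \<delta> * ?w" using \<delta> by (simp add: power2_eq_square)
      finally have "4 * c\<^sup>2 / (real i + 1)\<^sup>2 * (\<integral>\<omega>. \<bar>W \<omega> * ?Y \<omega>\<bar> * Z i \<omega> \<partial>M) \<le> 4 * c\<^sup>2 / (real i + 1)\<^sup>2 * (\<delta> * ?w)"
        by (intro mult_left_mono) auto
      with drift[OF V0] have dr: "- (4 * c\<^sup>2 / (real i + 1)\<^sup>2 * (\<delta> * ?w)) \<le> (\<integral>\<omega>. (W \<omega> * ?Y \<omega>) * ?D \<omega> \<partial>M)"
        by linarith
      \<comment> \<open>Chebyshev: since the second moment is at most \<open>\<eta>^2 / 2\<close>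
        per unit weight, at least half of the weight has \<open>Z i\<close> within
        \<open>\<eta>\<close> of \<open>z\<close>.\<close>
      have "?w / 2 \<le> ?w - (1 / \<eta>\<^sup>2) * u i"
      proof -
        have "u i \<le> \<eta>\<^sup>2 / 2 * ?w" using ui mult_right_mono[OF nl(1) w] by linarith
        then have "(1 / \<eta>\<^sup>2) * u i \<le> (1 / \<eta>\<^sup>2) * (\<eta>\<^sup>2 / 2 * ?w)" by (intro mult_left_mono) auto
        then show ?thesis using \<eta> by simp
      qed
      also have "\<dots> = (\<integral>\<omega>. W \<omega> - (1 / \<eta>\<^sup>2) * (W \<omega> * (?Y \<omega>)\<^sup>2) \<partial>M)"
      proof -
        have "integrable M (\<lambda>\<omega>. (1 / \<eta>\<^sup>2) * (W \<omega> * (?Y \<omega>)\<^sup>2))"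
          by (rule integrable_mult_right[OF weight_integrable[OF V1]])
        from Bochner_Integration.integral_diff[OF weight_integrable[OF W] this] show ?thesis
          by (simp only: integral_mult_right_zero u_def)
      qed
      also have "\<dots> \<le> (\<integral>\<omega>. W \<omega> * indicator (cball z \<eta>) (Z i \<omega>) \<partial>M)"
      proof (rule integral_weight_mono[OF V8 V9 AE_I2])
        fix \<omega>
        show "W \<omega> - (1 / \<eta>\<^sup>2) * (W \<omega> * (?Y \<omega>)\<^sup>2) \<le> W \<omega> * indicator (cball z \<eta>) (Z i \<omega>)"
        proof (cases "\<bar>?Y \<omega>\<bar> \<le> \<eta>")
          case True
          then show ?thesis using nonneg by (simp add: indicator_def dist_real_def abs_minus_commute)
        next
          case False
          then have "\<eta>\<^sup>2 \<le> (?Y \<omega>)\<^sup>2" using \<eta> by (simp add: abs_le_square_iff[symmetric])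
          then have "1 \<le> (1 / \<eta>\<^sup>2) * (?Y \<omega>)\<^sup>2" using \<eta> by simp
          from mult_left_mono[OF this, of "W \<omega>"] nonneg False show ?thesis
            by (simp add: indicator_def dist_real_def abs_minus_commute mult_ac)
        qed
      qed
      finally have "g * (?w / 2) \<le> g * (\<integral>\<omega>. W \<omega> * indicator (cball z \<eta>) (Z i \<omega>) \<partial>M)"
        using g by (intro mult_left_mono) auto
      also have "\<dots> \<le> (\<integral>\<omega>. W \<omega> * (R i \<omega>)\<^sup>2 \<partial>M)"
        using n i nonneg by (intro spread Wi) auto
      finally have "g * (?w / 2) / (16 * c\<^sup>2) / (real i + 1)\<^sup>2 \<le>
          (\<integral>\<omega>. W \<omega> * (R i \<omega>)\<^sup>2 \<partial>M) / (16 * c\<^sup>2) / (real i + 1)\<^sup>2"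
        by (intro divide_right_mono) auto
      with quadratic_variation_lower[OF Wi] nonneg
      have qv: "g * (?w / 2) / (16 * c\<^sup>2) / (real i + 1)\<^sup>2 \<le> (\<integral>\<omega>. W \<omega> * (?D \<omega>)\<^sup>2 \<partial>M)" by force
      have "g * (?w / 2) / (16 * c\<^sup>2) / (real i + 1)\<^sup>2 - 2 * (4 * c\<^sup>2 / (real i + 1)\<^sup>2 * (\<delta> * ?w)) = \<gamma> * ?w / (real i + 1)\<^sup>2"
      proof -
        have "g / (32 * c\<^sup>2) - 8 * c\<^sup>2 * \<delta> = \<gamma>"
          using c_ge_2 by (simp add: \<gamma>_def \<delta>_def power2_eq_square power4_eq_xxxx)
        from arg_cong[OF this, of "\<lambda>x. x * ?w / (real i + 1)\<^sup>2"] show ?thesis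
          by (simp add: diff_divide_distrib left_diff_distrib)
      qed
      then show ?thesis unfolding expand using dr qv by linarith
    qed
    have "(\<lambda>j. \<gamma> * ?w * (1 / (real n + 1) - 1 / (real j + 1))) \<longlonglongrightarrow> \<gamma> * ?w * (1 / (real n + 1) - 0)"
      using LIMSEQ_inverse_real_of_nat by (intro tendsto_intros) (simp add: inverse_eq_divide add.commute)
    moreover have "u \<longlonglongrightarrow> (\<integral>\<omega>. W \<omega> * (Z_lim \<omega> - z)\<^sup>2 \<partial>M)"
      unfolding u_def[abs_def] by (rule moment_tendsto[OF W weight_const z])
    moreover have "\<gamma> * ?w * (1 / (real n + 1) - 1 / (real j + 1)) \<le> u j" if "j \<ge> n" for j
    proof -
      have "u n + \<gamma> * ?w * (1 / (real n + 1) - 1 / (real j + 1)) \<le> u j"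
        by (rule telescoping_lower[of n u, OF step _ that]) (use w \<gamma> in auto)
      moreover have "u n \<ge> 0" unfolding u_def using nonneg by (intro integral_nonneg_weight) auto
      ultimately show ?thesis by linarith
    qed
    ultimately have "\<gamma> * ?w * (1 / (real n + 1) - 0) \<le> (\<integral>\<omega>. W \<omega> * (Z_lim \<omega> - z)\<^sup>2 \<partial>M)"
      by (intro LIMSEQ_le) auto
    then show "\<gamma> / (real n + 1) * ?w \<le> (\<integral>\<omega>. W \<omega> * (Z_lim \<omega> - z)\<^sup>2 \<partial>M)" by simp
  qed
qed

text \<open>The terms of first and second order in a step are controlled by the second moment,
  already of order \<open>1 / n\<close>, times \<open>1 / i^2\<close>; so the steps from
  \<open>n\<close> on add only order \<open>1 / n^2\<close>. In the constant, \<open>l^2\<close> is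
  the initial term, 24 is \<open>4 * 4\<close> from the drift plus 8 from the quadratic term, and
  the factor 2 is that of telescoping.\<close>

lemma fourth_moment_upper:
  assumes W: "weight n W" and nonneg: "\<And>\<omega>. W \<omega> \<ge> 0" and z: "0 \<le> z" "z \<le> 1" and l: "l \<ge> 0"
    and near: "\<And>\<omega>. W \<omega> * (Z n \<omega> - z)\<^sup>2 \<le> W \<omega> * (l / (real n + 1))"
  shows "(\<integral>\<omega>. W \<omega> * (Z_lim \<omega> - z) ^ 4 \<partial>M)
    \<le> (l\<^sup>2 + 2 * (24 * c\<^sup>2 * (l + \<kappa>) + 3 * c ^ 4)) / (real n + 1)\<^sup>2 * (\<integral>\<omega>. W \<omega> \<partial>M)"
proof -
  define V where "V = l + \<kappa>"
  let ?w = "\<integral>\<omega>. W \<omega> \<partial>M"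
  have w: "?w \<ge> 0" by (rule integral_nonneg_weight[OF nonneg])
  have V: "V > 0" using l \<kappa>_pos by (simp add: V_def)
  define u where "u i = (\<integral>\<omega>. W \<omega> * (Z i \<omega> - z) ^ 4 \<partial>M)" for i
  define q where "q = (24 * c\<^sup>2 * V + 3 * c ^ 4) * ?w / (real n + 1)"
  have step: "u (Suc i) \<le> u i + q / (real i + 1)\<^sup>2" if i: "i \<ge> n" for i
  proof -
    let ?D = "\<lambda>\<omega>. Z (Suc i) \<omega> - Z i \<omega>" and ?Y = "\<lambda>\<omega>. Z i \<omega> - z"
    let ?t = "1 / (real i + 1)\<^sup>2"
    note Wi = weight_mono[OF W i]
    have U: "weight (Suc i) (\<lambda>\<omega>. W \<omega> * (Z (Suc i) \<omega> - z) ^ 4)"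
      by (intro weight_intros weight_mono[OF Wi]) simp_all
    have V0: "weight i (\<lambda>\<omega>. W \<omega> * (?Y \<omega>) ^ 3)" by (intro weight_intros Wi) simp
    have V1: "weight (Suc i) (\<lambda>\<omega>. W \<omega> * (?Y \<omega>) ^ 4)"
      by (intro weight_intros weight_mono[OF Wi]) simp_all
    have V2: "weight (Suc i) (\<lambda>\<omega>. 4 * ((W \<omega> * (?Y \<omega>) ^ 3) * ?D \<omega>))"
      by (intro weight_intros weight_mono[OF Wi]) simp_all
    have V3: "weight (Suc i) (\<lambda>\<omega>. (8 * c\<^sup>2 * ?t) * (W \<omega> * (?Y \<omega>)\<^sup>2))"
      by (intro weight_intros weight_mono[OF Wi]) simp_all
    have V4: "weight (Suc i) (\<lambda>\<omega>. (3 * c ^ 4 * ?t / (real n + 1)) * W \<omega>)"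
      by (intro weight_intros weight_mono[OF Wi]) simp_all
    have V5: "weight i (\<lambda>\<omega>. W \<omega> * (?Y \<omega>)\<^sup>2)" by (intro weight_intros Wi) simp
    have V6: "weight i (\<lambda>\<omega>. \<bar>W \<omega> * (?Y \<omega>) ^ 3\<bar> * Z i \<omega>)" by (intro weight_intros Wi) simp_all
    have second: "(\<integral>\<omega>. W \<omega> * (?Y \<omega>)\<^sup>2 \<partial>M) \<le> V / (real n + 1) * ?w"
      unfolding V_def using nonneg near z i by (intro second_moment_near[OF W]) auto
    have "u (Suc i) \<le> (\<integral>\<omega>. ((W \<omega> * (?Y \<omega>) ^ 4 + 4 * ((W \<omega> * (?Y \<omega>) ^ 3) * ?D \<omega>)) +
        (8 * c\<^sup>2 * ?t) * (W \<omega> * (?Y \<omega>)\<^sup>2)) + (3 * c ^ 4 * ?t / (real n + 1)) * W \<omega> \<partial>M)"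
      unfolding u_def
    proof (rule integral_weight_mono[OF U weight_add[OF weight_add[OF weight_add[OF V1 V2] V3] V4]])
      show "AE \<omega> in M. W \<omega> * (Z (Suc i) \<omega> - z) ^ 4 \<le> ((W \<omega> * (?Y \<omega>) ^ 4 + 4 * ((W \<omega> * (?Y \<omega>) ^ 3) * ?D \<omega>)) +
        (8 * c\<^sup>2 * ?t) * (W \<omega> * (?Y \<omega>)\<^sup>2)) + (3 * c ^ 4 * ?t / (real n + 1)) * W \<omega>"
        using AE_R_bounds
      proof eventually_elim
        case (elim \<omega>)
        define y d where "y = ?Y \<omega>" and "d = ?D \<omega>"
        have "\<bar>d\<bar> \<le> c / (real i + 1)" using elim by (simp add: d_def)
        then have "\<bar>d\<bar>\<^sup>2 \<le> (c / (real i + 1))\<^sup>2" by (rule power_mono) simp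
        then have d2: "d\<^sup>2 \<le> c\<^sup>2 * ?t" by (simp add: power_divide)
        have "d\<^sup>2 * d\<^sup>2 \<le> (c\<^sup>2 * ?t) * (c\<^sup>2 * ?t)" using d2 by (intro mult_mono) auto
        also have "\<dots> = c ^ 4 * ?t * ?t" by (simp add: power2_eq_square power4_eq_xxxx)
        \<comment> \<open>Of the two factors \<open>1 / (i + 1)^2\<close> one is kept for summation
          and the other relaxed to \<open>1 / (n + 1)\<close>, to match the remaining terms.\<close>
        also have "\<dots> \<le> c ^ 4 * ?t * (1 / (real n + 1))"
        proof (intro mult_left_mono)
          have "real n + 1 \<le> real i + 1" using i by simp
          also have "\<dots> \<le> (real i + 1)\<^sup>2" by (simp add: power2_eq_square)
          finally show "?t \<le> 1 / (real n + 1)" by (simp add: frac_le)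
        qed auto
        finally have d4: "d\<^sup>2 * d\<^sup>2 \<le> c ^ 4 * ?t / (real n + 1)" by simp
        \<comment> \<open>Completing the square absorbs the odd term \<open>4 * y * d ^ 3\<close> of
          the binomial expansion, at the price of raising the coefficients 6 and 1 to 8 and
          3.\<close>
        have "(y + d) ^ 4 = y ^ 4 + 4 * y ^ 3 * d + 8 * (y\<^sup>2 * d\<^sup>2) + 3 * (d\<^sup>2 * d\<^sup>2) - 2 * (d * (y - d))\<^sup>2"
          by (simp add: power2_eq_square power3_eq_cube power4_eq_xxxx algebra_simps)
        also have "\<dots> \<le> y ^ 4 + 4 * y ^ 3 * d + 8 * (y\<^sup>2 * (c\<^sup>2 * ?t)) + 3 * (c ^ 4 * ?t / (real n + 1)) - 2 * 0"
          using d2 d4 by (intro add_mono diff_mono mult_left_mono order_refl) auto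
        finally have "W \<omega> * (y + d) ^ 4 \<le> W \<omega> * (y ^ 4 + 4 * y ^ 3 * d + 8 * (y\<^sup>2 * (c\<^sup>2 * ?t)) + 3 * (c ^ 4 * ?t / (real n + 1)) - 2 * 0)"
          by (rule mult_left_mono[OF _ nonneg])
        also have "\<dots> = ((W \<omega> * y ^ 4 + 4 * ((W \<omega> * y ^ 3) * d)) +
            (8 * c\<^sup>2 * ?t) * (W \<omega> * y\<^sup>2)) + (3 * c ^ 4 * ?t / (real n + 1)) * W \<omega>"
          by (simp add: distrib_left mult_ac)
        also have "y + d = Z (Suc i) \<omega> - z" by (simp add: y_def d_def)
        finally show ?case by (simp only: y_def d_def)
      qed
    qed
    also have "\<dots> = u i + 4 * (\<integral>\<omega>. (W \<omega> * (?Y \<omega>) ^ 3) * ?D \<omega> \<partial>M) +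
        (8 * c\<^sup>2 * ?t) * (\<integral>\<omega>. W \<omega> * (?Y \<omega>)\<^sup>2 \<partial>M) + (3 * c ^ 4 * ?t / (real n + 1)) * ?w"
      unfolding integral_weight_add[OF weight_add[OF weight_add[OF V1 V2] V3] V4]
        integral_weight_add[OF weight_add[OF V1 V2] V3] integral_weight_add[OF V1 V2]
      by (simp only: integral_mult_right_zero u_def)
    also have "\<dots> \<le> u i + 4 * (4 * c\<^sup>2 / (real i + 1)\<^sup>2 * (V / (real n + 1) * ?w)) +
        (8 * c\<^sup>2 * ?t) * (V / (real n + 1) * ?w) + (3 * c ^ 4 * ?t / (real n + 1)) * ?w"
    proof (intro add_mono order_refl mult_left_mono second)
      have "(\<integral>\<omega>. \<bar>W \<omega> * (?Y \<omega>) ^ 3\<bar> * Z i \<omega> \<partial>M) \<le> (\<integral>\<omega>. W \<omega> * (?Y \<omega>)\<^sup>2 \<partial>M)"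
      proof (rule integral_weight_mono[OF V6 V5 AE_I2])
        fix \<omega>
        have "\<bar>?Y \<omega>\<bar> * Z i \<omega> \<le> 1"
          using Z_bounds[of i \<omega>] z by (intro mult_le_one) (auto simp: abs_le_iff)
        then have "W \<omega> * (?Y \<omega>)\<^sup>2 * (\<bar>?Y \<omega>\<bar> * Z i \<omega>) \<le> W \<omega> * (?Y \<omega>)\<^sup>2"
          using nonneg by (intro mult_left_le) auto
        moreover have "\<bar>W \<omega> * (?Y \<omega>) ^ 3\<bar> = W \<omega> * (?Y \<omega>)\<^sup>2 * \<bar>?Y \<omega>\<bar>"
          using nonneg[of \<omega>] by (simp add: abs_mult power3_eq_cube power2_eq_square)
        ultimately show "\<bar>W \<omega> * (?Y \<omega>) ^ 3\<bar> * Z i \<omega> \<le> W \<omega> * (?Y \<omega>)\<^sup>2" by (simp add: mult.assoc)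
      qed
      then have "4 * c\<^sup>2 / (real i + 1)\<^sup>2 * (\<integral>\<omega>. \<bar>W \<omega> * (?Y \<omega>) ^ 3\<bar> * Z i \<omega> \<partial>M)
          \<le> 4 * c\<^sup>2 / (real i + 1)\<^sup>2 * (V / (real n + 1) * ?w)"
        using second by (intro mult_left_mono) auto
      then show "(\<integral>\<omega>. (W \<omega> * (?Y \<omega>) ^ 3) * ?D \<omega> \<partial>M) \<le> 4 * c\<^sup>2 / (real i + 1)\<^sup>2 * (V / (real n + 1) * ?w)"
        using drift[OF V0] by linarith
    qed auto
    also have "\<dots> = u i + q / (real i + 1)\<^sup>2"
    proof -
      have "4 * (4 * c\<^sup>2 / x * (V / y * ?w)) + (8 * c\<^sup>2 * (1 / x)) * (V / y * ?w) + (3 * c ^ 4 * (1 / x) / y) * ?w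
          = (24 * c\<^sup>2 * V + 3 * c ^ 4) * ?w / y / x" if "x \<noteq> 0" "y \<noteq> 0" for x y :: real
        using that by (simp add: field_simps)
      from this[of "(real i + 1)\<^sup>2" "real n + 1"] show ?thesis by (simp add: q_def)
    qed
    finally show ?thesis .
  qed
  have q0: "q \<ge> 0" unfolding q_def using V w c_ge_2 by auto
  have un: "u n \<le> l\<^sup>2 / (real n + 1)\<^sup>2 * ?w"
  proof -
    have A: "weight n (\<lambda>\<omega>. W \<omega> * (Z n \<omega> - z) ^ 4)" "weight n (\<lambda>\<omega>. (l\<^sup>2 / (real n + 1)\<^sup>2) * W \<omega>)"
      by (intro weight_intros W; simp)+
    have "u n \<le> (\<integral>\<omega>. (l\<^sup>2 / (real n + 1)\<^sup>2) * W \<omega> \<partial>M)"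
      unfolding u_def
    proof (rule integral_weight_mono[OF A AE_I2])
      fix \<omega>
      show "W \<omega> * (Z n \<omega> - z) ^ 4 \<le> (l\<^sup>2 / (real n + 1)\<^sup>2) * W \<omega>"
      proof (cases "W \<omega> = 0")
        case False
        then have "W \<omega> > 0" using nonneg[of \<omega>] by simp
        with near[of \<omega>] have "(Z n \<omega> - z)\<^sup>2 \<le> l / (real n + 1)" by (simp only: mult_le_cancel_left_pos)
        then have "((Z n \<omega> - z)\<^sup>2)\<^sup>2 \<le> (l / (real n + 1))\<^sup>2" by (rule power_mono) simp
        then have "(Z n \<omega> - z) ^ 4 \<le> l\<^sup>2 / (real n + 1)\<^sup>2" by (simp add: power_divide flip: power_mult)
        from mult_left_mono[OF this nonneg[of \<omega>]] show ?thesis by (simp add: mult.commute)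
      qed simp
    qed
    then show ?thesis by (simp only: integral_mult_right_zero)
  qed
  have bound: "u j \<le> (l\<^sup>2 + 2 * (24 * c\<^sup>2 * V + 3 * c ^ 4)) / (real n + 1)\<^sup>2 * ?w" if "j \<ge> n" for j
  proof -
    have "u j \<le> u n + 2 * q * (1 / (real n + 1) - 1 / (real j + 1))"
      by (rule telescoping_upper[of n u, OF step q0 that])
    also have "\<dots> \<le> l\<^sup>2 / (real n + 1)\<^sup>2 * ?w + 2 * q * (1 / (real n + 1))"
      using un q0 by (intro add_mono mult_left_mono) auto
    also have "\<dots> = (l\<^sup>2 + 2 * (24 * c\<^sup>2 * V + 3 * c ^ 4)) / (real n + 1)\<^sup>2 * ?w"
      by (simp add: q_def power2_eq_square add_divide_distrib distrib_right)
    finally show ?thesis .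
  qed
  show ?thesis
    using moment_tendsto[OF W weight_const z, of 4] bound
    unfolding V_def u_def by (intro LIMSEQ_le_const2) auto
qed

text \<open>By the Paley--Zygmund argument, from any past at time \<open>n\<close> the limit misses \<open>z\<close> with a probability
  bounded below uniformly in \<open>n\<close>.\<close>

lemma uniform_escape:
  assumes spread: "spreads_at z" and z: "0 \<le> z" "z \<le> 1"
  shows "\<exists>\<delta>>0. \<exists>n0. \<forall>n\<ge>n0. \<forall>W. weight n W \<longrightarrow> (\<forall>\<omega>. W \<omega> \<ge> 0) \<longrightarrow>
    \<delta> * (\<integral>\<omega>. W \<omega> \<partial>M) \<le> (\<integral>\<omega>. W \<omega> * indicator (- {z}) (Z_lim \<omega>) \<partial>M)"
proof -
  \<comment> \<open>Outside the window of squared radius \<open>l / (n + 1)\<close>, Chebyshev with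
    second moment \<open>\<kappa> / (n + 1)\<close> must leave probability at most one half for
    \<open>Z_lim = z\<close>; hence twice \<open>\<kappa>\<close>.\<close>
  define l where "l = 2 * \<kappa>"
  have l: "l > 0" using \<kappa>_pos by (simp add: l_def)
  define G where "G = l\<^sup>2 + 2 * (24 * c\<^sup>2 * (l + \<kappa>) + 3 * c ^ 4)"
  have G: "G > 0" unfolding G_def using l \<kappa>_pos by (intro add_pos_nonneg) auto
  from second_moment_lower[OF spread z less_imp_le[OF l]] obtain \<gamma> n0 where \<gamma>: "\<gamma> > 0"
    and lower: "\<And>n W. n \<ge> n0 \<Longrightarrow> weight n W \<Longrightarrow> (\<And>\<omega>. W \<omega> \<ge> 0) \<Longrightarrow>
      (\<And>\<omega>. W \<omega> * (Z n \<omega> - z)\<^sup>2 \<le> W \<omega> * (l / (real n + 1))) \<Longrightarrow>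
      \<gamma> / (real n + 1) * (\<integral>\<omega>. W \<omega> \<partial>M) \<le> (\<integral>\<omega>. W \<omega> * (Z_lim \<omega> - z)\<^sup>2 \<partial>M)"
    by blast
  \<comment> \<open>One half serves the pasts far from \<open>z\<close>, and
    \<open>\<gamma>^2 / G\<close>, the ratio of squared second to fourth moment, those near
    \<open>z\<close>.\<close>
  define \<delta> where "\<delta> = min (1 / 2) (\<gamma>\<^sup>2 / G)"
  have \<delta>: "\<delta> > 0" using \<gamma> G by (simp add: \<delta>_def)
  have \<delta>_le: "\<delta> \<le> 1 / 2" "\<delta> \<le> \<gamma>\<^sup>2 / G"
    unfolding \<delta>_def by (rule min.cobounded1, rule min.cobounded2)
  let ?I = "\<lambda>\<omega>. indicator (- {z}) (Z_lim \<omega>) :: real"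
  have I: "?I \<in> borel_measurable M" by measurable
  have AE_I: "AE \<omega> in M. \<bar>?I \<omega>\<bar> \<le> 1" by (auto simp: indicator_def)
  show ?thesis
  proof (rule exI[of _ \<delta>], intro conjI \<delta> exI[of _ n0] allI impI)
    fix n W
    assume n: "n \<ge> n0" and W: "weight n W" and nonneg: "\<forall>\<omega>. 0 \<le> W \<omega>"
    define S where "S = {x. (x - z)\<^sup>2 \<le> l / (real n + 1)}"
    have S: "S \<in> sets borel" unfolding S_def by measurable
    define W1 where "W1 = (\<lambda>\<omega>. W \<omega> * indicator S (Z n \<omega>))"
    define W2 where "W2 = (\<lambda>\<omega>. W \<omega> * indicator (- S) (Z n \<omega>))"
    have W1: "weight n W1" and W2: "weight n W2"
      unfolding W1_def W2_def using S by (intro weight_mult W weight_indicator; simp)+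
    have nonneg12: "W1 \<omega> \<ge> 0" "W2 \<omega> \<ge> 0" for \<omega>
      using nonneg by (auto simp: W1_def W2_def)
    have W12: "W \<omega> = W1 \<omega> + W2 \<omega>" for \<omega>
      by (auto simp: W1_def W2_def indicator_def)
    have near: "W1 \<omega> * (Z n \<omega> - z)\<^sup>2 \<le> W1 \<omega> * (l / (real n + 1))" for \<omega>
    proof (cases "Z n \<omega> \<in> S")
      case True
      then have "(Z n \<omega> - z)\<^sup>2 \<le> l / (real n + 1)" by (simp add: S_def)
      from mult_left_mono[OF this] show ?thesis using nonneg12(1) by simp
    qed (simp add: W1_def)
    have n1: "real n + 1 > 0" by simp
    have "\<delta> * (\<integral>\<omega>. W1 \<omega> \<partial>M) \<le> (\<integral>\<omega>. W1 \<omega> * ?I \<omega> \<partial>M)"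
    proof -
      \<comment> \<open>The pointwise bound \<open>y \<le> t + y^2 / (4 * t)\<close>, with
        \<open>y\<close> the squared distance, replaces Cauchy-Schwarz. This \<open>t\<close> makes
        the fourth-moment term exactly half of the lower bound on the second moment, so the
        indicator has to supply the other half.\<close>
      define t where "t = G / (2 * \<gamma>) / (real n + 1)"
      have t: "t > 0" using G \<gamma> by (simp add: t_def)
      have bound: "AE \<omega> in M. \<bar>(Z_lim \<omega> - z) ^ p\<bar> \<le> 1" for p
        using AE_Z_lim_bounds
      proof eventually_elim
        case (elim \<omega>)
        then have "\<bar>Z_lim \<omega> - z\<bar> \<le> 1" using z by (simp add: abs_le_iff)
        then show ?case by (simp add: power_abs power_le_one)
      qed
      have i2: "integrable M (\<lambda>\<omega>. W1 \<omega> * (Z_lim \<omega> - z) ^ p)" for p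
        by (rule integrable_weight_bounded[OF W1 _ bound]) measurable
      have iI: "integrable M (\<lambda>\<omega>. W1 \<omega> * ?I \<omega>)"
        by (rule integrable_weight_bounded[OF W1 I AE_I])
      have "\<gamma> / (real n + 1) * (\<integral>\<omega>. W1 \<omega> \<partial>M) \<le> (\<integral>\<omega>. W1 \<omega> * (Z_lim \<omega> - z)\<^sup>2 \<partial>M)"
        by (rule lower[OF n W1 nonneg12(1) near])
      also have "\<dots> \<le> (\<integral>\<omega>. t * (W1 \<omega> * ?I \<omega>) + (1 / (4 * t)) * (W1 \<omega> * (Z_lim \<omega> - z) ^ 4) \<partial>M)"
      proof (rule integral_mono_AE[OF i2 _ AE_I2])
        show "integrable M (\<lambda>\<omega>. t * (W1 \<omega> * ?I \<omega>) + (1 / (4 * t)) * (W1 \<omega> * (Z_lim \<omega> - z) ^ 4))"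
          by (intro Bochner_Integration.integrable_add integrable_mult_right iI i2)
        fix \<omega>
        have "(Z_lim \<omega> - z)\<^sup>2 \<le> t * ?I \<omega> + (1 / (4 * t)) * (Z_lim \<omega> - z) ^ 4"
        proof (cases "Z_lim \<omega> = z")
          case False
          define y where "y = (Z_lim \<omega> - z)\<^sup>2"
          have "0 \<le> (y - 2 * t)\<^sup>2 / (4 * t)" using t by simp
          also have "\<dots> = t + (1 / (4 * t)) * y\<^sup>2 - y"
            using t by (simp add: power2_diff field_simps) (simp add: power2_eq_square)
          finally show ?thesis using False by (simp add: y_def flip: power_mult)
        qed simp
        from mult_left_mono[OF this nonneg12(1)[of \<omega>]]
        show "W1 \<omega> * (Z_lim \<omega> - z)\<^sup>2 \<le> t * (W1 \<omega> * ?I \<omega>) + (1 / (4 * t)) * (W1 \<omega> * (Z_lim \<omega> - z) ^ 4)"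
          by (simp add: distrib_left mult_ac)
      qed
      also have "\<dots> = t * (\<integral>\<omega>. W1 \<omega> * ?I \<omega> \<partial>M) + (1 / (4 * t)) * (\<integral>\<omega>. W1 \<omega> * (Z_lim \<omega> - z) ^ 4 \<partial>M)"
        using Bochner_Integration.integral_add[OF integrable_mult_right[OF iI] integrable_mult_right[OF i2]]
        by (simp only: integral_mult_right_zero)
      also have "\<dots> \<le> t * (\<integral>\<omega>. W1 \<omega> * ?I \<omega> \<partial>M) + (1 / (4 * t)) * (G / (real n + 1)\<^sup>2 * (\<integral>\<omega>. W1 \<omega> \<partial>M))"
        unfolding G_def using t l
        by (intro add_left_mono mult_left_mono fourth_moment_upper[OF W1 nonneg12(1) z _ near]) auto
      also have "(1 / (4 * t)) * (G / (real n + 1)\<^sup>2 * (\<integral>\<omega>. W1 \<omega> \<partial>M)) = (\<gamma> / (real n + 1) * (\<integral>\<omega>. W1 \<omega> \<partial>M) / 2)"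
        using G \<gamma> by (simp add: t_def power2_eq_square)
      finally have "(\<gamma> / (real n + 1) * (\<integral>\<omega>. W1 \<omega> \<partial>M) / 2) \<le> t * (\<integral>\<omega>. W1 \<omega> * ?I \<omega> \<partial>M)"
        by linarith
      then have "(1 / t) * ((\<gamma> / (real n + 1) * (\<integral>\<omega>. W1 \<omega> \<partial>M) / 2)) \<le> (1 / t) * (t * (\<integral>\<omega>. W1 \<omega> * ?I \<omega> \<partial>M))"
        using t by (intro mult_left_mono) auto
      moreover have "(1 / t) * ((\<gamma> / (real n + 1) * (\<integral>\<omega>. W1 \<omega> \<partial>M) / 2)) = \<gamma>\<^sup>2 / G * (\<integral>\<omega>. W1 \<omega> \<partial>M)"
      proof -
        have "(1 / (G / (2 * \<gamma>) / x)) * (\<gamma> / x * y / 2) = \<gamma>\<^sup>2 / G * y" if "x > 0" for x y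
          using that G \<gamma> by (simp add: power2_eq_square)
        from this[OF n1] show ?thesis by (simp only: t_def)
      qed
      moreover have "(1 / t) * (t * (\<integral>\<omega>. W1 \<omega> * ?I \<omega> \<partial>M)) = (\<integral>\<omega>. W1 \<omega> * ?I \<omega> \<partial>M)"
        using t by simp
      ultimately have "\<gamma>\<^sup>2 / G * (\<integral>\<omega>. W1 \<omega> \<partial>M) \<le> (\<integral>\<omega>. W1 \<omega> * ?I \<omega> \<partial>M)" by linarith
      moreover have "\<delta> * (\<integral>\<omega>. W1 \<omega> \<partial>M) \<le> \<gamma>\<^sup>2 / G * (\<integral>\<omega>. W1 \<omega> \<partial>M)"
        by (intro mult_right_mono integral_nonneg_weight \<delta>_le nonneg12)
      ultimately show ?thesis by linarith
    qed
    moreover have "\<delta> * (\<integral>\<omega>. W2 \<omega> \<partial>M) \<le> (\<integral>\<omega>. W2 \<omega> * ?I \<omega> \<partial>M)"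
    proof -
      let ?J = "\<lambda>\<omega>. indicator {z} (Z_lim \<omega>) :: real"
      have J: "?J \<in> borel_measurable M" by measurable
      have iJ: "integrable M (\<lambda>\<omega>. W2 \<omega> * ?J \<omega>)"
        by (rule integrable_weight_bounded[OF W2 J]) (auto simp: indicator_def)
      have iI: "integrable M (\<lambda>\<omega>. W2 \<omega> * ?I \<omega>)"
        by (rule integrable_weight_bounded[OF W2 I AE_I])
      have bound: "AE \<omega> in M. \<bar>(Z_lim \<omega> - Z n \<omega>)\<^sup>2\<bar> \<le> 1"
        using AE_Z_lim_bounds
      proof eventually_elim
        case (elim \<omega>)
        have "\<bar>Z_lim \<omega> - Z n \<omega>\<bar>\<^sup>2 \<le> 1"
          using elim Z_bounds[of n \<omega>] by (intro power_le_one) (auto simp: abs_le_iff)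
        then show ?case by simp
      qed
      have i2: "integrable M (\<lambda>\<omega>. W2 \<omega> * (Z_lim \<omega> - Z n \<omega>)\<^sup>2)"
        by (rule integrable_weight_bounded[OF W2 _ bound]) measurable
      have "l / (real n + 1) * (\<integral>\<omega>. W2 \<omega> * ?J \<omega> \<partial>M) = (\<integral>\<omega>. l / (real n + 1) * (W2 \<omega> * ?J \<omega>) \<partial>M)"
        by (rule integral_mult_right_zero[symmetric])
      also have "\<dots> \<le> (\<integral>\<omega>. W2 \<omega> * (Z_lim \<omega> - Z n \<omega>)\<^sup>2 \<partial>M)"
      proof (rule integral_mono_AE[OF integrable_mult_right[OF iJ] i2 AE_I2])
        fix \<omega>
        show "l / (real n + 1) * (W2 \<omega> * ?J \<omega>) \<le> W2 \<omega> * (Z_lim \<omega> - Z n \<omega>)\<^sup>2"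
        proof (cases "Z_lim \<omega> = z \<and> Z n \<omega> \<notin> S")
          case True
          \<comment> \<open>On this event \<open>Z n\<close> lies outside the window around
            \<open>z\<close>, which is now the value of the limit.\<close>
          then have "l / (real n + 1) \<le> (Z_lim \<omega> - Z n \<omega>)\<^sup>2"
            by (simp add: S_def power2_commute)
          from mult_left_mono[OF this nonneg12(2)[of \<omega>]] True show ?thesis by (simp add: mult.commute)
        next
          case False
          then show ?thesis using nonneg12(2)[of \<omega>] by (auto simp: W2_def)
        qed
      qed
      also have "\<dots> \<le> \<kappa> * (\<integral>\<omega>. W2 \<omega> * Z n \<omega> \<partial>M) / (real n + 1)"
        by (rule second_moment_limit[OF W2 nonneg12(2)])
      also have "\<dots> \<le> \<kappa> * (\<integral>\<omega>. W2 \<omega> \<partial>M) / (real n + 1)"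
        using \<kappa>_pos by (intro divide_right_mono mult_left_mono integral_weight_Z_le[OF W2 nonneg12(2)]) auto
      finally have "\<kappa> / (real n + 1) * (2 * (\<integral>\<omega>. W2 \<omega> * ?J \<omega> \<partial>M)) \<le> \<kappa> / (real n + 1) * (\<integral>\<omega>. W2 \<omega> \<partial>M)"
        by (simp add: l_def mult_ac)
      then have "2 * (\<integral>\<omega>. W2 \<omega> * ?J \<omega> \<partial>M) \<le> (\<integral>\<omega>. W2 \<omega> \<partial>M)"
        using \<kappa>_pos n1 by (simp only: mult_le_cancel_left_pos divide_pos_pos)
      moreover have "(\<integral>\<omega>. W2 \<omega> \<partial>M) = (\<integral>\<omega>. W2 \<omega> * ?I \<omega> + W2 \<omega> * ?J \<omega> \<partial>M)"
        by (intro Bochner_Integration.integral_cong) (auto simp: indicator_def)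
      moreover have "\<dots> = (\<integral>\<omega>. W2 \<omega> * ?I \<omega> \<partial>M) + (\<integral>\<omega>. W2 \<omega> * ?J \<omega> \<partial>M)"
        by (rule Bochner_Integration.integral_add[OF iI iJ])
      moreover have "\<delta> * (\<integral>\<omega>. W2 \<omega> \<partial>M) \<le> 1 / 2 * (\<integral>\<omega>. W2 \<omega> \<partial>M)"
        by (intro mult_right_mono integral_nonneg_weight \<delta>_le nonneg12)
      ultimately show ?thesis by linarith
    qed
    moreover have "(\<integral>\<omega>. W \<omega> \<partial>M) = (\<integral>\<omega>. W1 \<omega> \<partial>M) + (\<integral>\<omega>. W2 \<omega> \<partial>M)"
      unfolding W12 by (rule integral_weight_add[OF W1 W2])
    moreover have "(\<integral>\<omega>. W \<omega> * ?I \<omega> \<partial>M) = (\<integral>\<omega>. W1 \<omega> * ?I \<omega> \<partial>M) + (\<integral>\<omega>. W2 \<omega> * ?I \<omega> \<partial>M)"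
      unfolding W12 distrib_right
      by (rule Bochner_Integration.integral_add[OF integrable_weight_bounded[OF W1 I AE_I] integrable_weight_bounded[OF W2 I AE_I]])
    ultimately show "\<delta> * (\<integral>\<omega>. W \<omega> \<partial>M) \<le> (\<integral>\<omega>. W \<omega> * ?I \<omega> \<partial>M)"
      by (simp add: distrib_left)
  qed
qed

text \<open>Apply the escape bound to the weights \<open>\<phi> j (Z n)\<close>. Continuity of
  \<open>\<phi> j\<close> lets \<open>n\<close> tend to infinity with \<open>j\<close> fixed, so the
  atom times \<open>\<delta>\<close> is at most the mean of \<open>\<phi> j (Z_lim)\<close> off the
  atom; there \<open>\<phi> j\<close> tends to 0 as \<open>j\<close> grows.\<close>

theorem Z_lim_no_atom:
  assumes spread: "spreads_at z" and z: "0 \<le> z" "z \<le> 1"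
  shows "measure M {\<omega> \<in> space M. Z_lim \<omega> = z} = 0"
proof -
  obtain \<delta> n0 where \<delta>: "\<delta> > 0" and escape: "\<And>n W. n \<ge> n0 \<Longrightarrow> weight n W \<Longrightarrow> (\<And>\<omega>. W \<omega> \<ge> 0) \<Longrightarrow>
    \<delta> * (\<integral>\<omega>. W \<omega> \<partial>M) \<le> (\<integral>\<omega>. W \<omega> * indicator (- {z}) (Z_lim \<omega>) \<partial>M)"
    using uniform_escape[OF spread z] by blast
  \<comment> \<open>Continuous functions with values in the unit interval that decrease pointwise to
    the indicator of \<open>z\<close>.\<close>
  define \<phi> where "\<phi> j x = 1 / (1 + real j * (x - z)\<^sup>2)" for j :: nat and x
  have den: "1 + real j * (x - z)\<^sup>2 \<ge> 1" for j x by simp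
  have \<phi>: "0 \<le> \<phi> j x" "\<phi> j x \<le> 1" for j x
    using den[of j x] frac_le[of 1 1 1 "1 + real j * (x - z)\<^sup>2"] by (simp_all add: \<phi>_def)
  have [measurable]: "\<phi> j \<in> borel_measurable borel" for j
    unfolding \<phi>_def by measurable
  have cont: "(\<lambda>n. \<phi> j (x n)) \<longlonglongrightarrow> \<phi> j y" if "x \<longlonglongrightarrow> y" for j x y
    unfolding \<phi>_def using den[of j y] that by (intro tendsto_intros) linarith+
  let ?I = "\<lambda>\<omega>. indicator (- {z}) (Z_lim \<omega>) :: real"
  let ?A = "{\<omega> \<in> space M. Z_lim \<omega> = z}"
  have "\<delta> * measure M ?A \<le> (\<integral>\<omega>. \<phi> j (Z_lim \<omega>) * ?I \<omega> \<partial>M)" for j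
  proof -
    have "\<delta> * measure M ?A = \<delta> * (\<integral>\<omega>. indicator ?A \<omega> \<partial>M)" by simp
    also have "\<dots> \<le> \<delta> * (\<integral>\<omega>. \<phi> j (Z_lim \<omega>) \<partial>M)"
    proof (intro mult_left_mono integral_mono_AE AE_I2)
      show "integrable M (\<lambda>\<omega>. \<phi> j (Z_lim \<omega>))"
        using \<phi> by (intro integrable_const_bound[where B = 1]) auto
      show "integrable M (indicator ?A :: 'w \<Rightarrow> real)"
        by (intro integrable_real_indicator) (auto simp: emeasure_eq_measure)
      show "indicator ?A \<omega> \<le> \<phi> j (Z_lim \<omega>)" for \<omega>
        using \<phi>(1) by (auto simp: indicator_def \<phi>_def)
    qed (use \<delta> in simp)
    also have "\<dots> \<le> (\<integral>\<omega>. \<phi> j (Z_lim \<omega>) * ?I \<omega> \<partial>M)"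
    proof (rule LIMSEQ_le)
      show "(\<lambda>n. \<delta> * (\<integral>\<omega>. \<phi> j (Z n \<omega>) \<partial>M)) \<longlonglongrightarrow> \<delta> * (\<integral>\<omega>. \<phi> j (Z_lim \<omega>) \<partial>M)"
      proof (intro tendsto_mult_left integral_dominated_convergence[where w = "\<lambda>_. 1"])
        show "AE \<omega> in M. (\<lambda>n. \<phi> j (Z n \<omega>)) \<longlonglongrightarrow> \<phi> j (Z_lim \<omega>)"
          using AE_tendsto_Z_lim by eventually_elim (rule cont)
      qed (use \<phi> in auto)
      show "(\<lambda>n. \<integral>\<omega>. \<phi> j (Z n \<omega>) * ?I \<omega> \<partial>M) \<longlonglongrightarrow> (\<integral>\<omega>. \<phi> j (Z_lim \<omega>) * ?I \<omega> \<partial>M)"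
      proof (intro integral_dominated_convergence[where w = "\<lambda>_. 1"])
        show "AE \<omega> in M. (\<lambda>n. \<phi> j (Z n \<omega>) * ?I \<omega>) \<longlonglongrightarrow> \<phi> j (Z_lim \<omega>) * ?I \<omega>"
          using AE_tendsto_Z_lim by eventually_elim (intro tendsto_mult_right cont)
      qed (use \<phi> in \<open>auto simp: indicator_def\<close>)
      have "weight n (\<lambda>\<omega>. \<phi> j (Z n \<omega>))" for n
        using \<phi> by (intro weight_bounded[where D = 1]) (auto simp: abs_le_iff intro: order_trans[of _ 0])
      \<comment> \<open>Uniformity in \<open>n\<close> is essential here: the same
        \<open>\<delta>\<close> and \<open>n0\<close> serve every weight.\<close>
      then show "\<exists>N. \<forall>n\<ge>N. \<delta> * (\<integral>\<omega>. \<phi> j (Z n \<omega>) \<partial>M) \<le> (\<integral>\<omega>. \<phi> j (Z n \<omega>) * ?I \<omega> \<partial>M)"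
        using \<phi>(1) by (intro exI[of _ n0] allI impI escape)
    qed
    finally show ?thesis .
  qed
  moreover have "(\<lambda>j. \<integral>\<omega>. \<phi> j (Z_lim \<omega>) * ?I \<omega> \<partial>M) \<longlonglongrightarrow> (\<integral>\<omega>. 0 \<partial>M)"
  proof (intro integral_dominated_convergence[where w = "\<lambda>_. 1"] AE_I2)
    fix \<omega>
    show "(\<lambda>j. \<phi> j (Z_lim \<omega>) * ?I \<omega>) \<longlonglongrightarrow> 0"
    proof (cases "Z_lim \<omega> = z")
      case False
      then have "filterlim (\<lambda>j. (Z_lim \<omega> - z)\<^sup>2 * real j) at_top sequentially"
        by (intro filterlim_tendsto_pos_mult_at_top[OF tendsto_const _ filterlim_real_sequentially]) simp
      then have "filterlim (\<lambda>j. 1 + real j * (Z_lim \<omega> - z)\<^sup>2) at_top sequentially"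
        by (intro filterlim_tendsto_add_at_top[OF tendsto_const]) (simp add: mult.commute)
      then have "(\<lambda>j. inverse (1 + real j * (Z_lim \<omega> - z)\<^sup>2)) \<longlonglongrightarrow> 0"
        by (rule tendsto_inverse_0_at_top)
      with False show ?thesis by (simp add: \<phi>_def inverse_eq_divide)
    qed simp
  qed (use \<phi> in \<open>auto simp: indicator_def\<close>)
  ultimately have "\<delta> * measure M ?A \<le> 0"
    by (intro LIMSEQ_le_const[where X = "\<lambda>j. \<integral>\<omega>. \<phi> j (Z_lim \<omega>) * ?I \<omega> \<partial>M"]) auto
  with \<delta> show ?thesis by (simp add: mult_le_0_iff measure_le_0_iff)
qed

end

section \<open>The hypergeometric urn\<close>

text \<open>The hypergeometric mean, by the absorption identity for \<open>k * (h choose k)\<close>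
  and Vandermonde. The range extends to a fixed \<open>C\<close> because the sample size will be
  random and the sum has to be exchanged with an integral.\<close>

lemma sum_hypergeometric_mass:
  assumes "n \<le> s" "h \<le> s" "0 < s" and "n \<le> C"
  shows "(\<Sum>k\<le>C. real k * hypergeometric_mass n s h k) = real n * real h / real s"
proof (cases "n = 0 \<or> h = 0")
  case True
  then have "real k * hypergeometric_mass n s h k = 0" for k
    by (cases "k = 0") (auto simp: hypergeometric_mass_def binomial_eq_0)
  then have "(\<Sum>k\<le>C. real k * hypergeometric_mass n s h k) = 0" by (intro sum.neutral) blast
  with True show ?thesis by auto
next
  case False
  then obtain n' h' where n': "n = Suc n'" and h': "h = Suc h'"
    using not0_implies_Suc by blast
  from \<open>0 < s\<close> obtain s' where s': "s = Suc s'" using gr0_implies_Suc by blast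
  have pos: "s choose n > 0" using \<open>n \<le> s\<close> by (simp add: zero_less_binomial_iff)
  have "(\<Sum>k\<le>C. real k * hypergeometric_mass n s h k) = (\<Sum>k\<le>n. real k * hypergeometric_mass n s h k)"
    using \<open>n \<le> C\<close> by (intro sum.mono_neutral_right) (auto simp: hypergeometric_mass_def)
  also have "\<dots> = (\<Sum>k\<le>n. real (k * (h choose k) * ((s - h) choose (n - k)))) / real (s choose n)"
    unfolding sum_divide_distrib by (intro sum.cong) (auto simp: hypergeometric_mass_def)
  also have "(\<Sum>k\<le>n. real (k * (h choose k) * ((s - h) choose (n - k)))) = real (\<Sum>k\<le>n. k * (h choose k) * ((s - h) choose (n - k)))"
    by simp
  also have "(\<Sum>k\<le>n. k * (h choose k) * ((s - h) choose (n - k)))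
      = (\<Sum>k\<le>n'. Suc k * (h choose Suc k) * ((s - h) choose (n - Suc k)))"
    unfolding n' sum.atMost_Suc_shift by simp
  also have "\<dots> = (\<Sum>k\<le>n'. h * ((h' choose k) * ((s - h) choose (n' - k))))"
    by (intro sum.cong refl) (simp only: binomial_absorption h' n' diff_Suc_Suc diff_Suc_1 mult.assoc)
  also have "\<dots> = h * ((h' + (s - h)) choose n')"
    by (simp add: sum_distrib_left[symmetric] vandermonde)
  also have "h' + (s - h) = s'" using \<open>h \<le> s\<close> by (simp add: h' s')
  finally have e: "(\<Sum>k\<le>C. real k * hypergeometric_mass n s h k) = real (h * (s' choose n')) / real (s choose n)" .
  have "n * (s choose n) = s * (s' choose n')"
    unfolding n' s' by (metis binomial_absorption diff_Suc_1)
  then have "real n * real (s choose n) = real s * real (s' choose n')"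
    by (metis of_nat_mult)
  then show ?thesis unfolding e using pos \<open>0 < s\<close> by (simp add: field_simps)
qed

text \<open>From \<open>(k / n) ^ n \<le> k choose n\<close> and
  \<open>(h + k) choose n \<le> (h + k) ^ n\<close>. Replacing \<open>n\<close> by \<open>C\<close>,
  legitimate as the base is at most 1, makes the bound independent of the random sample
  size.\<close>

lemma hypergeometric_mass_0_ge:
  assumes n: "1 \<le> n" "n \<le> C" and "C \<le> k"
  shows "(real k / real (h + k) / real C) ^ C \<le> hypergeometric_mass n (h + k) h 0"
proof -
  define x where "x = real k / real (h + k)"
  have pos: "real n > 0" "real C > 0" "real (h + k) > 0" "real k > 0" using assms by auto
  have x: "0 \<le> x" "x \<le> 1" using pos by (auto simp: x_def divide_simps)
  have "(x / real C) ^ C \<le> (x / real C) ^ n"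
    using x pos n by (intro power_decreasing) (auto simp: divide_simps)
  also have "\<dots> \<le> (x / real n) ^ n"
    using x pos n by (intro power_mono divide_left_mono) auto
  also have "\<dots> = (real k / real n) ^ n / real (h + k) ^ n"
    by (simp add: x_def power_divide power_mult_distrib mult.commute)
  also have "\<dots> \<le> real (k choose n) / real ((h + k) choose n)"
  proof (intro frac_le)
    show "(real k / real n) ^ n \<le> real (k choose n)"
      using binomial_ge_n_over_k_pow_k[of n k, where 'a = real] assms by simp
    have "(h + k) choose n \<le> (h + k) ^ n" using assms by (intro binomial_le_pow) auto
    then show "real ((h + k) choose n) \<le> real (h + k) ^ n"
      by (metis of_nat_le_iff of_nat_power)
    show "0 < real ((h + k) choose n)"
      using assms by (simp add: zero_less_binomial_iff)
  qed simp
  also have "\<dots> = hypergeometric_mass n (h + k) h 0"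
    by (simp add: hypergeometric_mass_def)
  finally show ?thesis by (simp add: x_def)
qed

section \<open>Independence and conditional expectation as integral identities\<close>

lemma (in prob_space) indep_set_lebesgue_integral:
  assumes indep: "indep_set (sets G) (sets H)"
    and G: "subalgebra M G" and H: "subalgebra M H"
    and f: "f \<in> borel_measurable G" "integrable M f" and g: "g \<in> borel_measurable H" "integrable M g"
  shows "(\<integral>\<omega>. f \<omega> * g \<omega> \<partial>M) = (\<integral>\<omega>. f \<omega> \<partial>M) * (\<integral>\<omega>. g \<omega> \<partial>M :: real)"
proof (rule indep_var_lebesgue_integral)
  have sub: "sigma_sets (space M) {u -` A \<inter> space M | A. A \<in> sets borel} \<subseteq> sets G'"
    if "subalgebra M G'" "u \<in> borel_measurable G'" for G' and u :: "'a \<Rightarrow> real"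
  proof -
    have sp: "space G' = space M" using that(1) by (simp add: subalgebra_def)
    show ?thesis
      unfolding sp[symmetric] using measurable_sets[OF that(2)] by (intro sets.sigma_sets_subset) auto
  qed
  show "indep_var borel f borel g"
    unfolding indep_var_eq
  proof (intro conjI)
    show "random_variable borel f" "random_variable borel g"
      using f(2) g(2) by auto
    show "indep_set (sigma_sets (space M) {f -` A \<inter> space M | A. A \<in> sets borel})
        (sigma_sets (space M) {g -` A \<inter> space M | A. A \<in> sets borel})"
      using indep unfolding indep_set_def
      by (rule indep_sets_mono_sets) (auto split: bool.split dest: subsetD[OF sub[OF G f(1)]] subsetD[OF sub[OF H g(1)]])
  qed
qed (use f g in auto)

text \<open>This translates assumptions on conditional laws into the weighted integrals in which the
  balanced process is stated.\<close>

lemma (in finite_measure) integral_mult_real_cond_exp: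
  assumes G: "subalgebra M G" and W: "W \<in> borel_measurable G" "AE \<omega> in M. \<bar>W \<omega>\<bar> \<le> D"
    and Y: "integrable M Y"
  shows "integrable M (\<lambda>\<omega>. W \<omega> * real_cond_exp M G Y \<omega>)"
    "(\<integral>\<omega>. W \<omega> * real_cond_exp M G Y \<omega> \<partial>M) = (\<integral>\<omega>. W \<omega> * Y \<omega> \<partial>M)"
proof -
  interpret finite_measure_subalgebra M G by unfold_locales (rule G)
  have i: "integrable M (\<lambda>\<omega>. W \<omega> * Y \<omega>)"
  proof (rule Bochner_Integration.integrable_bound)
    show "integrable M (\<lambda>\<omega>. D * Y \<omega>)" using Y by simp
    show "(\<lambda>\<omega>. W \<omega> * Y \<omega>) \<in> borel_measurable M"
      using measurable_from_subalg[OF G W(1)] Y by measurable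
    show "AE \<omega> in M. norm (W \<omega> * Y \<omega>) \<le> norm (D * Y \<omega>)"
      using W(2) by eventually_elim (auto simp: abs_mult intro!: mult_right_mono)
  qed
  show "integrable M (\<lambda>\<omega>. W \<omega> * real_cond_exp M G Y \<omega>)"
    "(\<integral>\<omega>. W \<omega> * real_cond_exp M G Y \<omega> \<partial>M) = (\<integral>\<omega>. W \<omega> * Y \<omega> \<partial>M)"
    using real_cond_exp_intg[OF i W(1)] Y by auto
qed

lemma subalgebra_vimage_algebra:
  assumes "subalgebra M G" "f \<in> measurable G L"
  shows "subalgebra G (vimage_algebra (space M) f L)"
  using assms sets_image_in_sets[of G "space M" f L] by (auto simp: subalgebra_def)

context hypergeometric_urn begin

abbreviation F :: "nat \<Rightarrow> 'w measure" where "F n \<equiv> urn_filtration M N X A B n"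
abbreviation G :: "nat \<Rightarrow> 'w measure" where "G n \<equiv> urn_before_draw M N X A B (Suc n)"
abbreviation L :: "nat \<Rightarrow> 'w measure" where "L n \<equiv> urn_after_draw M N X A B (Suc n)"
abbreviation H :: "nat \<Rightarrow> 'w \<Rightarrow> nat" where "H n \<equiv> balls_A a X A n"
abbreviation K :: "nat \<Rightarrow> 'w \<Rightarrow> nat" where "K n \<equiv> balls_B b N X B n"
abbreviation S :: "nat \<Rightarrow> 'w \<Rightarrow> nat" where "S n \<equiv> balls_total a b N X A B n"

section \<open>The sigma-algebras of the urn and what is measurable for them\<close>

lemma history_in_space: "urn_history N X A B n \<omega> \<in> space (history_space n)"
  by (auto simp: urn_history_def history_space_def space_PiM)

lemma measurable_history_F: "urn_history N X A B n \<in> measurable (F n) (history_space n)"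
  unfolding urn_filtration_def by (intro measurable_vimage_algebra1) (simp add: history_in_space)

lemma measurable_step_F:
  assumes "j \<in> {1..n}"
  shows "urn_step N X A B j \<in> measurable (F n) (count_space UNIV)"
proof -
  have "(\<lambda>\<omega>. urn_history N X A B n \<omega> j) \<in> measurable (F n) (count_space UNIV)"
    using measurable_history_F[of n] assms unfolding history_space_def
    by (rule measurable_compose[OF _ measurable_component_singleton])
  then show ?thesis using assms by (simp add: urn_history_def cong: measurable_cong)
qed

lemma measurable_components_F:
  assumes "j \<in> {1..n}"
  shows "N j \<in> measurable (F n) (count_space UNIV)" "X j \<in> measurable (F n) (count_space UNIV)"
    "A j \<in> measurable (F n) (count_space UNIV)" "B j \<in> measurable (F n) (count_space UNIV)"
proof -
  have "(\<lambda>\<omega>. \<phi> (urn_step N X A B j \<omega>)) \<in> measurable (F n) (count_space UNIV)"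
    for \<phi> :: "nat \<times> nat \<times> nat \<times> nat \<Rightarrow> nat"
    by (rule measurable_compose[OF measurable_step_F[OF assms]]) simp
  from this[of fst] this[of "\<lambda>x. fst (snd x)"] this[of "\<lambda>x. fst (snd (snd x))"] this[of "\<lambda>x. snd (snd (snd x))"]
  show "N j \<in> measurable (F n) (count_space UNIV)" "X j \<in> measurable (F n) (count_space UNIV)"
    "A j \<in> measurable (F n) (count_space UNIV)" "B j \<in> measurable (F n) (count_space UNIV)"
    by (simp_all add: urn_step_def)
qed

lemma measurable_balls_F:
  shows "H n \<in> measurable (F n) (count_space UNIV)" "K n \<in> measurable (F n) (count_space UNIV)"
proof -
  have m: "(\<lambda>\<omega>. f \<omega> + (\<Sum>j=1..n. g j \<omega>)) \<in> measurable (F n) (count_space UNIV)"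
    if "f \<in> measurable (F n) (count_space UNIV)" "\<And>j. j \<in> {1..n} \<Longrightarrow> g j \<in> measurable (F n) (count_space UNIV)"
    for f :: "'w \<Rightarrow> nat" and g
  proof -
    have "(\<lambda>\<omega>. \<Sum>j\<in>J. g j \<omega>) \<in> measurable (F n) (count_space UNIV)" if "finite J" "J \<subseteq> {1..n}" for J
      using that
    proof (induction rule: finite_induct)
      case (insert x J)
      then have [measurable]: "g x \<in> measurable (F n) (count_space UNIV)"
        "(\<lambda>\<omega>. \<Sum>j\<in>J. g j \<omega>) \<in> measurable (F n) (count_space UNIV)"
        using \<open>\<And>j. j \<in> {1..n} \<Longrightarrow> g j \<in> measurable (F n) (count_space UNIV)\<close> by auto
      show ?case using insert by simp
    qed simp
    from this[of "{1..n}"] that(1) show ?thesis by simp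
  qed
  show "H n \<in> measurable (F n) (count_space UNIV)"
    unfolding balls_A_def[abs_def] by (intro m) (simp, use measurable_components_F in measurable)
  show "K n \<in> measurable (F n) (count_space UNIV)"
    unfolding balls_B_def[abs_def] by (intro m) (simp, use measurable_components_F in measurable)
qed

lemma S_eq: "S n \<omega> = H n \<omega> + K n \<omega>"
  by (simp add: balls_total_def)

lemma filtration_F: "subalgebra (F (Suc n)) (F n)"
proof -
  have eq: "urn_history N X A B n = (\<lambda>\<omega>. restrict (urn_history N X A B (Suc n) \<omega>) {1..n})"
    by (rule ext) (auto simp: urn_history_def restrict_def fun_eq_iff)
  have "urn_history N X A B n \<in> measurable (F (Suc n)) (history_space n)"
    unfolding eq using measurable_history_F[of "Suc n"] unfolding history_space_def
    by (rule measurable_compose[OF _ measurable_restrict_subset]) auto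
  from subalgebra_vimage_algebra[OF subalgebra_urn_filtration this] show ?thesis
    unfolding urn_filtration_def[of M N X A B n] .
qed

lemma subalgebra_G: "subalgebra M (G n)"
  by (rule subalgebra_urn_before_draw) simp

lemma measurable_G:
  "urn_history N X A B n \<in> measurable (G n) (history_space n)"
  "N (Suc n) \<in> measurable (G n) (count_space UNIV)"
proof -
  have "(\<lambda>\<omega>. (urn_history N X A B n \<omega>, N (Suc n) \<omega>)) \<in> measurable (G n) (history_space n \<Otimes>\<^sub>M count_space UNIV)"
    unfolding urn_before_draw_def by (simp, intro measurable_vimage_algebra1)
      (simp add: space_pair_measure history_in_space)
  from measurable_compose[OF this measurable_fst] measurable_compose[OF this measurable_snd]
  show "urn_history N X A B n \<in> measurable (G n) (history_space n)"
    "N (Suc n) \<in> measurable (G n) (count_space UNIV)" by simp_all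
qed

lemma subalgebra_G_F: "subalgebra (G n) (F n)"
  unfolding urn_filtration_def by (rule subalgebra_vimage_algebra[OF subalgebra_G measurable_G(1)])

lemma subalgebra_L: "subalgebra M (L n)"
proof -
  have "(\<lambda>\<omega>. (urn_history N X A B n \<omega>, N (Suc n) \<omega>, X (Suc n) \<omega>))
      \<in> measurable M (history_space n \<Otimes>\<^sub>M count_space UNIV \<Otimes>\<^sub>M count_space UNIV)"
    using measurable_urn_history random_N random_X by (intro measurable_Pair) auto
  from subalgebra_vimage_algebra[OF _ this] show ?thesis
    unfolding urn_after_draw_def by (simp add: subalgebra_def)
qed

lemma measurable_L:
  "urn_history N X A B n \<in> measurable (L n) (history_space n)"
  "N (Suc n) \<in> measurable (L n) (count_space UNIV)"
  "X (Suc n) \<in> measurable (L n) (count_space UNIV)"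
proof -
  have m: "(\<lambda>\<omega>. (urn_history N X A B n \<omega>, N (Suc n) \<omega>, X (Suc n) \<omega>))
      \<in> measurable (L n) (history_space n \<Otimes>\<^sub>M count_space UNIV \<Otimes>\<^sub>M count_space UNIV)"
    unfolding urn_after_draw_def by (simp, intro measurable_vimage_algebra1)
      (simp add: space_pair_measure history_in_space)
  note m2 = measurable_compose[OF m measurable_snd]
  from measurable_compose[OF m measurable_fst] measurable_compose[OF m2 measurable_fst] measurable_compose[OF m2 measurable_snd]
  show "urn_history N X A B n \<in> measurable (L n) (history_space n)"
    "N (Suc n) \<in> measurable (L n) (count_space UNIV)"
    "X (Suc n) \<in> measurable (L n) (count_space UNIV)" by simp_all
qed

lemma subalgebra_L_F: "subalgebra (L n) (F n)"
  unfolding urn_filtration_def by (rule subalgebra_vimage_algebra[OF subalgebra_L measurable_L(1)])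

section \<open>Consequences of the law of the draw\<close>

lemma measurable_components:
  "N (Suc n) \<in> measurable M (count_space UNIV)" "X (Suc n) \<in> measurable M (count_space UNIV)"
  "A (Suc n) \<in> measurable M (count_space UNIV)" "B (Suc n) \<in> measurable M (count_space UNIV)"
  using random_N random_X random_A random_B by auto

text \<open>The weight may depend on the sample size as well as on the past, since the draw is
  conditioned on both.\<close>

lemma integral_draw:
  assumes W: "W \<in> borel_measurable (G n)" "AE \<omega> in M. \<bar>W \<omega>\<bar> \<le> D"
  shows "integrable M (\<lambda>\<omega>. W \<omega> * hypergeometric_mass (N (Suc n) \<omega>) (S n \<omega>) (H n \<omega>) k)"
    "(\<integral>\<omega>. W \<omega> * indicator {\<omega> \<in> space M. X (Suc n) \<omega> = k} \<omega> \<partial>M)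
      = (\<integral>\<omega>. W \<omega> * hypergeometric_mass (N (Suc n) \<omega>) (S n \<omega>) (H n \<omega>) k \<partial>M)"
proof -
  let ?Y = "indicator {\<omega> \<in> space M. X (Suc n) \<omega> = k} :: 'w \<Rightarrow> real"
  let ?h = "\<lambda>\<omega>. hypergeometric_mass (N (Suc n) \<omega>) (S n \<omega>) (H n \<omega>) k"
  note [measurable] = measurable_components[of n]
  have Y: "integrable M ?Y"
    by (intro integrable_real_indicator) (auto simp: emeasure_eq_measure)
  note ce = integral_mult_real_cond_exp[OF subalgebra_G W Y]
  have law: "AE \<omega> in M. W \<omega> * real_cond_exp M (G n) ?Y \<omega> = W \<omega> * ?h \<omega>"
    using draw_law[of "Suc n" k] unfolding cond_mass_def by (auto elim: eventually_mono)
  have NG: "N (Suc n) \<in> measurable M (count_space UNIV)" "S n \<in> measurable M (count_space UNIV)" "H n \<in> measurable M (count_space UNIV)"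
  proof -
    have HK: "H n \<in> measurable M (count_space UNIV)" "K n \<in> measurable M (count_space UNIV)"
      by (rule measurable_from_subalg[OF subalgebra_urn_filtration measurable_balls_F(1)],
          rule measurable_from_subalg[OF subalgebra_urn_filtration measurable_balls_F(2)])
    then show "H n \<in> measurable M (count_space UNIV)" by simp
    show "S n \<in> measurable M (count_space UNIV)"
      unfolding balls_total_def[abs_def] using HK by measurable
  qed measurable
  have h: "?h \<in> borel_measurable M"
    using NG unfolding hypergeometric_mass_def by measurable
  have Wh: "(\<lambda>\<omega>. W \<omega> * ?h \<omega>) \<in> borel_measurable M"
    using measurable_from_subalg[OF subalgebra_G W(1)] h by measurable
  show "integrable M (\<lambda>\<omega>. W \<omega> * ?h \<omega>)"
    using integrable_cong_AE[OF _ Wh law] ce(1) by (auto intro: borel_measurable_integrable)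
  show "(\<integral>\<omega>. W \<omega> * ?Y \<omega> \<partial>M) = (\<integral>\<omega>. W \<omega> * ?h \<omega> \<partial>M)"
    using integral_cong_AE[OF _ Wh law] ce by (auto intro: borel_measurable_integrable)
qed

text \<open>The hypergeometric mass vanishes above the sample size, so testing the draw law with the
  weight that indicates \<open>N (Suc n) < k\<close> gives probability zero. This makes the
  truncated subtraction in \<open>balls_B\<close> a genuine one.\<close>

lemma AE_X_le_N: "AE \<omega> in M. X (Suc n) \<omega> \<le> N (Suc n) \<omega>"
proof -
  note [measurable] = measurable_components[of n]
  have "AE \<omega> in M. \<not> (X (Suc n) \<omega> = k \<and> N (Suc n) \<omega> < k)" for k
  proof -
    let ?W = "\<lambda>\<omega>. if N (Suc n) \<omega> < k then 1 else 0 :: real"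
    let ?E = "{\<omega> \<in> space M. X (Suc n) \<omega> = k \<and> N (Suc n) \<omega> < k}"
    have W: "?W \<in> borel_measurable (G n)"
      using measurable_G(2)[of n] by measurable
    have "prob ?E = (\<integral>\<omega>. indicator ?E \<omega> \<partial>M)" by simp
    also have "\<dots> = (\<integral>\<omega>. ?W \<omega> * indicator {\<omega> \<in> space M. X (Suc n) \<omega> = k} \<omega> \<partial>M)"
      by (intro Bochner_Integration.integral_cong) (auto simp: indicator_def)
    also have "\<dots> = (\<integral>\<omega>. ?W \<omega> * hypergeometric_mass (N (Suc n) \<omega>) (S n \<omega>) (H n \<omega>) k \<partial>M)"
      by (rule integral_draw(2)[OF W, where D = 1]) simp
    also have "\<dots> = (\<integral>\<omega>. 0 \<partial>M)"
      by (intro Bochner_Integration.integral_cong) (auto simp: hypergeometric_mass_def)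
    finally have "prob ?E = 0" by simp
    then have "?E \<in> null_sets M" by (auto simp: emeasure_eq_measure)
    from AE_not_in[OF this] show ?thesis by (auto elim!: eventually_mono)
  qed
  then have "AE \<omega> in M. \<forall>k. \<not> (X (Suc n) \<omega> = k \<and> N (Suc n) \<omega> < k)"
    by (simp only: AE_all_countable) blast
  then show ?thesis by eventually_elim (auto simp: not_less)
qed

end

locale bounded_hypergeometric_urn = hypergeometric_urn M a b N X A B
  for M :: "'w measure" and a b :: nat and N X A B :: "nat \<Rightarrow> 'w \<Rightarrow> nat" +
  fixes C :: nat and m :: "nat \<Rightarrow> real"
  assumes bounded: "\<And>n. n \<ge> 1 \<Longrightarrow> AE \<omega> in M. max (A n \<omega>) (max (B n \<omega>) (N n \<omega>)) \<le> C"
    and mean_A: "\<And>n. n \<ge> 1 \<Longrightarrow> (\<integral>\<omega>. real (A n \<omega>) \<partial>M) = m n"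
    and mean_B: "\<And>n. n \<ge> 1 \<Longrightarrow> (\<integral>\<omega>. real (B n \<omega>) \<partial>M) = m n"
begin

section \<open>Almost sure bounds for the urn\<close>

lemma AE_bounds:
  "AE \<omega> in M. X (Suc n) \<omega> \<le> N (Suc n) \<omega> \<and> N (Suc n) \<omega> \<le> C \<and> X (Suc n) \<omega> \<le> C \<and> A (Suc n) \<omega> \<le> C \<and> B (Suc n) \<omega> \<le> C"
proof -
  have "AE \<omega> in M. max (A (Suc n) \<omega>) (max (B (Suc n) \<omega>) (N (Suc n) \<omega>)) \<le> C"
    by (rule bounded) simp
  with AE_X_le_N[of n] show ?thesis by eventually_elim auto
qed

lemma integrable_reinforcement:
  "integrable M (\<lambda>\<omega>. real (A (Suc n) \<omega>))" "integrable M (\<lambda>\<omega>. real (B (Suc n) \<omega>))"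
proof -
  note [measurable] = measurable_components[of n]
  have b: "AE \<omega> in M. norm (real (A (Suc n) \<omega>)) \<le> real C" "AE \<omega> in M. norm (real (B (Suc n) \<omega>)) \<le> real C"
    using AE_bounds[of n] by (eventually_elim, simp)+
  show "integrable M (\<lambda>\<omega>. real (A (Suc n) \<omega>))" by (rule integrable_const_bound[OF b(1)]) measurable
  show "integrable M (\<lambda>\<omega>. real (B (Suc n) \<omega>))" by (rule integrable_const_bound[OF b(2)]) measurable
qed

lemma H_Suc: "H (Suc n) \<omega> = H n \<omega> + A (Suc n) \<omega> * X (Suc n) \<omega>"
  by (simp add: balls_A_def)

lemma K_Suc: "K (Suc n) \<omega> = K n \<omega> + B (Suc n) \<omega> * (N (Suc n) \<omega> - X (Suc n) \<omega>)"
  by (simp add: balls_B_def)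

lemma H_ge_1: "H n \<omega> \<ge> 1"
  using a_ge_1 by (simp add: balls_A_def)

lemma K_ge_1: "K n \<omega> \<ge> 1"
  using b_ge_1 by (simp add: balls_B_def)

lemma AE_increments_le:
  "AE \<omega> in M. A (Suc n) \<omega> * X (Suc n) \<omega> \<le> C * C \<and> B (Suc n) \<omega> * (N (Suc n) \<omega> - X (Suc n) \<omega>) \<le> C * C"
  using AE_bounds[of n] by eventually_elim (auto intro!: mult_le_mono)

text \<open>A deterministic bound at each time turns sums up to the random total into sums over a
  fixed range, which may be exchanged with integrals.\<close>

lemma AE_S_bounded: "\<exists>D. AE \<omega> in M. S n \<omega> \<le> D"
proof (induction n)
  case 0
  show ?case by (intro exI[of _ "a + b"]) (simp add: S_eq balls_A_def balls_B_def)
next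
  case (Suc n)
  then obtain D where "AE \<omega> in M. S n \<omega> \<le> D" by blast
  then have "AE \<omega> in M. S (Suc n) \<omega> \<le> D + 2 * (C * C)"
    using AE_increments_le[of n] by eventually_elim (simp add: S_eq H_Suc K_Suc)
  then show ?case by blast
qed

lemma measurable_S_F: "S n \<in> measurable (F n) (count_space UNIV)"
  unfolding balls_total_def[abs_def] using measurable_balls_F[of n] by measurable

text \<open>The assumption concerns conditional masses summed over a random range. Multiplying the
  mass at \<open>k\<close> by the weight indicating \<open>k \<le> S n\<close> fixes the range;
  integrating then gives the event probability 1.\<close>

lemma AE_N_bounds: "AE \<omega> in M. 1 \<le> N (Suc n) \<omega> \<and> N (Suc n) \<omega> \<le> S n \<omega>"
proof -
  obtain D where D: "AE \<omega> in M. S n \<omega> \<le> D" using AE_S_bounded by blast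
  note [measurable] = measurable_components[of n] measurable_from_subalg[OF subalgebra_urn_filtration measurable_S_F[of n]]
  let ?E = "{\<omega> \<in> space M. 1 \<le> N (Suc n) \<omega> \<and> N (Suc n) \<omega> \<le> S n \<omega>}"
  let ?Y = "\<lambda>k. indicator {\<omega> \<in> space M. N (Suc n) \<omega> = k} :: 'w \<Rightarrow> real"
  let ?W = "\<lambda>k \<omega>. if k \<le> S n \<omega> then 1 else 0 :: real"
  let ?c = "\<lambda>k. real_cond_exp M (F n) (?Y k)"
  have W: "?W k \<in> borel_measurable (F n)" for k
    using measurable_S_F[of n] by measurable
  have Y: "integrable M (?Y k)" for k
    by (intro integrable_real_indicator) (auto simp: emeasure_eq_measure)
  have W1: "AE \<omega> in M. \<bar>?W k \<omega>\<bar> \<le> 1" for k by simp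
  note ce = integral_mult_real_cond_exp[OF subalgebra_urn_filtration W W1 Y]
  have iWY: "integrable M (\<lambda>\<omega>. ?W k \<omega> * ?Y k \<omega>)" for k
    by (intro integrable_const_bound[where B = 1]) (auto simp: indicator_def)
  have "prob ?E = (\<integral>\<omega>. indicator ?E \<omega> \<partial>M)"
    by (simp add: Int_absorb2 Collect_restrict)
  also have "\<dots> = (\<integral>\<omega>. (\<Sum>k=1..D. ?W k \<omega> * ?Y k \<omega>) \<partial>M)"
  proof (rule integral_cong_AE)
    show "AE \<omega> in M. indicator ?E \<omega> = (\<Sum>k=1..D. ?W k \<omega> * ?Y k \<omega>)"
      using D AE_space
    proof eventually_elim
      case (elim \<omega>)
      have "(\<Sum>k=1..D. ?W k \<omega> * ?Y k \<omega>) = (\<Sum>k=1..D. if k = N (Suc n) \<omega> then ?W k \<omega> else 0)"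
        using elim by (intro sum.cong) (auto simp: indicator_def)
      also have "\<dots> = (if N (Suc n) \<omega> \<in> {1..D} then ?W (N (Suc n) \<omega>) \<omega> else 0)"
        by (simp add: sum.delta)
      also have "\<dots> = indicator ?E \<omega>"
        using elim by (auto simp: indicator_def)
      finally show ?case by simp
    qed
    have "(\<lambda>\<omega>. real (N (Suc n) \<omega>)) \<in> borel_measurable M" "(\<lambda>\<omega>. real (S n \<omega>)) \<in> borel_measurable M"
      by measurable
    then have "{\<omega> \<in> space M. 1 \<le> real (N (Suc n) \<omega>)} \<inter> {\<omega> \<in> space M. real (N (Suc n) \<omega>) \<le> real (S n \<omega>)} \<in> sets M"
      by (intro sets.Int borel_measurable_le borel_measurable_const)
    also have "{\<omega> \<in> space M. 1 \<le> real (N (Suc n) \<omega>)} \<inter> {\<omega> \<in> space M. real (N (Suc n) \<omega>) \<le> real (S n \<omega>)} = ?E"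
      by auto
    finally show "indicator ?E \<in> borel_measurable M" by (rule borel_measurable_indicator)
    show "(\<lambda>\<omega>. \<Sum>k=1..D. ?W k \<omega> * ?Y k \<omega>) \<in> borel_measurable M"
      by (intro borel_measurable_sum borel_measurable_integrable iWY)
  qed
  also have "\<dots> = (\<Sum>k=1..D. \<integral>\<omega>. ?W k \<omega> * ?Y k \<omega> \<partial>M)"
    by (rule Bochner_Integration.integral_sum) (rule iWY)
  also have "\<dots> = (\<Sum>k=1..D. \<integral>\<omega>. ?W k \<omega> * ?c k \<omega> \<partial>M)"
    by (intro sum.cong refl ce(2)[symmetric])
  also have "\<dots> = (\<integral>\<omega>. (\<Sum>k=1..D. ?W k \<omega> * ?c k \<omega>) \<partial>M)"
    by (rule Bochner_Integration.integral_sum[symmetric]) (rule ce(1))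
  also have "\<dots> = (\<integral>\<omega>. 1 \<partial>M)"
  proof (rule integral_cong_AE)
    show "AE \<omega> in M. (\<Sum>k=1..D. ?W k \<omega> * ?c k \<omega>) = 1"
      using D sample_size_law[of "Suc n", simplified, unfolded cond_mass_def]
    proof eventually_elim
      case (elim \<omega>)
      have "(\<Sum>k=1..D. ?W k \<omega> * ?c k \<omega>) = (\<Sum>k=1..S n \<omega>. ?c k \<omega>)"
        using elim(1) by (intro sum.mono_neutral_cong_right) auto
      then show ?case using elim(2) by simp
    qed
    show "(\<lambda>\<omega>. \<Sum>k=1..D. ?W k \<omega> * ?c k \<omega>) \<in> borel_measurable M"
      by (intro borel_measurable_sum borel_measurable_integrable ce(1))
  qed simp
  finally have "prob ?E = 1" by (simp add: prob_space)
  from AE_prob_1[OF this] show ?thesis by simp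
qed

section \<open>Conditional means of the increments\<close>

lemma integral_X:
  assumes W: "W \<in> borel_measurable (G n)" "AE \<omega> in M. \<bar>W \<omega>\<bar> \<le> D"
  shows "(\<integral>\<omega>. W \<omega> * real (X (Suc n) \<omega>) \<partial>M)
    = (\<integral>\<omega>. W \<omega> * (real (N (Suc n) \<omega>) * (real (H n \<omega>) / real (S n \<omega>))) \<partial>M)"
proof -
  note [measurable] = measurable_components[of n] measurable_from_subalg[OF subalgebra_urn_filtration measurable_S_F[of n]]
    measurable_from_subalg[OF subalgebra_G W(1)]
    measurable_from_subalg[OF subalgebra_urn_filtration measurable_balls_F(1)[of n]]
  let ?Y = "\<lambda>k. indicator {\<omega> \<in> space M. X (Suc n) \<omega> = k} :: 'w \<Rightarrow> real"
  let ?h = "\<lambda>k \<omega>. hypergeometric_mass (N (Suc n) \<omega>) (S n \<omega>) (H n \<omega>) k"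
  have iWY: "integrable M (\<lambda>\<omega>. real k * (W \<omega> * ?Y k \<omega>))" for k
  proof (intro integrable_mult_right integrable_const_bound)
    show "AE \<omega> in M. norm (W \<omega> * ?Y k \<omega>) \<le> D"
      using W(2) by eventually_elim (auto simp: indicator_def)
  qed measurable
  \<comment> \<open>As \<open>X (Suc n)\<close> is at most \<open>C\<close>, it is a finite
    combination of the indicators to which the draw law applies.\<close>
  have "(\<integral>\<omega>. W \<omega> * real (X (Suc n) \<omega>) \<partial>M) = (\<integral>\<omega>. (\<Sum>k\<le>C. real k * (W \<omega> * ?Y k \<omega>)) \<partial>M)"
  proof (rule integral_cong_AE)
    show "AE \<omega> in M. W \<omega> * real (X (Suc n) \<omega>) = (\<Sum>k\<le>C. real k * (W \<omega> * ?Y k \<omega>))"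
      using AE_bounds[of n] AE_space
    proof eventually_elim
      case (elim \<omega>)
      have "(\<Sum>k\<le>C. real k * (W \<omega> * ?Y k \<omega>)) = (\<Sum>k\<le>C. if k = X (Suc n) \<omega> then real k * W \<omega> else 0)"
        using elim by (intro sum.cong) (auto simp: indicator_def)
      then show ?case using elim by (simp add: sum.delta mult.commute)
    qed
  qed measurable
  also have "\<dots> = (\<Sum>k\<le>C. real k * (\<integral>\<omega>. W \<omega> * ?Y k \<omega> \<partial>M))"
    unfolding Bochner_Integration.integral_sum[OF iWY] by simp
  also have "\<dots> = (\<Sum>k\<le>C. real k * (\<integral>\<omega>. W \<omega> * ?h k \<omega> \<partial>M))"
    by (intro sum.cong refl arg_cong2[where f = "(*)"] integral_draw(2)[OF W])
  also have "\<dots> = (\<Sum>k\<le>C. (\<integral>\<omega>. real k * (W \<omega> * ?h k \<omega>) \<partial>M))" by simp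
  also have "\<dots> = (\<integral>\<omega>. (\<Sum>k\<le>C. real k * (W \<omega> * ?h k \<omega>)) \<partial>M)"
    by (rule Bochner_Integration.integral_sum[symmetric]) (intro integrable_mult_right integral_draw(1)[OF W])
  also have "\<dots> = (\<integral>\<omega>. W \<omega> * (real (N (Suc n) \<omega>) * (real (H n \<omega>) / real (S n \<omega>))) \<partial>M)"
  proof (rule integral_cong_AE)
    show "(\<lambda>\<omega>. \<Sum>k\<le>C. real k * (W \<omega> * ?h k \<omega>)) \<in> borel_measurable M"
      by (intro borel_measurable_sum borel_measurable_integrable integrable_mult_right integral_draw(1)[OF W])
    show "AE \<omega> in M. (\<Sum>k\<le>C. real k * (W \<omega> * ?h k \<omega>)) =
        W \<omega> * (real (N (Suc n) \<omega>) * (real (H n \<omega>) / real (S n \<omega>)))"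
      using AE_bounds[of n] AE_N_bounds[of n]
    proof eventually_elim
      case (elim \<omega>)
      have "(\<Sum>k\<le>C. real k * (W \<omega> * ?h k \<omega>)) = W \<omega> * (\<Sum>k\<le>C. real k * ?h k \<omega>)"
        by (simp add: sum_distrib_left mult_ac)
      also have "(\<Sum>k\<le>C. real k * ?h k \<omega>) = real (N (Suc n) \<omega>) * real (H n \<omega>) / real (S n \<omega>)"
        using elim H_ge_1[of n \<omega>] by (intro sum_hypergeometric_mass) (auto simp: S_eq)
      finally show ?case by simp
    qed
  qed measurable
  finally show ?thesis .
qed

text \<open>\<open>V\<close> is allowed to involve the draw itself, because the number of added
  balls is the reinforcement times the draw; independence is therefore used with respect to
  \<open>L n\<close>.\<close>

lemma integral_reinforcement:
  assumes V: "V \<in> borel_measurable (L n)" "AE \<omega> in M. \<bar>V \<omega>\<bar> \<le> D"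
  shows "(\<integral>\<omega>. real (A (Suc n) \<omega>) * V \<omega> \<partial>M) = m (Suc n) * (\<integral>\<omega>. V \<omega> \<partial>M)"
    "(\<integral>\<omega>. real (B (Suc n) \<omega>) * V \<omega> \<partial>M) = m (Suc n) * (\<integral>\<omega>. V \<omega> \<partial>M)"
proof -
  note [measurable] = measurable_components[of n]
  define J where "J = vimage_algebra (space M) (\<lambda>\<omega>. (A (Suc n) \<omega>, B (Suc n) \<omega>)) (count_space UNIV)"
  have iV: "integrable M V"
    using V measurable_from_subalg[OF subalgebra_L V(1)] by (intro integrable_const_bound[where B = D]) auto
  have J: "subalgebra M J"
    unfolding J_def by (rule subalgebra_vimage_algebra) (simp add: subalgebra_def, measurable)
  have AB: "(\<lambda>\<omega>. (A (Suc n) \<omega>, B (Suc n) \<omega>)) \<in> measurable J (count_space UNIV)"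
    unfolding J_def by (rule measurable_vimage_algebra1) simp
  have mA: "(\<lambda>\<omega>. real (A (Suc n) \<omega>)) \<in> borel_measurable J" "(\<lambda>\<omega>. real (B (Suc n) \<omega>)) \<in> borel_measurable J"
    using measurable_compose[OF AB, of "\<lambda>p. real (fst p)" borel] measurable_compose[OF AB, of "\<lambda>p. real (snd p)" borel] by auto
  note iA = integrable_reinforcement[of n]
  have indep: "indep_set (sets J) (sets (L n))"
    using reinforcement_indep[of "Suc n"] unfolding J_def by simp
  show "(\<integral>\<omega>. real (A (Suc n) \<omega>) * V \<omega> \<partial>M) = m (Suc n) * (\<integral>\<omega>. V \<omega> \<partial>M)"
    using indep_set_lebesgue_integral[OF indep J subalgebra_L mA(1) iA(1) V(1) iV] mean_A[of "Suc n"] by simp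
  show "(\<integral>\<omega>. real (B (Suc n) \<omega>) * V \<omega> \<partial>M) = m (Suc n) * (\<integral>\<omega>. V \<omega> \<partial>M)"
    using indep_set_lebesgue_integral[OF indep J subalgebra_L mA(2) iA(2) V(1) iV] mean_B[of "Suc n"] by simp
qed

text \<open>Together with a nonempty sample, the lower bound gives the
  \<open>\<nu> n \<ge> 1\<close> required of the balanced process.\<close>

lemma m_bounds: "1 \<le> m (Suc n)" "m (Suc n) \<le> real C"
proof -
  have "AE \<omega> in M. 1 \<le> real (A (Suc n) \<omega>)"
    using AE_space[of M] by eventually_elim (use reinforcement_pos[of "Suc n"] in force)
  then have "(\<integral>\<omega>. 1 \<partial>M) \<le> (\<integral>\<omega>. real (A (Suc n) \<omega>) \<partial>M)"
    by (intro integral_mono_AE integrable_reinforcement) auto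
  moreover have "AE \<omega> in M. real (A (Suc n) \<omega>) \<le> real C"
    using AE_bounds[of n] by eventually_elim simp
  then have "(\<integral>\<omega>. real (A (Suc n) \<omega>) \<partial>M) \<le> (\<integral>\<omega>. real C \<partial>M)"
    by (intro integral_mono_AE integrable_reinforcement) auto
  ultimately show "1 \<le> m (Suc n)" "m (Suc n) \<le> real C"
    using mean_A[of "Suc n"] by (auto simp: prob_space)
qed

text \<open>Two conditionings in turn: given \<open>L n\<close> the reinforcement is replaced by its
  mean, and given \<open>G n\<close> the draw by \<open>N (Suc n)\<close> times the proportion.
  Equal means of \<open>A\<close> and \<open>B\<close> make the factor
  \<open>m (Suc n) * N (Suc n)\<close> common to both colors.\<close>

lemma integral_increments:
  assumes W: "W \<in> borel_measurable (F n)" "AE \<omega> in M. \<bar>W \<omega>\<bar> \<le> D"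
  shows "(\<integral>\<omega>. W \<omega> * (real (H (Suc n) \<omega>) - real (H n \<omega>)) \<partial>M) =
      (\<integral>\<omega>. W \<omega> * (m (Suc n) * real (N (Suc n) \<omega>) * (real (H n \<omega>) / (real (H n \<omega>) + real (K n \<omega>)))) \<partial>M)"
    "(\<integral>\<omega>. W \<omega> * (real (K (Suc n) \<omega>) - real (K n \<omega>)) \<partial>M) =
      (\<integral>\<omega>. W \<omega> * (m (Suc n) * real (N (Suc n) \<omega>) * (real (K n \<omega>) / (real (H n \<omega>) + real (K n \<omega>)))) \<partial>M)"
proof -
  note WG = measurable_from_subalg[OF subalgebra_G_F W(1)] and WL = measurable_from_subalg[OF subalgebra_L_F W(1)]
  note [measurable] = measurable_components[of n] measurable_from_subalg[OF subalgebra_urn_filtration W(1)]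
    measurable_from_subalg[OF subalgebra_urn_filtration measurable_balls_F(1)[of n]]
    measurable_from_subalg[OF subalgebra_urn_filtration measurable_balls_F(2)[of n]]
  have V: "(\<lambda>\<omega>. W \<omega> * real (X (Suc n) \<omega>)) \<in> borel_measurable (L n)"
    "(\<lambda>\<omega>. W \<omega> * (real (N (Suc n) \<omega>) - real (X (Suc n) \<omega>))) \<in> borel_measurable (L n)"
    using WL measurable_L(2,3)[of n] by measurable
  have VD: "AE \<omega> in M. \<bar>W \<omega> * real (X (Suc n) \<omega>)\<bar> \<le> D * real C"
    "AE \<omega> in M. \<bar>W \<omega> * (real (N (Suc n) \<omega>) - real (X (Suc n) \<omega>))\<bar> \<le> D * real C"
    "AE \<omega> in M. norm (W \<omega> * real (N (Suc n) \<omega>)) \<le> D * real C"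
    using W(2) AE_bounds[of n] by (eventually_elim, auto simp: abs_mult intro!: mult_mono)+
  have iX: "integrable M (\<lambda>\<omega>. W \<omega> * real (X (Suc n) \<omega>))"
    using VD(1) by (intro integrable_const_bound[where B = "D * real C"]) auto
  have iN: "integrable M (\<lambda>\<omega>. W \<omega> * real (N (Suc n) \<omega>))"
    using VD(3) by (intro integrable_const_bound[where B = "D * real C"]) auto
  let ?z = "\<lambda>\<omega>. real (H n \<omega>) / (real (H n \<omega>) + real (K n \<omega>))"
  have z: "0 \<le> ?z \<omega>" "?z \<omega> \<le> 1" "1 - ?z \<omega> = real (K n \<omega>) / (real (H n \<omega>) + real (K n \<omega>))" for \<omega>
    using H_ge_1[of n \<omega>] by (auto simp: field_simps)
  have iNz: "integrable M (\<lambda>\<omega>. W \<omega> * (real (N (Suc n) \<omega>) * ?z \<omega>))"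
  proof (rule integrable_const_bound)
    show "AE \<omega> in M. norm (W \<omega> * (real (N (Suc n) \<omega>) * ?z \<omega>)) \<le> D * real C"
      using VD(3)
    proof eventually_elim
      case (elim \<omega>)
      have "\<bar>W \<omega> * real (N (Suc n) \<omega>)\<bar> * ?z \<omega> \<le> \<bar>W \<omega> * real (N (Suc n) \<omega>)\<bar>"
        using z[of \<omega>] by (intro mult_left_le) auto
      then show ?case using elim z(1)[of \<omega>] by (simp add: abs_mult mult.assoc)
    qed
  qed measurable
  have X: "(\<integral>\<omega>. W \<omega> * real (X (Suc n) \<omega>) \<partial>M) = (\<integral>\<omega>. W \<omega> * (real (N (Suc n) \<omega>) * ?z \<omega>) \<partial>M)"
    using integral_X[OF WG W(2)] by (simp add: S_eq)
  have "(\<integral>\<omega>. W \<omega> * (real (H (Suc n) \<omega>) - real (H n \<omega>)) \<partial>M) = (\<integral>\<omega>. real (A (Suc n) \<omega>) * (W \<omega> * real (X (Suc n) \<omega>)) \<partial>M)"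
    by (intro Bochner_Integration.integral_cong) (auto simp: H_Suc)
  also have "\<dots> = m (Suc n) * (\<integral>\<omega>. W \<omega> * (real (N (Suc n) \<omega>) * ?z \<omega>) \<partial>M)"
    unfolding integral_reinforcement(1)[OF V(1) VD(1)] X ..
  also have "\<dots> = (\<integral>\<omega>. m (Suc n) * (W \<omega> * (real (N (Suc n) \<omega>) * ?z \<omega>)) \<partial>M)"
    by (rule integral_mult_right_zero[symmetric])
  finally show "(\<integral>\<omega>. W \<omega> * (real (H (Suc n) \<omega>) - real (H n \<omega>)) \<partial>M) =
      (\<integral>\<omega>. W \<omega> * (m (Suc n) * real (N (Suc n) \<omega>) * ?z \<omega>) \<partial>M)"
    by (simp add: mult_ac)
  have "(\<integral>\<omega>. W \<omega> * (real (K (Suc n) \<omega>) - real (K n \<omega>)) \<partial>M)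
      = (\<integral>\<omega>. real (B (Suc n) \<omega>) * (W \<omega> * (real (N (Suc n) \<omega>) - real (X (Suc n) \<omega>))) \<partial>M)"
  \<comment> \<open>Only almost everywhere: the natural-number difference is the real one just where
    \<open>X (Suc n) \<le> N (Suc n)\<close>.\<close>
  proof (rule integral_cong_AE)
    show "AE \<omega> in M. W \<omega> * (real (K (Suc n) \<omega>) - real (K n \<omega>)) =
        real (B (Suc n) \<omega>) * (W \<omega> * (real (N (Suc n) \<omega>) - real (X (Suc n) \<omega>)))"
      using AE_bounds[of n] by eventually_elim (simp add: K_Suc of_nat_diff)
    show "(\<lambda>\<omega>. W \<omega> * (real (K (Suc n) \<omega>) - real (K n \<omega>))) \<in> borel_measurable M"
      unfolding K_Suc by measurable
  qed measurable
  also have "\<dots> = m (Suc n) * (\<integral>\<omega>. W \<omega> * (real (N (Suc n) \<omega>) - real (X (Suc n) \<omega>)) \<partial>M)"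
    by (rule integral_reinforcement(2)[OF V(2) VD(2)])
  also have "(\<integral>\<omega>. W \<omega> * (real (N (Suc n) \<omega>) - real (X (Suc n) \<omega>)) \<partial>M)
      = (\<integral>\<omega>. W \<omega> * real (N (Suc n) \<omega>) \<partial>M) - (\<integral>\<omega>. W \<omega> * (real (N (Suc n) \<omega>) * ?z \<omega>) \<partial>M)"
    unfolding X[symmetric] right_diff_distrib by (rule Bochner_Integration.integral_diff[OF iN iX])
  also have "\<dots> = (\<integral>\<omega>. W \<omega> * real (N (Suc n) \<omega>) - W \<omega> * (real (N (Suc n) \<omega>) * ?z \<omega>) \<partial>M)"
    by (rule Bochner_Integration.integral_diff[OF iN iNz, symmetric])
  also have "m (Suc n) * \<dots> = (\<integral>\<omega>. m (Suc n) * (W \<omega> * real (N (Suc n) \<omega>) - W \<omega> * (real (N (Suc n) \<omega>) * ?z \<omega>)) \<partial>M)"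
    by (rule integral_mult_right_zero[symmetric])
  also have "\<dots> = (\<integral>\<omega>. W \<omega> * (m (Suc n) * real (N (Suc n) \<omega>) * (real (K n \<omega>) / (real (H n \<omega>) + real (K n \<omega>)))) \<partial>M)"
    unfolding z(3)[symmetric] by (intro Bochner_Integration.integral_cong) (auto simp: algebra_simps)
  finally show "(\<integral>\<omega>. W \<omega> * (real (K (Suc n) \<omega>) - real (K n \<omega>)) \<partial>M) =
      (\<integral>\<omega>. W \<omega> * (m (Suc n) * real (N (Suc n) \<omega>) * (real (K n \<omega>) / (real (H n \<omega>) + real (K n \<omega>)))) \<partial>M)" .
qed

text \<open>Drawing no ball of color A is likely enough to bound the conditional variance from below away
  from the boundary.\<close>

lemma square_increment_ge:
  assumes W: "W \<in> borel_measurable (F n)" "AE \<omega> in M. \<bar>W \<omega>\<bar> \<le> D" and nonneg: "\<And>\<omega>. W \<omega> \<ge> 0"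
    and Q: "AE \<omega> in M. W \<omega> > 0 \<longrightarrow> C \<le> K n \<omega> \<and> z \<le> real (H n \<omega>) / real (S n \<omega>) \<and> y \<le> real (K n \<omega>) / real (S n \<omega>)"
    and zy: "0 \<le> z" "0 \<le> y"
  shows "z\<^sup>2 * (y / real C) ^ C * (\<integral>\<omega>. W \<omega> \<partial>M) \<le>
    (\<integral>\<omega>. W \<omega> * ((real (H (Suc n) \<omega>) - real (H n \<omega>)) * (real (K n \<omega>) / real (S n \<omega>))
       - (real (K (Suc n) \<omega>) - real (K n \<omega>)) * (real (H n \<omega>) / real (S n \<omega>)))\<^sup>2 \<partial>M)"
proof -
  note [measurable] = measurable_components[of n] measurable_from_subalg[OF subalgebra_urn_filtration W(1)]
    measurable_from_subalg[OF subalgebra_urn_filtration measurable_balls_F(1)[of n]]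
    measurable_from_subalg[OF subalgebra_urn_filtration measurable_balls_F(2)[of n]]
    measurable_from_subalg[OF subalgebra_urn_filtration measurable_S_F[of n]]
  let ?Y = "indicator {\<omega> \<in> space M. X (Suc n) \<omega> = 0} :: 'w \<Rightarrow> real"
  let ?h = "\<lambda>\<omega>. hypergeometric_mass (N (Suc n) \<omega>) (S n \<omega>) (H n \<omega>) 0"
  let ?R = "\<lambda>\<omega>. (real (H (Suc n) \<omega>) - real (H n \<omega>)) * (real (K n \<omega>) / real (S n \<omega>))
       - (real (K (Suc n) \<omega>) - real (K n \<omega>)) * (real (H n \<omega>) / real (S n \<omega>))"
  note d = integral_draw[OF measurable_from_subalg[OF subalgebra_G_F W(1)] W(2), where k = 0]
  have iW: "integrable M W"
    using W(2) by (intro integrable_const_bound[where B = D]) auto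
  have iWY: "integrable M (\<lambda>\<omega>. W \<omega> * ?Y \<omega>)"
  proof (rule integrable_const_bound)
    show "AE \<omega> in M. norm (W \<omega> * ?Y \<omega>) \<le> D"
      using W(2) by eventually_elim (auto simp: indicator_def)
  qed measurable
  have iWR: "integrable M (\<lambda>\<omega>. W \<omega> * (?R \<omega>)\<^sup>2)"
  proof (rule integrable_const_bound)
    show "AE \<omega> in M. norm (W \<omega> * (?R \<omega>)\<^sup>2) \<le> D * (real (C * C))\<^sup>2"
      using W(2) AE_increments_le[of n]
    proof eventually_elim
      case (elim \<omega>)
      define x where "x = real (H n \<omega>) / real (S n \<omega>)"
      have x: "0 \<le> x" "x \<le> 1" "real (K n \<omega>) / real (S n \<omega>) = 1 - x"
        using H_ge_1[of n \<omega>] by (auto simp: x_def S_eq field_simps)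
      define u v where "u = real (A (Suc n) \<omega> * X (Suc n) \<omega>)" and "v = real (B (Suc n) \<omega> * (N (Suc n) \<omega> - X (Suc n) \<omega>))"
      have uv: "0 \<le> u" "u \<le> real (C * C)" "0 \<le> v" "v \<le> real (C * C)"
        using elim(2) unfolding u_def v_def of_nat_le_iff by auto
      have R: "?R \<omega> = u * (1 - x) - v * x"
        unfolding x(3) x_def[symmetric] by (simp add: H_Suc K_Suc u_def v_def)
      have "u * (1 - x) \<le> real (C * C)" "v * x \<le> real (C * C)" "0 \<le> u * (1 - x)" "0 \<le> v * x"
        using uv x order_trans[OF mult_left_le[of "1 - x" u]] order_trans[OF mult_left_le[of x v]] by auto
      then have "\<bar>?R \<omega>\<bar> \<le> real (C * C)" unfolding R by linarith
      then have "\<bar>?R \<omega>\<bar>\<^sup>2 \<le> (real (C * C))\<^sup>2" by (rule power_mono) simp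
      then show ?case using elim(1) by (auto simp: abs_mult intro!: mult_mono)
    qed
    show "(\<lambda>\<omega>. W \<omega> * (?R \<omega>)\<^sup>2) \<in> borel_measurable M"
      unfolding H_Suc K_Suc by measurable
  qed
  have "z\<^sup>2 * (y / real C) ^ C * (\<integral>\<omega>. W \<omega> \<partial>M) = z\<^sup>2 * (\<integral>\<omega>. (y / real C) ^ C * W \<omega> \<partial>M)"
    by simp
  \<comment> \<open>The mass at 0 is the conditional probability of drawing no ball of color A; on
    the support of \<open>W\<close> it is at least \<open>(y / C) ^ C\<close>.\<close>
  also have "\<dots> \<le> z\<^sup>2 * (\<integral>\<omega>. W \<omega> * ?h \<omega> \<partial>M)"
  proof (intro mult_left_mono integral_mono_AE d(1) integrable_mult_right iW)
    show "AE \<omega> in M. (y / real C) ^ C * W \<omega> \<le> W \<omega> * ?h \<omega>"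
      using AE_bounds[of n] AE_N_bounds[of n] Q
    proof eventually_elim
      case (elim \<omega>)
      show ?case
      proof (cases "W \<omega> > 0")
        case True
        with elim(3) have Q': "C \<le> K n \<omega>" "y \<le> real (K n \<omega>) / real (S n \<omega>)" by auto
        have "(y / real C) ^ C \<le> (real (K n \<omega>) / real (S n \<omega>) / real C) ^ C"
          using Q' zy by (intro power_mono divide_right_mono) auto
        also have "\<dots> \<le> ?h \<omega>"
          unfolding S_eq using elim Q' by (intro hypergeometric_mass_0_ge) auto
        finally show ?thesis using nonneg[of \<omega>] by (simp add: mult.commute mult_left_mono)
      next
        case False
        then have "W \<omega> = 0" using nonneg[of \<omega>] by simp
        then show ?thesis by simp
      qed
    qed
  qed simp
  also have "\<dots> = (\<integral>\<omega>. z\<^sup>2 * (W \<omega> * ?Y \<omega>) \<partial>M)"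
    unfolding d(2)[symmetric] by simp
  also have "\<dots> \<le> (\<integral>\<omega>. W \<omega> * (?R \<omega>)\<^sup>2 \<partial>M)"
  proof (intro integral_mono_AE integrable_mult_right iWY iWR)
    show "AE \<omega> in M. z\<^sup>2 * (W \<omega> * ?Y \<omega>) \<le> W \<omega> * (?R \<omega>)\<^sup>2"
      using AE_bounds[of n] AE_N_bounds[of n] Q AE_space
    proof eventually_elim
      case (elim \<omega>)
      show ?case
      proof (cases "W \<omega> > 0 \<and> X (Suc n) \<omega> = 0")
        case True
        define x where "x = real (H n \<omega>) / real (S n \<omega>)"
        have x: "z \<le> x" using elim(3) True by (simp add: x_def)
        have "1 \<le> B (Suc n) \<omega> * N (Suc n) \<omega>"
          using elim reinforcement_pos[of "Suc n" \<omega>] by simp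
        then have BN: "1 \<le> real (B (Suc n) \<omega> * N (Suc n) \<omega>)" by linarith
        \<comment> \<open>Without a draw of color A only the second term of \<open>?R\<close>
          remains, and at least one ball of color B is added, so its size is at least the proportion
          of A.\<close>
        have "?R \<omega> = - (real (B (Suc n) \<omega> * N (Suc n) \<omega>) * x)"
          using True by (simp add: H_Suc K_Suc x_def)
        moreover have "z \<le> real (B (Suc n) \<omega> * N (Suc n) \<omega>) * x"
          using x zy BN mult_right_mono[OF BN, of x] by linarith
        ultimately have "z\<^sup>2 \<le> (?R \<omega>)\<^sup>2"
          using zy by (simp only: power2_minus) (intro power_mono)
        from mult_left_mono[OF this nonneg[of \<omega>]] True elim show ?thesis
          by (simp add: indicator_def mult.commute)
      next
        case False
        then show ?thesis using nonneg[of \<omega>] by (auto simp: indicator_def)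
      qed
    qed
  qed
  finally show ?thesis .
qed

text \<open>The constant has to dominate the initial total \<open>a + b\<close>, the increments of
  each color, at most \<open>C * C\<close>, and \<open>m (Suc n) * N (Suc n)\<close>, also at most
  \<open>C * C\<close>.\<close>

lemma balanced:
  "balanced_reinforcement M F (\<lambda>n \<omega>. real (H n \<omega>)) (\<lambda>n \<omega>. real (K n \<omega>))
    (\<lambda>n \<omega>. m (Suc n) * real (N (Suc n) \<omega>)) (real (a + b + C * C))"
proof unfold_locales
  show "subalgebra M (F n)" for n by (rule subalgebra_urn_filtration)
  show "subalgebra (F (Suc n)) (F n)" for n by (rule filtration_F)
  show "(\<lambda>\<omega>. real (H n \<omega>)) \<in> borel_measurable (F n)" for n
    by (rule measurable_compose[OF measurable_balls_F(1)]) simp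
  show "(\<lambda>\<omega>. real (K n \<omega>)) \<in> borel_measurable (F n)" for n
    by (rule measurable_compose[OF measurable_balls_F(2)]) simp
  show "1 \<le> real (H n \<omega>)" "1 \<le> real (K n \<omega>)" for n \<omega>
    using H_ge_1[of n \<omega>] K_ge_1[of n \<omega>] by simp_all
  show "real (H 0 \<omega>) + real (K 0 \<omega>) \<le> real (a + b + C * C)" for \<omega>
    by (simp add: balls_A_def balls_B_def)
  have inc: "AE \<omega> in M. real (A (Suc n) \<omega> * X (Suc n) \<omega>) \<le> real (a + b + C * C)
      \<and> real (B (Suc n) \<omega> * (N (Suc n) \<omega> - X (Suc n) \<omega>)) \<le> real (a + b + C * C)" for n
    using AE_increments_le[of n] by eventually_elim (simp only: of_nat_le_iff, linarith)
  show "AE \<omega> in M. real (H n \<omega>) \<le> real (H (Suc n) \<omega>) \<and> real (H (Suc n) \<omega>) \<le> real (H n \<omega>) + real (a + b + C * C)" for n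
    using inc[of n] unfolding H_Suc of_nat_add by eventually_elim auto
  show "AE \<omega> in M. real (K n \<omega>) \<le> real (K (Suc n) \<omega>) \<and> real (K (Suc n) \<omega>) \<le> real (K n \<omega>) + real (a + b + C * C)" for n
    using inc[of n] unfolding K_Suc of_nat_add by eventually_elim auto
  show "AE \<omega> in M. real (H n \<omega>) + real (K n \<omega>) + 1 \<le> real (H (Suc n) \<omega>) + real (K (Suc n) \<omega>)" for n
    using AE_bounds[of n] AE_N_bounds[of n] AE_space
  proof eventually_elim
    case (elim \<omega>)
    have AB: "1 \<le> A (Suc n) \<omega>" "1 \<le> B (Suc n) \<omega>"
      using reinforcement_pos[of "Suc n" \<omega>] elim by auto
    \<comment> \<open>Every sampled ball brings at least one new ball, and the sample is not
      empty.\<close>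
    have "1 \<le> X (Suc n) \<omega> + (N (Suc n) \<omega> - X (Suc n) \<omega>)" using elim by simp
    also have "\<dots> \<le> A (Suc n) \<omega> * X (Suc n) \<omega> + B (Suc n) \<omega> * (N (Suc n) \<omega> - X (Suc n) \<omega>)"
      using AB by (intro add_mono) auto
    finally have "H n \<omega> + K n \<omega> + 1 \<le> H (Suc n) \<omega> + K (Suc n) \<omega>"
      unfolding H_Suc K_Suc by linarith
    then show ?case by linarith
  qed
  show "(\<lambda>\<omega>. m (Suc n) * real (N (Suc n) \<omega>)) \<in> borel_measurable M" for n
    using measurable_components(1)[of n] by measurable
  show "AE \<omega> in M. 1 \<le> m (Suc n) * real (N (Suc n) \<omega>) \<and> m (Suc n) * real (N (Suc n) \<omega>) \<le> real (a + b + C * C)" for n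
    using AE_bounds[of n] AE_N_bounds[of n]
  proof eventually_elim
    case (elim \<omega>)
    have "1 * 1 \<le> m (Suc n) * real (N (Suc n) \<omega>)"
      using elim m_bounds[of n] by (intro mult_mono) auto
    moreover have "m (Suc n) * real (N (Suc n) \<omega>) \<le> real C * real C"
      using elim m_bounds[of n] by (intro mult_mono) auto
    ultimately show ?case by simp
  qed
qed (fact integral_increments)+

lemma spreads:
  assumes z: "0 < z" "z < 1"
  shows "balanced_reinforcement.spreads_at M F (\<lambda>n \<omega>. real (H n \<omega>)) (\<lambda>n \<omega>. real (K n \<omega>)) z"
proof -
  interpret bal: balanced_reinforcement M F "\<lambda>n \<omega>. real (H n \<omega>)" "\<lambda>n \<omega>. real (K n \<omega>)"
    "\<lambda>n \<omega>. m (Suc n) * real (N (Suc n) \<omega>)" "real (a + b + C * C)"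
    by (rule balanced)
  have s: "bal.s n \<omega> = real (S n \<omega>)" for n \<omega>
    by (simp add: bal.s_def S_eq)
  \<comment> \<open>Within \<open>\<eta>\<close> of \<open>z\<close> the proportion of A is at least
    \<open>z / 2\<close> and that of B at least \<open>y\<close>; these give \<open>g\<close>
    through \<open>square_increment_ge\<close>.\<close>
  define \<eta> where "\<eta> = min (z / 2) ((1 - z) / 2)"
  define y where "y = (1 - z) / 2"
  define g where "g = (z / 2)\<^sup>2 * (y / real C) ^ C"
  have "real C \<ge> 1" using m_bounds[of 0] by linarith
  then have pos: "\<eta> > 0" "y > 0" "g > 0"
    using z by (auto simp: \<eta>_def y_def g_def)
  \<comment> \<open>The bound on the mass at 0 needs \<open>C\<close> balls of color B; there are at
    least \<open>y * n\<close> of them while the proportion is near \<open>z\<close>.\<close>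
  obtain n0 :: nat where n0: "real n0 \<ge> real C / y"
    using real_arch_simple by blast
  have "g * (\<integral>\<omega>. W \<omega> * indicator (cball z \<eta>) (bal.Z n \<omega>) \<partial>M) \<le> (\<integral>\<omega>. W \<omega> * (bal.R n \<omega>)\<^sup>2 \<partial>M)"
    if n: "n \<ge> n0" and W: "bal.weight n W" and nonneg: "\<forall>\<omega>. 0 \<le> W \<omega>" for n W
  proof -
    define V where "V = (\<lambda>\<omega>. W \<omega> * indicator (cball z \<eta>) (bal.Z n \<omega>))"
    have V: "bal.weight n V"
      unfolding V_def by (intro bal.weight_mult W bal.weight_indicator) simp
    then obtain D where D: "V \<in> borel_measurable (F n)" "AE \<omega> in M. \<bar>V \<omega>\<bar> \<le> D"
      by (auto simp: bal.weight_def)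
    have Q: "AE \<omega> in M. V \<omega> > 0 \<longrightarrow> C \<le> K n \<omega> \<and> z / 2 \<le> real (H n \<omega>) / real (S n \<omega>) \<and> y \<le> real (K n \<omega>) / real (S n \<omega>)"
      using bal.AE_steps
    proof eventually_elim
      case (elim \<omega>)
      have sn: "real n + 1 \<le> real (S n \<omega>)" using elim[rule_format, of n] by (simp add: s)
      show ?case
      proof
        assume "V \<omega> > 0"
        then have "bal.Z n \<omega> \<in> cball z \<eta>"
          by (cases "bal.Z n \<omega> \<in> cball z \<eta>") (simp_all add: V_def)
        then have "\<bar>z - bal.Z n \<omega>\<bar> \<le> \<eta>"
          by (simp add: dist_real_def)
        then have Z: "z / 2 \<le> bal.Z n \<omega>" "y \<le> 1 - bal.Z n \<omega>"
          by (auto simp: \<eta>_def y_def abs_le_iff field_simps min_def split: if_splits)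
        have "real C \<le> y * real n0" using n0 pos by (simp add: field_simps)
        also have "\<dots> \<le> (1 - bal.Z n \<omega>) * real (S n \<omega>)"
          using Z(2) pos sn n by (intro mult_mono) auto
        also have "\<dots> = real (K n \<omega>)"
          unfolding bal.one_minus_Z s using sn by simp
        finally have "C \<le> K n \<omega>" by simp
        with Z show "C \<le> K n \<omega> \<and> z / 2 \<le> real (H n \<omega>) / real (S n \<omega>) \<and> y \<le> real (K n \<omega>) / real (S n \<omega>)"
          unfolding bal.one_minus_Z by (simp add: bal.Z_def s)
      qed
    qed
    have R: "bal.R n \<omega> = (real (H (Suc n) \<omega>) - real (H n \<omega>)) * (real (K n \<omega>) / real (S n \<omega>))
       - (real (K (Suc n) \<omega>) - real (K n \<omega>)) * (real (H n \<omega>) / real (S n \<omega>))" for \<omega>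
      unfolding bal.R_def bal.one_minus_Z by (simp only: bal.Z_def s)
    have "g * (\<integral>\<omega>. V \<omega> \<partial>M) \<le> (\<integral>\<omega>. V \<omega> * (bal.R n \<omega>)\<^sup>2 \<partial>M)"
      unfolding g_def R using nonneg z pos by (intro square_increment_ge[OF D _ Q]) (auto simp: V_def)
    also have "\<dots> \<le> (\<integral>\<omega>. W \<omega> * (bal.R n \<omega>)\<^sup>2 \<partial>M)"
    proof (rule bal.integral_weight_mono)
      show "bal.weight (Suc n) (\<lambda>\<omega>. V \<omega> * (bal.R n \<omega>)\<^sup>2)"
        by (intro bal.weight_mult bal.weight_power bal.weight_R bal.weight_mono[OF V]) simp_all
      show "bal.weight (Suc n) (\<lambda>\<omega>. W \<omega> * (bal.R n \<omega>)\<^sup>2)"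
        by (intro bal.weight_mult bal.weight_power bal.weight_R bal.weight_mono[OF W]) simp_all
      show "AE \<omega> in M. V \<omega> * (bal.R n \<omega>)\<^sup>2 \<le> W \<omega> * (bal.R n \<omega>)\<^sup>2"
        using nonneg by (intro AE_I2 mult_right_mono) (auto simp: V_def indicator_def)
    qed
    finally show ?thesis unfolding V_def .
  qed
  with pos show ?thesis unfolding bal.spreads_at_def by blast
qed

theorem proportion_limit_no_atoms:
  "\<exists>Z \<in> borel_measurable M. (AE \<omega> in M. (\<lambda>n. proportion_A a b N X A B n \<omega>) \<longlonglongrightarrow> Z \<omega>) \<and>
    (\<forall>z \<in> {0..1::real}. measure M {\<omega> \<in> space M. Z \<omega> = z} = 0)"
proof -
  interpret bal: balanced_reinforcement M F "\<lambda>n \<omega>. real (H n \<omega>)" "\<lambda>n \<omega>. real (K n \<omega>)"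
    "\<lambda>n \<omega>. m (Suc n) * real (N (Suc n) \<omega>)" "real (a + b + C * C)"
    by (rule balanced)
  have "bal.Z n \<omega> = proportion_A a b N X A B n \<omega>" for n \<omega>
    by (simp add: bal.Z_def bal.s_def proportion_A_def S_eq)
  then have "AE \<omega> in M. (\<lambda>n. proportion_A a b N X A B n \<omega>) \<longlonglongrightarrow> bal.Z_lim \<omega>"
    using bal.AE_tendsto_Z_lim by simp
  moreover have "measure M {\<omega> \<in> space M. bal.Z_lim \<omega> = z} = 0" if "z \<in> {0..1}" for z
  proof -
    from that consider "z = 0" | "z = 1" | "0 < z" "z < 1" by fastforce
    then show ?thesis
      using bal.Z_lim_no_atom_0 bal.Z_lim_no_atom_1 bal.Z_lim_no_atom[OF spreads] by cases auto
  qed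
  ultimately show ?thesis using bal.measurable_Z_lim by blast
qed

end

theorem theorem3p15:
  fixes M :: "'w measure"
    and a b C :: nat
    and N X A B :: "nat \<Rightarrow> 'w \<Rightarrow> nat"
    and N_lim Q_lim :: "'w \<Rightarrow> real"
    and m :: "nat \<Rightarrow> real"
    and m_lim q_A q_B q_AB :: real
  assumes urn: "hypergeometric_urn M a b N X A B"
    and bounded: "\<And>n. n \<ge> 1 \<Longrightarrow> AE \<omega> in M. max (A n \<omega>) (max (B n \<omega>) (N n \<omega>)) \<le> C"
    and mean_A: "\<And>n. n \<ge> 1 \<Longrightarrow> (\<integral>\<omega>. real (A n \<omega>) \<partial>M) = m n"
    and mean_B: "\<And>n. n \<ge> 1 \<Longrightarrow> (\<integral>\<omega>. real (B n \<omega>) \<partial>M) = m n"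
    and mean_lim: "m \<longlonglongrightarrow> m_lim" "m_lim > 0"
    and N_lim: "N_lim \<in> borel_measurable M" "AE \<omega> in M. N_lim \<omega> > 0"
      "AE \<omega> in M. (\<lambda>n. real_cond_exp M (urn_filtration M N X A B n)
          (\<lambda>\<omega>. real (N (Suc n) \<omega>)) \<omega>) \<longlonglongrightarrow> N_lim \<omega>"
    and Q_lim: "Q_lim \<in> borel_measurable M" "AE \<omega> in M. Q_lim \<omega> > 0"
      "AE \<omega> in M. (\<lambda>n. real_cond_exp M (urn_filtration M N X A B n)
          (\<lambda>\<omega>. (real (N (Suc n) \<omega>))\<^sup>2) \<omega>) \<longlonglongrightarrow> Q_lim \<omega>"
    and q_A: "(\<lambda>n. \<integral>\<omega>. (real (A n \<omega>))\<^sup>2 \<partial>M) \<longlonglongrightarrow> q_A" "q_A > 0"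
    and q_B: "(\<lambda>n. \<integral>\<omega>. (real (B n \<omega>))\<^sup>2 \<partial>M) \<longlonglongrightarrow> q_B" "q_B > 0"
    and q_AB: "(\<lambda>n. \<integral>\<omega>. real (A n \<omega>) * real (B n \<omega>) \<partial>M) \<longlonglongrightarrow> q_AB" "q_AB > 0"
  shows "\<exists>Z \<in> borel_measurable M.
    (AE \<omega> in M. (\<lambda>n. proportion_A a b N X A B n \<omega>) \<longlonglongrightarrow> Z \<omega>) \<and>
    (\<forall>z \<in> {0..1::real}. measure M {\<omega> \<in> space M. Z \<omega> = z} = 0)"
proof -
  interpret hypergeometric_urn M a b N X A B by (rule urn)
  interpret bounded_hypergeometric_urn M a b N X A B C m
    by unfold_locales (fact bounded mean_A mean_B)+
  show ?thesis by (rule proportion_limit_no_atoms)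
qed

end
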